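(* Let $p>1$, let $(M,g)$ be a complete Riemannian manifold and let $\Omega\subset M$ be an open set. Let $\rho\in W^{1,p}_{loc}(\Omega)$ be a nonnegative function with $-\Delta_p\rho\ge0$ on $\Omega$ in weak sense. Let $s>0$ and $a>1$. Then for every $u\in C_0^1(\Omega)$ $$\int_\Omega|u|^s\,dv_g\le\left(\frac{p}{p-1}\right)^{p/a}\left(\int_\Omega|\nabla u|^p\,dv_g\right)^{1/a}\left(\int_\Omega|u|^{\frac{as-p}{a-1}}\frac{\rho^{p(a'-1)}}{|\nabla\rho|^{p(a'-1)}}\,dv_g\right)^{1/a'}.$$ In particular, if $\rho=d^\alpha$ for some $\alpha\ne0$ with $|\nabla d|=1$, then for every $u\in C_0^1(\Omega)$ $$\int_\Omega|u|^s\,dv_g\le\left(\frac{p}{|\alpha|(p-1)}\right)^{p/a}\left(\int_\Omega|\nabla u|^p\,dv_g\right)^{1/a}\left(\int_\Omega|u|^{\frac{as-p}{a-1}}\,d^{\,p(a'-1)}\,dv_g\right)^{1/a'}.$$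
   Context: $a'=a/(a-1)$. $dv_g$, $\nabla$, $\mathrm{div}$ are the volume form, gradient and divergence of $g$; $\Delta_p u=\mathrm{div}(|\nabla u|^{p-2}\nabla u)$. $C_0^1(\Omega)$ denotes compactly supported $C^1$ functions in $\Omega$. "$-\Delta_p\rho\ge0$ on $\Omega$ in weak sense" (i.e. $\rho$ is $p$-superharmonic) means $\int_\Omega|\nabla\rho|^{p-2}(\nabla\rho\cdot\nabla\varphi)\,dv_g\ge0$ for every nonnegative $\varphi\in C_0^1(\Omega)$. The quotient $\rho/|\nabla\rho|$ is understood as $+\infty$ where $\nabla\rho=0$ (with $0\cdot\infty=0$ in integrands), negative powers of $0$ are $+\infty$, and each inequality is asserted whenever the last integral on its right-hand side is finite (otherwise the right-hand side is regarded as $+\infty$). *)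

theory Defs
  imports "HOL-Analysis.Analysis"
begin

section \<open>Functions of class \<open>C\<^sup>k\<close> on open subsets of Euclidean space\<close>

text \<open>Used for open \<open>S\<close> in a finite-dimensional space only, where continuity of all directional
  derivatives of order at most \<open>k\<close> amounts to the usual notion of class \<open>C\<^sup>k\<close>.\<close>

primrec Ck_on :: "nat \<Rightarrow> ('a::euclidean_space \<Rightarrow> 'b::real_normed_vector) \<Rightarrow> 'a set \<Rightarrow> bool" where
  "Ck_on 0 f S \<longleftrightarrow> continuous_on S f"
| "Ck_on (Suc k) f S \<longleftrightarrow>
     f differentiable_on S \<and> (\<forall>v. Ck_on k (\<lambda>x. frechet_derivative f (at x) v) S)"

definition smooth_on :: "('a::euclidean_space \<Rightarrow> 'b::real_normed_vector) \<Rightarrow> 'a set \<Rightarrow> bool" where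
  "smooth_on f S \<longleftrightarrow> (\<forall>k. Ck_on k f S)"

definition compact_support_in :: "('a::topological_space \<Rightarrow> real) \<Rightarrow> 'a set \<Rightarrow> bool" where
  "compact_support_in f S \<longleftrightarrow> compact (closure {x. f x \<noteq> 0}) \<and> closure {x. f x \<noteq> 0} \<subseteq> S"


section \<open>Riemannian manifolds\<close>

text \<open>The points of the manifold are the elements of the type \<open>'m\<close>; its dimension is \<open>CARD('n)\<close>.
  Tensor fields are given by their components in the charts of an atlas, subject to the usual
  transformation laws. A chart is a pair of its domain and its coordinate map; values of the
  coordinate map, or of components with respect to the chart, outside the domain are irrelevant.\<close>

type_synonym ('m, 'n) chart = "'m set \<times> ('m \<Rightarrow> real ^ 'n)"
type_synonym ('m, 'n) vfield = "('m, 'n) chart \<Rightarrow> 'm \<Rightarrow> real ^ 'n"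
type_synonym ('m, 'n) metric = "('m, 'n) chart \<Rightarrow> 'm \<Rightarrow> real ^ 'n ^ 'n"

definition chart_inv :: "('m, 'n) chart \<Rightarrow> real ^ 'n \<Rightarrow> 'm" where
  "chart_inv c = inv_into (fst c) (snd c)"

definition smooth_atlas ::
  "('m::{t2_space, second_countable_topology}, 'n::finite) chart set \<Rightarrow> bool" where
  "smooth_atlas A \<longleftrightarrow>
     (\<Union>c\<in>A. fst c) = UNIV \<and>
     (\<forall>c\<in>A. open (fst c) \<and> open (snd c ` fst c) \<and>
        homeomorphism (fst c) (snd c ` fst c) (snd c) (chart_inv c)) \<and>
     (\<forall>c\<in>A. \<forall>c'\<in>A. smooth_on (snd c' \<circ> chart_inv c) (snd c ` (fst c \<inter> fst c')))"

definition transition_jacobian ::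
  "('m, 'n::finite) chart \<Rightarrow> ('m, 'n) chart \<Rightarrow> 'm \<Rightarrow> real ^ 'n ^ 'n" where
  "transition_jacobian c c' m = matrix (frechet_derivative (snd c' \<circ> chart_inv c) (at (snd c m)))"

definition riemannian_metric ::
  "('m::{t2_space, second_countable_topology}, 'n::finite) chart set \<Rightarrow> ('m, 'n) metric \<Rightarrow> bool" where
  "riemannian_metric A g \<longleftrightarrow>
     (\<forall>c\<in>A. \<forall>i j. smooth_on (\<lambda>x. g c (chart_inv c x) $ i $ j) (snd c ` fst c)) \<and>
     (\<forall>c\<in>A. \<forall>m\<in>fst c. transpose (g c m) = g c m \<and> (\<forall>v. v \<noteq> 0 \<longrightarrow> 0 < v \<bullet> (g c m *v v))) \<and>
     (\<forall>c\<in>A. \<forall>c'\<in>A. \<forall>m\<in>fst c \<inter> fst c'.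
        g c m = transpose (transition_jacobian c c' m) ** g c' m ** transition_jacobian c c' m)"

text \<open>Pointwise quantities built from vector fields do not depend on the chart they are computed
  in, so an arbitrary chart around each point is used.\<close>

definition chart_at :: "('m, 'n) chart set \<Rightarrow> 'm \<Rightarrow> ('m, 'n) chart" where
  "chart_at A m = (SOME c. c \<in> A \<and> m \<in> fst c)"

definition vector_field_on ::
  "('m, 'n::finite) chart set \<Rightarrow> 'm set \<Rightarrow> ('m, 'n) vfield \<Rightarrow> bool" where
  "vector_field_on A \<Omega> X \<longleftrightarrow>
     (\<forall>c\<in>A. \<forall>c'\<in>A. \<forall>m\<in>fst c \<inter> fst c' \<inter> \<Omega>. X c' m = transition_jacobian c c' m *v X c m)"

definition g_inner ::
  "('m, 'n::finite) chart set \<Rightarrow> ('m, 'n) metric \<Rightarrow> ('m, 'n) vfield \<Rightarrow> ('m, 'n) vfield \<Rightarrow> 'm \<Rightarrow> real" where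
  "g_inner A g X Y m = (let c = chart_at A m in X c m \<bullet> (g c m *v Y c m))"

definition g_norm ::
  "('m, 'n::finite) chart set \<Rightarrow> ('m, 'n) metric \<Rightarrow> ('m, 'n) vfield \<Rightarrow> 'm \<Rightarrow> real" where
  "g_norm A g X m = sqrt (g_inner A g X X m)"

text \<open>The gradient with components \<open>g\<^sup>i\<^sup>j \<partial>\<^sub>j u\<close>.\<close>

definition partial :: "(real ^ 'n \<Rightarrow> real) \<Rightarrow> 'n \<Rightarrow> real ^ 'n::finite \<Rightarrow> real" where
  "partial f i x = frechet_derivative f (at x) (axis i 1)"

definition grad :: "('m, 'n::finite) metric \<Rightarrow> ('m \<Rightarrow> real) \<Rightarrow> ('m, 'n) vfield" where
  "grad g u c m = matrix_inv (g c m) *v (\<chi> i. partial (u \<circ> chart_inv c) i (snd c m))"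


subsection \<open>Completeness\<close>

text \<open>Completeness is that of the Riemannian distance, the infimum of the lengths of piecewise
  \<open>C\<^sup>1\<close> curves. As \<open>M\<close> need not be connected, the distance may be infinite.\<close>

definition piecewise_C1_curve ::
  "('m::{t2_space, second_countable_topology}, 'n::finite) chart set \<Rightarrow> (real \<Rightarrow> 'm) \<Rightarrow> bool" where
  "piecewise_C1_curve A \<gamma> \<longleftrightarrow> continuous_on {0..1} \<gamma> \<and>
     (\<exists>S. finite S \<and>
        (\<forall>c\<in>A. (snd c \<circ> \<gamma>) C1_differentiable_on ({t\<in>{0..1}. \<gamma> t \<in> fst c} - S)))"

definition curve_speed ::
  "('m, 'n::finite) chart set \<Rightarrow> ('m, 'n) metric \<Rightarrow> (real \<Rightarrow> 'm) \<Rightarrow> real \<Rightarrow> real" where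
  "curve_speed A g \<gamma> t =
     (let c = chart_at A (\<gamma> t); v = vector_derivative (snd c \<circ> \<gamma>) (at t)
      in sqrt (v \<bullet> (g c (\<gamma> t) *v v)))"

definition curve_length ::
  "('m, 'n::finite) chart set \<Rightarrow> ('m, 'n) metric \<Rightarrow> (real \<Rightarrow> 'm) \<Rightarrow> ennreal" where
  "curve_length A g \<gamma> = (\<integral>\<^sup>+ t\<in>{0..1}. ennreal (curve_speed A g \<gamma> t) \<partial>lborel)"

definition g_dist ::
  "('m::{t2_space, second_countable_topology}, 'n::finite) chart set \<Rightarrow> ('m, 'n) metric \<Rightarrow>
     'm \<Rightarrow> 'm \<Rightarrow> ennreal" where
  "g_dist A g x y =
     (INF \<gamma>\<in>{\<gamma>. piecewise_C1_curve A \<gamma> \<and> \<gamma> 0 = x \<and> \<gamma> 1 = y}. curve_length A g \<gamma>)"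

definition g_complete ::
  "('m::{t2_space, second_countable_topology}, 'n::finite) chart set \<Rightarrow> ('m, 'n) metric \<Rightarrow> bool" where
  "g_complete A g \<longleftrightarrow>
     (\<forall>x :: nat \<Rightarrow> 'm.
        (\<forall>e>0. \<exists>N. \<forall>j\<ge>N. \<forall>k\<ge>N. g_dist A g (x j) (x k) < e) \<longrightarrow>
        (\<exists>l. (\<lambda>k. g_dist A g (x k) l) \<longlonglongrightarrow> 0))"

definition complete_riemannian_manifold ::
  "('m::{t2_space, second_countable_topology}, 'n::finite) chart set \<Rightarrow> ('m, 'n) metric \<Rightarrow> bool" where
  "complete_riemannian_manifold A g \<longleftrightarrow>
     smooth_atlas A \<and> riemannian_metric A g \<and> g_complete A g"


subsection \<open>The volume measure\<close>

text \<open>In every chart the volume is \<open>sqrt (det g\<^sub>i\<^sub>j) dx\<close>. Since countably many charts cover the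
  manifold, this determines the Borel measure \<open>dv\<close> uniquely.\<close>

definition riemannian_volume ::
  "('m::{t2_space, second_countable_topology}, 'n::finite) chart set \<Rightarrow> ('m, 'n) metric \<Rightarrow>
     'm measure \<Rightarrow> bool" where
  "riemannian_volume A g dv \<longleftrightarrow> sets dv = sets borel \<and>
     (\<forall>c\<in>A. \<forall>B\<in>sets borel. B \<subseteq> fst c \<longrightarrow>
        emeasure dv B =
          (\<integral>\<^sup>+ x\<in>snd c ` B. ennreal (sqrt (det (g c (chart_inv c x)))) \<partial>lborel))"


section \<open>Function spaces\<close>

text \<open>\<open>C01 A \<Omega>\<close> is \<open>C\<^sub>0\<^sup>1(\<Omega>)\<close>; its elements are extended by \<open>0\<close> to the whole manifold.\<close>

definition C01 ::
  "('m::{t2_space, second_countable_topology}, 'n::finite) chart set \<Rightarrow> 'm set \<Rightarrow> ('m \<Rightarrow> real) set" where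
  "C01 A \<Omega> = {u. compact_support_in u \<Omega> \<and> (\<forall>c\<in>A. Ck_on 1 (u \<circ> chart_inv c) (snd c ` fst c))}"

definition Lp_loc :: "'m::topological_space measure \<Rightarrow> real \<Rightarrow> 'm set \<Rightarrow> ('m \<Rightarrow> real) \<Rightarrow> bool" where
  "Lp_loc dv p \<Omega> f \<longleftrightarrow> f \<in> borel_measurable (restrict_space borel \<Omega>) \<and>
     (\<forall>K. compact K \<and> K \<subseteq> \<Omega> \<longrightarrow> (\<integral>\<^sup>+ x\<in>K. ennreal (\<bar>f x\<bar> powr p) \<partial>dv) < \<infinity>)"

text \<open>\<open>X\<close> is the weak gradient of \<open>f\<close>: in every chart the functions \<open>g\<^sub>i\<^sub>j X\<^sup>j\<close> are the weak partial
  derivatives \<open>\<partial>\<^sub>i f\<close>.\<close>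

definition has_weak_gradient ::
  "('m::{t2_space, second_countable_topology}, 'n::finite) chart set \<Rightarrow> ('m, 'n) metric \<Rightarrow>
     'm measure \<Rightarrow> 'm set \<Rightarrow> ('m \<Rightarrow> real) \<Rightarrow> ('m, 'n) vfield \<Rightarrow> bool" where
  "has_weak_gradient A g dv \<Omega> f X \<longleftrightarrow>
     vector_field_on A \<Omega> X \<and>
     (\<forall>c\<in>A. X c \<in> borel_measurable (restrict_space borel (fst c \<inter> \<Omega>))) \<and>
     Lp_loc dv 1 \<Omega> f \<and> Lp_loc dv 1 \<Omega> (g_norm A g X) \<and>
     (\<forall>c\<in>A. \<forall>i \<psi>. Ck_on 1 \<psi> UNIV \<and> compact_support_in \<psi> (snd c ` (fst c \<inter> \<Omega>)) \<longrightarrow>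
        (LINT x:snd c ` (fst c \<inter> \<Omega>)|lborel. f (chart_inv c x) * partial \<psi> i x) =
        - (LINT x:snd c ` (fst c \<inter> \<Omega>)|lborel.
             (g c (chart_inv c x) *v X c (chart_inv c x)) $ i * \<psi> x))"

text \<open>\<open>f \<in> W\<^sup>1\<^sup>,\<^sup>p\<^sub>l\<^sub>o\<^sub>c(\<Omega>)\<close>, with weak gradient \<open>X\<close> (unique up to null sets).\<close>

definition W1p_loc ::
  "('m::{t2_space, second_countable_topology}, 'n::finite) chart set \<Rightarrow> ('m, 'n) metric \<Rightarrow>
     'm measure \<Rightarrow> real \<Rightarrow> 'm set \<Rightarrow> ('m \<Rightarrow> real) \<Rightarrow> ('m, 'n) vfield \<Rightarrow> bool" where
  "W1p_loc A g dv p \<Omega> f X \<longleftrightarrow>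
     has_weak_gradient A g dv \<Omega> f X \<and> Lp_loc dv p \<Omega> f \<and> Lp_loc dv p \<Omega> (g_norm A g X)"

text \<open>\<open>-\<Delta>\<^sub>p f \<ge> 0\<close> on \<open>\<Omega>\<close> in the weak sense, where \<open>X\<close> is the weak gradient of \<open>f\<close>. The integrand
  \<open>|X|\<^sup>p\<^sup>-\<^sup>2 X \<cdot> \<nabla>\<phi>\<close> is \<open>0\<close> where \<open>X = 0\<close>, also for \<open>p < 2\<close>.\<close>

definition p_superharmonic ::
  "('m::{t2_space, second_countable_topology}, 'n::finite) chart set \<Rightarrow> ('m, 'n) metric \<Rightarrow>
     'm measure \<Rightarrow> real \<Rightarrow> 'm set \<Rightarrow> ('m, 'n) vfield \<Rightarrow> bool" where
  "p_superharmonic A g dv p \<Omega> X \<longleftrightarrow>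
     (\<forall>\<phi>\<in>C01 A \<Omega>. (\<forall>x. 0 \<le> \<phi> x) \<longrightarrow>
        0 \<le> (LINT x:\<Omega>|dv. g_norm A g X x powr (p - 2) * g_inner A g X (grad g \<phi>) x))"


section \<open>Extended powers and quotients\<close>

text \<open>Negative powers of \<open>0\<close> are \<open>\<infinity>\<close>, and \<open>r / 0\<close> is \<open>\<infinity>\<close> even for \<open>r = 0\<close>, unlike for the operations
  on the reals. Products follow the convention \<open>0 * \<infinity> = 0\<close> of type \<^typ>\<open>ennreal\<close>.\<close>

definition epow :: "ennreal \<Rightarrow> real \<Rightarrow> ennreal" where
  "epow x q =
     (if q = 0 then 1
      else if x = 0 then (if q > 0 then 0 else \<infinity>)
      else if x = \<infinity> then (if q > 0 then \<infinity> else 0)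
      else ennreal (enn2real x powr q))"

definition equot :: "real \<Rightarrow> real \<Rightarrow> ennreal" where
  "equot r t = (if t = 0 then \<infinity> else ennreal (r / t))"

end

theory Submission
  imports Defs
begin

text \<open>Testing \<open>- \<Delta>\<^sub>p \<rho> \<ge> 0\<close> with \<open>|u|\<^sup>p / (\<rho> + \<epsilon>)\<^sup>p\<^sup>-\<^sup>1\<close>, estimating the mixed term by Young's inequality and letting
  \<open>\<epsilon> \<rightarrow> 0\<close> gives the Hardy inequality
  \<open>\<integral> |u|\<^sup>p |\<nabla>\<rho>|\<^sup>p / \<rho>\<^sup>p \<le> (p / (p - 1))\<^sup>p \<integral> |\<nabla>u|\<^sup>p\<close>, and the theorem follows from it by Hoelder's inequality with
  exponents \<open>a\<close> and \<open>a'\<close>. The test function is not of class \<open>C\<^sup>1\<close>, so \<open>\<rho>\<close> is first mollified in a chart; this is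
  harmless because the tested quantity is additive in \<open>w = |u|\<^sup>p\<close>, which may therefore be split into pieces supported
  in single charts. For \<open>\<rho> = d\<^sup>\<alpha>\<close> the weak gradients are related by \<open>|\<nabla>\<rho>| = |\<alpha>| d\<^sup>\<alpha>\<^sup>-\<^sup>1\<close>, where \<open>d > 0\<close>
  almost everywhere since \<open>\<nabla>d\<close> vanishes almost everywhere on \<open>{d = 0}\<close>.\<close>

section \<open>Translation continuity in \<open>L\<^sup>1\<close> and mollification\<close>

text \<open>Only the denominator is mollified: the field \<open>X\<close> in the weak inequality
  stays the true gradient, because superharmonicity speaks of \<open>X\<close> alone. In the limit,
  the products of \<open>|X|^(p-1)\<close> with the gradients of the mollified functions have no
  integrable majorant common to all k. By Jensen's inequality the p-th power of such a gradient lies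
  below the mollification of \<open>|G|^p\<close>, where \<open>G\<close> is the Euclidean weak
  gradient; these majorants converge in L^1, and dominated convergence with varying majorants
  suffices. The shift by \<epsilon> keeps the negative power bounded, as nonnegative kernels keep
  the mollified functions nonnegative. Young's inequality must not use up the negative term
  \<open>|u|^p |X|^p / (\<rho> + \<epsilon>)^p\<close>; it takes the share (p - 1) / p of it, the
  optimal one, whence the constant. The limit in \<epsilon> yields more than the inequality: \<rho>
  is positive at almost every point where u and \<open>X\<close> are both nonzero. Points with u
  nonzero and \<open>X\<close> zero are excluded at the end, up to a null set, by finiteness of the
  integral on the right, since the quotient is infinite there.\<close>

lemma L1_translation_continuous:
  fixes f :: "'a::euclidean_space \<Rightarrow> 'b::euclidean_space"
  assumes "integrable lborel f" "0 < (e::real)"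
  shows "\<exists>\<delta>>0. \<forall>h. norm h < \<delta> \<longrightarrow> (\<integral>\<^sup>+x. norm (f (x + h) - f x) \<partial>lborel) \<le> e"
  using assms
proof (induction arbitrary: e)
  case (base A c)
  then have A[measurable]: "A \<in> sets borel" "emeasure lborel A < \<infinity>" by auto
  \<comment> \<open>The indicator of \<open>A\<close> and its translate differ only where
    \<open>x\<close> or \<open>x + h\<close> lies in \<open>U - K\<close>, a set of measure at most
    \<open>2 * r\<close>. The two occurrences cost \<open>norm c * (2 * (2 * r))\<close> together;
    the summand 1 keeps the quotient defined for \<open>c = 0\<close>.\<close>
  define r where "r = e / (4 * (norm c + 1))"
  have r: "r > 0" "norm c * (2 * (2 * r)) \<le> e"
    using base.prems by (auto simp: r_def divide_simps add_nonneg_pos add_pos_nonneg)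
  obtain U where U: "open U" "A \<subseteq> U" "emeasure lborel (U - A) < r"
    using outer_regular_lborel[OF A(1) r(1)] by auto
  \<comment> \<open>Inner regularity is applied to a finite measure. Restricting
    \<open>lborel\<close> to \<open>A\<close> provides one and changes nothing on subsets of
    \<open>A\<close>.\<close>
  define M where "M = density lborel (indicator A)"
  have em: "emeasure M B = emeasure lborel (A \<inter> B)" if "B \<in> sets borel" for B
    unfolding M_def using that by (simp add: emeasure_density nn_integral_set_ennreal flip: indicator_inter_arith)
  have K: "emeasure M A = (SUP K \<in> {K. K \<subseteq> A \<and> compact K}. emeasure M K)"
    using A by (intro inner_regular) (auto simp: M_def em[unfolded M_def] space_borel)
  have "\<exists>K. K \<subseteq> A \<and> compact K \<and> emeasure lborel A \<le> emeasure lborel K + r"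
  proof (cases "emeasure lborel A = 0")
    case True then show ?thesis by (intro exI[of _ "{}"]) auto
  next
    case False
    have "emeasure lborel A - r < emeasure lborel A"
      using False A(2) r
      by (cases "emeasure lborel A") (auto simp: ennreal_minus intro!: ennreal_lessI)
    also have "emeasure lborel A = (SUP K \<in> {K. K \<subseteq> A \<and> compact K}. emeasure M K)"
      using K em[OF A(1)] by simp
    finally obtain K where K: "K \<subseteq> A" "compact K" "emeasure lborel A - r < emeasure M K"
      by (auto simp: less_SUP_iff)
    have "emeasure M K = emeasure lborel K" using K em[of K]
      by (simp add: Int_absorb1 borel_compact)
    with K show ?thesis by (auto simp: ennreal_minus_le_iff add.commute intro!: exI[of _ K] dest!: less_imp_le)
  qed
  then obtain K where K: "K \<subseteq> A" "compact K" "emeasure lborel A \<le> emeasure lborel K + r" by blast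
  have [measurable]: "K \<in> sets borel" "U \<in> sets borel" using K U by (auto simp: borel_compact)
  have AK: "emeasure lborel (A - K) \<le> r"
  proof -
    have "emeasure lborel (A - K) = emeasure lborel A - emeasure lborel K"
      using A K emeasure_mono[of K A lborel] by (intro emeasure_Diff) (auto simp: top_unique)
    moreover have "emeasure lborel A \<noteq> top" using A by simp
    ultimately show ?thesis using K by (simp add: ennreal_minus_le_iff add.commute)
  qed
  have UK: "emeasure lborel (U - K) \<le> ennreal (2 * r)"
  proof -
    have "emeasure lborel (U - K) \<le> emeasure lborel (U - A) + emeasure lborel (A - K)"
      using K U by (intro order_trans[OF _ emeasure_subadditive] emeasure_mono) auto
    also have "\<dots> \<le> ennreal r + ennreal r" using U AK by (intro add_mono) auto
    finally show ?thesis using r by (simp flip: ennreal_plus)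
  qed
  obtain \<delta> where \<delta>: "\<delta> > 0" "\<And>x y. x \<in> K \<Longrightarrow> y \<notin> U \<Longrightarrow> \<delta> \<le> dist x y"
    using separate_compact_closed[of K "- U"] K U by (meson ComplI Compl_disjoint closed_Compl disjoint_eq_subset_Compl double_compl order_trans)
  show ?case
  proof (intro exI[of _ \<delta>] conjI allI impI)
    fix h :: 'a assume h: "norm h < \<delta>"
    have "norm (indicator A (x + h) *\<^sub>R c - indicator A x *\<^sub>R c) \<le>
        norm c * (indicator (U - K) x + indicator (U - K) (x + h))" for x
    proof -
      have "x \<in> K \<Longrightarrow> x + h \<in> U" "x + h \<in> K \<Longrightarrow> x \<in> U"
        using \<delta>(2)[of x "x + h"] \<delta>(2)[of "x + h" x] h by (force simp: dist_norm)+
      then show ?thesis using K U by (auto simp: indicator_def)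
    qed
    then have "(\<integral>\<^sup>+x. norm (indicator A (x + h) *\<^sub>R c - indicator A x *\<^sub>R c) \<partial>lborel)
      \<le> (\<integral>\<^sup>+x. ennreal (norm c) * (indicator (U - K) x + indicator (U - K) (h + x)) \<partial>lborel)"
      by (intro nn_integral_mono) (auto simp: add.commute[of h] simp flip: ennreal_indicator ennreal_plus ennreal_mult intro!: ennreal_leI)
    also have "\<dots> = ennreal (norm c) * ((\<integral>\<^sup>+x. indicator (U - K) x \<partial>lborel) + (\<integral>\<^sup>+x. indicator (U - K) (h + x) \<partial>lborel))"
      by (subst nn_integral_cmult) (auto simp: nn_integral_add)
    also have "(\<integral>\<^sup>+x. indicator (U - K) (h + x) \<partial>lborel) = (\<integral>\<^sup>+x. indicator (U - K) x \<partial>lborel)"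
      by (subst (2) lborel_distr_plus[of h, symmetric], subst nn_integral_distr) auto
    also have "ennreal (norm c) * ((\<integral>\<^sup>+x. indicator (U - K) x \<partial>lborel) + (\<integral>\<^sup>+x. indicator (U - K) x \<partial>lborel))
       \<le> ennreal (norm c) * (ennreal (2 * r) + ennreal (2 * r))"
      using UK by (intro mult_left_mono add_mono) auto
    also have "\<dots> = ennreal (norm c * (2 * (2 * r)))"
      using r by (simp flip: ennreal_plus ennreal_mult)
    also have "\<dots> \<le> e" using r by (intro ennreal_leI) auto
    finally show "(\<integral>\<^sup>+x. norm (indicator A (x + h) *\<^sub>R c - indicator A x *\<^sub>R c) \<partial>lborel) \<le> e" .
  qed (use \<delta> in auto)
next
  case (add f g)
  have [measurable]: "f \<in> borel_measurable borel" "g \<in> borel_measurable borel" using add by auto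
  have e2: "0 < e / 2" using add.prems by simp
  then obtain d1 d2 where d: "d1 > 0" "d2 > 0"
    "\<And>h. norm h < d1 \<Longrightarrow> (\<integral>\<^sup>+x. norm (f (x + h) - f x) \<partial>lborel) \<le> e/2"
    "\<And>h. norm h < d2 \<Longrightarrow> (\<integral>\<^sup>+x. norm (g (x + h) - g x) \<partial>lborel) \<le> e/2"
    using add.IH(1)[OF e2] add.IH(2)[OF e2] by auto
  show ?case
  proof (intro exI[of _ "min d1 d2"] conjI allI impI)
    fix h :: 'a assume h: "norm h < min d1 d2"
    have "(\<integral>\<^sup>+x. norm (f (x + h) + g (x + h) - (f x + g x)) \<partial>lborel) \<le>
      (\<integral>\<^sup>+x. ennreal (norm (f (x + h) - f x)) + ennreal (norm (g (x + h) - g x)) \<partial>lborel)"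
      by (intro nn_integral_mono) (auto simp flip: ennreal_plus intro!: ennreal_leI, metis add_diff_add norm_triangle_ineq)
    also have "\<dots> = (\<integral>\<^sup>+x. norm (f (x + h) - f x) \<partial>lborel) + (\<integral>\<^sup>+x. norm (g (x + h) - g x) \<partial>lborel)"
      by (intro nn_integral_add) auto
    also have "\<dots> \<le> ennreal (e/2) + ennreal (e/2)" using h by (intro add_mono d) auto
    also have "\<dots> = e" using add.prems by (simp flip: ennreal_plus)
    finally show "(\<integral>\<^sup>+x. norm (f (x + h) + g (x + h) - (f x + g x)) \<partial>lborel) \<le> e" .
  qed (use d in auto)
next
  case (lim f s)
  have [measurable]: "f \<in> borel_measurable borel" "\<And>i. s i \<in> borel_measurable borel" using lim by auto
  have e3: "0 < e / 4" using lim.prems by simp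
  have fin: "(\<integral>\<^sup>+x. ennreal (2 * norm (f x)) \<partial>lborel) < \<infinity>"
    using lim.hyps(4) integrable_iff_bounded[of lborel "\<lambda>x. 2 * norm (f x)"] by auto
  have "(\<lambda>i. \<integral>\<^sup>+x. norm (f x - s i x) \<partial>lborel) \<longlonglongrightarrow> 0"
    using lim.hyps fin by (intro nn_integral_dominated_convergence_norm[where w="\<lambda>x. 2 * norm (f x)"]) auto
  then have "(\<lambda>i. \<integral>\<^sup>+x. norm (s i x - f x) \<partial>lborel) \<longlonglongrightarrow> 0"
    by (simp add: norm_minus_commute)
  then have "eventually (\<lambda>i. (\<integral>\<^sup>+x. norm (s i x - f x) \<partial>lborel) < e/4) sequentially"
    using e3 by (intro order_tendstoD) auto
  then obtain i where i: "(\<integral>\<^sup>+x. norm (s i x - f x) \<partial>lborel) < e/4" 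
    by (auto simp: eventually_sequentially)
  obtain d where d: "d > 0" "\<And>h. norm h < d \<Longrightarrow> (\<integral>\<^sup>+x. norm (s i (x + h) - s i x) \<partial>lborel) \<le> e/4"
    using lim.IH[OF e3, of i] by auto
  show ?case
  proof (intro exI[of _ d] conjI allI impI)
    fix h :: 'a assume h: "norm h < d"
    have "norm (f (x + h) - f x) \<le> norm (s i (x + h) - s i x) + (norm (s i (h + x) - f (h + x)) + norm (s i x - f x))" for x
      using norm_triangle_ineq4[of "s i (x + h) - s i x" "(s i (h + x) - f (h + x)) - (s i x - f x)"]
        norm_triangle_ineq4[of "s i (h + x) - f (h + x)" "s i x - f x"] by (simp add: algebra_simps)
    then have "(\<integral>\<^sup>+x. norm (f (x + h) - f x) \<partial>lborel) \<le>
      (\<integral>\<^sup>+x. ennreal (norm (s i (x + h) - s i x)) + (ennreal (norm (s i (h + x) - f (h + x))) + ennreal (norm (s i x - f x))) \<partial>lborel)"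
      by (intro nn_integral_mono) (auto simp flip: ennreal_plus)
    also have "\<dots> = (\<integral>\<^sup>+x. norm (s i (x + h) - s i x) \<partial>lborel) + ((\<integral>\<^sup>+x. norm (s i (h + x) - f (h + x)) \<partial>lborel) + (\<integral>\<^sup>+x. norm (s i x - f x) \<partial>lborel))"
      by (simp add: nn_integral_add)
    also have "(\<integral>\<^sup>+x. norm (s i (h + x) - f (h + x)) \<partial>lborel) = (\<integral>\<^sup>+x. norm (s i x - f x) \<partial>lborel)"
      by (subst (2) lborel_distr_plus[of h, symmetric], subst nn_integral_distr) auto
    also have "(\<integral>\<^sup>+x. norm (s i (x + h) - s i x) \<partial>lborel) + ((\<integral>\<^sup>+x. norm (s i x - f x) \<partial>lborel) + (\<integral>\<^sup>+x. norm (s i x - f x) \<partial>lborel)) \<le> ennreal (e/4) + (ennreal (e/4) + ennreal (e/4))"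
      using i h by (intro add_mono d) auto
    also have "\<dots> \<le> e" using lim.prems by (simp flip: ennreal_plus)
    finally show "(\<integral>\<^sup>+x. norm (f (x + h) - f x) \<partial>lborel) \<le> e" .
  qed (use d in auto)
qed

section \<open>Bump functions and compactly supported functions of class C^1\<close>

lemma DERIV_max_0_square: "((\<lambda>t::real. (max 0 t)\<^sup>2) has_real_derivative 2 * max 0 t) (at t)"
proof -
  consider "t > 0" | "t < 0" | "t = 0" by linarith
  then show ?thesis
  proof cases
    case 1
    have "((\<lambda>t::real. t\<^sup>2) has_real_derivative 2 * t) (at t)" by (auto intro!: derivative_eq_intros)
    then have "((\<lambda>t::real. (max 0 t)\<^sup>2) has_real_derivative 2 * t) (at t)"
      by (rule has_field_derivative_transform_within_open[where S="{0<..}"]) (use 1 in auto)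
    then show ?thesis using 1 by simp
  next
    case 2
    have "((\<lambda>t::real. 0) has_real_derivative 0) (at t)" by (auto intro!: derivative_eq_intros)
    then have "((\<lambda>t::real. (max 0 t)\<^sup>2) has_real_derivative 0) (at t)"
      by (rule has_field_derivative_transform_within_open[where S="{..<0}"]) (use 2 in auto)
    then show ?thesis using 2 by simp
  next
    case 3
    have "(\<lambda>h::real. (max 0 h)\<^sup>2 / h) \<midarrow>0\<rightarrow> 0"
    proof (rule Lim_null_comparison[where g="\<lambda>h. \<bar>h\<bar>"])
      show "\<forall>\<^sub>F h in at 0. norm ((max 0 h)\<^sup>2 / h) \<le> \<bar>h\<bar>"
        by (auto simp: max_def power2_eq_square)
      show "((\<lambda>h. \<bar>h\<bar>) \<longlongrightarrow> (0::real)) (at 0)"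
        by (rule tendsto_rabs_zero) (rule tendsto_ident_at)
    qed
    then show ?thesis using 3 by (simp add: DERIV_def)
  qed
qed

lemma GDERIV_norm_square: "GDERIV (\<lambda>z. (norm z)\<^sup>2) z :> 2 *\<^sub>R z"
  unfolding gderiv_def power2_norm_eq_inner
  by (auto intro!: derivative_eq_intros simp: inner_commute)

lemma continuous_on_GDERIV:
  "(\<And>x. x \<in> S \<Longrightarrow> GDERIV f x :> D x) \<Longrightarrow> continuous_on S f"
  unfolding gderiv_def by (meson continuous_at_imp_continuous_on has_derivative_continuous)

lemma GDERIV_zero_outside:
  assumes "GDERIV \<psi> x :> d" "closed K" "\<And>x. x \<notin> K \<Longrightarrow> \<psi> x = 0" "x \<notin> K"
  shows "d = 0"
proof -
  have "GDERIV \<psi> x :> 0"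
    unfolding gderiv_def
    by (rule has_derivative_transform_within_open[where f="\<lambda>_. 0" and s="- K"]) (use assms in \<open>auto simp: open_Compl\<close>)
  then have "(\<lambda>h. h \<bullet> 0) = (\<lambda>h. h \<bullet> d)"
    using assms(1) unfolding gderiv_def by (rule has_derivative_unique)
  then have "d \<bullet> d = 0" by (metis inner_zero_right)
  then show ?thesis by simp
qed

text \<open>The kernel is the normalised square of a truncated paraboloid, which is of class C^1; no
  higher smoothness is aimed at, since test functions are C^1 throughout. The normalising integral
  \<open>Z\<close> is positive because \<open>b\<close> is positive on a ball, which is not
  negligible.\<close>

lemma mollifier_exists:
  assumes "\<delta> > (0::real)"
  shows "\<exists>(\<eta>::'a::euclidean_space \<Rightarrow> real) D. (\<forall>x. GDERIV \<eta> x :> D x) \<and> continuous_on UNIV D \<and> (\<forall>x. 0 \<le> \<eta> x)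
    \<and> (\<forall>x. \<delta> \<le> norm x \<longrightarrow> \<eta> x = 0) \<and> integrable lborel \<eta> \<and> (\<integral>x. \<eta> x \<partial>lborel) = 1"
proof -
  define b :: "'a \<Rightarrow> real" where "b z = (max 0 (1 - (norm z)\<^sup>2 / \<delta>\<^sup>2))\<^sup>2" for z
  define D :: "'a \<Rightarrow> 'a" where "D z = (2 * max 0 (1 - (norm z)\<^sup>2 / \<delta>\<^sup>2)) *\<^sub>R (0 - (1 / \<delta>\<^sup>2) *\<^sub>R 2 *\<^sub>R z)" for z
  have bD: "GDERIV b z :> D z" for z
  proof -
    have "GDERIV (\<lambda>z. (norm z)\<^sup>2 / \<delta>\<^sup>2) z :> (1 / \<delta>\<^sup>2) *\<^sub>R 2 *\<^sub>R z"
      by (rule GDERIV_DERIV_compose[OF GDERIV_norm_square, where g="\<lambda>t. t / \<delta>\<^sup>2"])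
         (use assms in \<open>auto intro!: derivative_eq_intros simp: power2_eq_square power4_eq_xxxx\<close>)
    then have "GDERIV (\<lambda>z. 1 - (norm z)\<^sup>2 / \<delta>\<^sup>2) z :> 0 - (1 / \<delta>\<^sup>2) *\<^sub>R 2 *\<^sub>R z"
      by (intro GDERIV_diff GDERIV_const)
    then show ?thesis
      unfolding b_def D_def by (rule GDERIV_DERIV_compose[OF _ DERIV_max_0_square])
  qed
  have bcont: "continuous_on UNIV b" using bD by (rule continuous_on_GDERIV)
  have b0: "b z = 0" if "\<delta> \<le> norm z" for z
  proof -
    have "\<delta>\<^sup>2 \<le> (norm z)\<^sup>2" using that assms by (intro power_mono) auto
    then show ?thesis using assms by (simp add: b_def)
  qed
  have bnn: "0 \<le> b z" for z by (simp add: b_def)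
  have bint: "integrable lborel b"
  proof -
    have "set_integrable lborel (cball 0 \<delta>) b"
      unfolding set_integrable_def
      by (rule borel_integrable_compact) (use bcont in \<open>auto intro: continuous_on_subset\<close>)
    also have "(\<lambda>x. indicator (cball 0 \<delta>) x *\<^sub>R b x) = b"
      using b0 by (auto simp: indicator_def fun_eq_iff)
    then have "set_integrable lborel (cball 0 \<delta>) b = integrable lborel b"
      by (simp add: set_integrable_def)
    finally show ?thesis .
  qed
  define Z where "Z = (\<integral>x. b x \<partial>lborel)"
  have Z: "Z > 0"
  proof -
    have "0 \<le> Z" unfolding Z_def using bnn by (intro integral_nonneg_AE) auto
    moreover have "Z \<noteq> 0"
    proof
      assume "Z = 0"
      then have "AE x in lborel. b x = 0"
        unfolding Z_def using bint bnn by (subst (asm) integral_nonneg_eq_0_iff_AE) auto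
      then have "AE x in lborel. x \<notin> ball (0::'a) \<delta>"
      proof eventually_elim
        case (elim x)
        show ?case
        proof
        assume "x \<in> ball 0 \<delta>"
        from elim have "1 \<le> (norm x)\<^sup>2 / \<delta>\<^sup>2" by (auto simp: b_def max_def split: if_splits)
        then have "\<delta>\<^sup>2 \<le> (norm x)\<^sup>2" using assms by (simp add: field_simps)
        then have "\<delta> \<le> norm x" using assms power2_le_imp_le by force
        then show False using \<open>x \<in> ball 0 \<delta>\<close> by simp
        qed
      qed
      then have "emeasure lborel (ball (0::'a) \<delta>) = 0"
        by (subst (asm) AE_iff_measurable[OF _ refl]) (auto simp: ball_def)
      then have "ball (0::'a) \<delta> \<in> null_sets lborel" by auto
      then have "negligible (ball (0::'a) \<delta>)"
        by (simp add: negligible_iff_null_sets null_sets_completionI)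
      then show False using open_not_negligible[of "ball (0::'a) \<delta>"] assms by simp
    qed
    ultimately show ?thesis by simp
  qed
  show ?thesis
  proof (intro exI[of _ "\<lambda>z. b z / Z"] exI[of _ "\<lambda>z. (1/Z) *\<^sub>R D z"] conjI allI impI)
    show "GDERIV (\<lambda>z. b z / Z) x :> (1/Z) *\<^sub>R D x" for x
      by (rule GDERIV_DERIV_compose[OF bD, where g="\<lambda>t. t / Z"]) (use Z in \<open>auto intro!: derivative_eq_intros\<close>)
    show "continuous_on UNIV (\<lambda>z. (1/Z) *\<^sub>R D z)"
      unfolding D_def using assms by (intro continuous_intros) auto
    show "(\<integral>x. b x / Z \<partial>lborel) = 1" using Z bint by (simp flip: Z_def)
  qed (use bnn b0 bint Z in \<open>auto intro: less_imp_le divide_nonneg_pos\<close>)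
qed

text \<open>\<open>D\<close> is uniformly continuous on the 1-neighbourhood \<open>K'\<close> of
  \<open>K\<close>. If \<open>z\<close> and \<open>z + h\<close> do not both lie in
  \<open>K'\<close>, then neither lies in \<open>K\<close>, and \<open>D\<close> vanishes at both.
  The error of the linearisation then follows from the mean value inequality. Uniformity in
  \<open>z\<close> is what allows both estimates to be integrated.\<close>

lemma C1_compact_support_uniform:
  fixes \<psi> :: "'a::euclidean_space \<Rightarrow> real"
  assumes \<psi>: "\<And>x. GDERIV \<psi> x :> D x" and D: "continuous_on UNIV D"
    and K: "compact K" "\<And>x. x \<notin> K \<Longrightarrow> \<psi> x = 0" and "e > 0"
  shows "\<exists>\<delta>>0. \<forall>z h. norm h < \<delta> \<longrightarrow> norm (D (z + h) - D z) \<le> e \<and> \<bar>\<psi> (z + h) - \<psi> z - h \<bullet> D z\<bar> \<le> e * norm h"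
proof -
  define K' where "K' = {x + y | x y. x \<in> K \<and> y \<in> cball 0 1}"
  have K': "compact K'" unfolding K'_def by (intro compact_sums K) auto
  have D0: "D x = 0" if "x \<notin> K" for x
    using GDERIV_zero_outside[OF \<psi>, of K] K that by (auto simp: compact_imp_closed)
  have "uniformly_continuous_on K' D"
    using K' D by (intro compact_uniformly_continuous) (auto intro: continuous_on_subset)
  then obtain d where d: "d > 0" "\<And>x y. x \<in> K' \<Longrightarrow> y \<in> K' \<Longrightarrow> dist y x < d \<Longrightarrow> dist (D y) (D x) < e"
    using \<open>e > 0\<close> unfolding uniformly_continuous_on_def by metis
  define \<delta> where "\<delta> = min d 1"
  have \<delta>: "\<delta> > 0" using d by (simp add: \<delta>_def)
  have *: "norm (D (z + h) - D z) \<le> e" if h: "norm h < \<delta>" for z h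
  proof (cases "z \<in> K' \<and> z + h \<in> K'")
    case True
    then show ?thesis using d(2)[of z "z + h"] h by (auto simp: \<delta>_def dist_norm)
  next
    case False
    have "z \<in> K \<Longrightarrow> z \<in> K'" "z + h \<in> K \<Longrightarrow> z + h \<in> K'" 
      unfolding K'_def by (force intro: exI[of _ "0::'a"])+
    moreover have "z \<in> K \<Longrightarrow> z + h \<in> K'" using h unfolding K'_def \<delta>_def by force
    moreover have "z + h \<in> K \<Longrightarrow> z \<in> K'" using h unfolding K'_def \<delta>_def
      by (intro CollectI exI[of _ "z + h"] exI[of _ "-h"]) auto
    ultimately have "z \<notin> K" "z + h \<notin> K" using False by auto
    then show ?thesis using D0 \<open>e > 0\<close> by simp
  qed
  show ?thesis
  proof (intro exI[of _ \<delta>] conjI allI impI \<delta>)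
    fix z h :: 'a assume h: "norm h < \<delta>"
    show "norm (D (z + h) - D z) \<le> e" using * h by auto
    have "norm (\<psi> (z + h) - \<psi> z - (z + h - z) \<bullet> D z) \<le> norm (z + h - z) * e"
    proof (rule differentiable_bound_linearization[where S="ball z \<delta>" and f'="\<lambda>x h. h \<bullet> D x" and ?x0.0=z])
      show "z + t *\<^sub>R (z + h - z) \<in> ball z \<delta>" if "t \<in> {0..1}" for t
        using that h mult_left_le_one_le[of "norm h" t] by (auto simp: dist_norm)
      show "(\<psi> has_derivative (\<lambda>h. h \<bullet> D x)) (at x within ball z \<delta>)" for x
        using \<psi>[of x] unfolding gderiv_def by (rule has_derivative_at_withinI)
      show "onorm ((\<lambda>h. h \<bullet> D x) - (\<lambda>h. h \<bullet> D z)) \<le> e" if "x \<in> ball z \<delta>" for x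
      proof (rule onorm_bound)
        show "norm (((\<lambda>h. h \<bullet> D x) - (\<lambda>h. h \<bullet> D z)) v) \<le> e * norm v" for v
        proof -
          have "norm (D x - D z) \<le> e" using *[of "x - z" z] that by (auto simp: dist_norm norm_minus_commute)
          then have "norm v * norm (D x - D z) \<le> norm v * e" by (intro mult_left_mono) auto
          moreover have "\<bar>v \<bullet> (D x - D z)\<bar> \<le> norm v * norm (D x - D z)" by (rule Cauchy_Schwarz_ineq2)
          ultimately show ?thesis by (simp add: inner_diff_right mult.commute)
        qed
      qed (use \<open>e > 0\<close> in auto)
    qed (use \<delta> in auto)
    then show "\<bar>\<psi> (z + h) - \<psi> z - h \<bullet> D z\<bar> \<le> e * norm h" by (simp add: mult.commute)
  qed
qed

lemma integrable_compact_support: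
  fixes f :: "'a::euclidean_space \<Rightarrow> 'b::{banach, second_countable_topology}"
  assumes "continuous_on UNIV f" "compact K" "\<And>x. x \<notin> K \<Longrightarrow> f x = 0"
  shows "integrable lborel f"
proof -
  have "integrable lborel (\<lambda>x. indicator K x *\<^sub>R f x)"
    by (rule borel_integrable_compact) (use assms in \<open>auto intro: continuous_on_subset\<close>)
  also have "(\<lambda>x. indicator K x *\<^sub>R f x) = f"
    using assms by (auto simp: indicator_def fun_eq_iff)
  finally show ?thesis .
qed

lemma lborel_integral_translation:
  fixes f :: "'a::euclidean_space \<Rightarrow> 'b::{banach, second_countable_topology}"
  shows "integrable lborel (\<lambda>x. f (c + x)) \<longleftrightarrow> integrable lborel f"
    and "(\<integral>x. f (c + x) \<partial>lborel) = (\<integral>x. f x \<partial>lborel)"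
proof -
  have *: "integrable lborel (\<lambda>x. f (c + x))" if "integrable lborel f" for f :: "'a \<Rightarrow> 'b" and c
    using that by (subst (asm) lborel_distr_plus[of c, symmetric], subst (asm) integrable_distr_eq) auto
  then show 1: "integrable lborel (\<lambda>x. f (c + x)) \<longleftrightarrow> integrable lborel f"
    using *[of "\<lambda>x. f (c + x)" "- c"] by auto
  show "(\<integral>x. f (c + x) \<partial>lborel) = (\<integral>x. f x \<partial>lborel)"
  proof (cases "integrable lborel f")
    case True
    then have [measurable]: "f \<in> borel_measurable borel" by auto
    show ?thesis by (subst (2) lborel_distr_plus[of c, symmetric], subst integral_distr) auto
  qed (use 1 in \<open>simp add: not_integrable_integral_eq\<close>)
qed

text \<open>Integrate the linearisation error
  \<open>\<psi> (h + x) - \<psi> x - h \<bullet> D x\<close>: translation invariance cancels the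
  first two terms and leaves \<open>- (h \<bullet> I)\<close>, while the error is at most
  \<open>e * norm h\<close> and lives on the fixed compact set \<open>K'\<close>. A short
  \<open>h\<close> parallel to \<open>I\<close> turns this into \<open>norm I \<le> e * V\<close>
  for every \<open>e\<close>. This replaces Fubini and one-dimensional integration by parts.\<close>

lemma integral_GDERIV_compact_support:
  fixes \<psi> :: "'a::euclidean_space \<Rightarrow> real"
  assumes \<psi>: "\<And>x. GDERIV \<psi> x :> D x" and D: "continuous_on UNIV D"
    and K: "compact K" "\<And>x. x \<notin> K \<Longrightarrow> \<psi> x = 0"
  shows "(\<integral>x. D x \<partial>lborel) = 0"
proof -
  have D0: "D x = 0" if "x \<notin> K" for x
    using GDERIV_zero_outside[OF \<psi>, of K] K that by (auto simp: compact_imp_closed)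
  have Dint: "integrable lborel D" using D K D0 by (intro integrable_compact_support)
  have \<psi>int: "integrable lborel \<psi>" using continuous_on_GDERIV[OF \<psi>] K by (intro integrable_compact_support)
  define K' where "K' = {x + y | x y. x \<in> K \<and> y \<in> cball 0 1}"
  have K': "compact K'" unfolding K'_def by (intro compact_sums K) auto
  have K'fin: "emeasure lborel K' < \<infinity>" using K' by (rule emeasure_compact_finite)
  have [measurable]: "K' \<in> sets borel" using K' by (rule borel_compact)
  define I where "I = (\<integral>x. D x \<partial>lborel)"
  define V where "V = measure lborel K'"
  have "norm I \<le> e * V" if "e > 0" for e
  proof (cases "I = 0")
    case True then show ?thesis using that by (simp add: V_def)
  next
    case False
    obtain d where d: "d > 0" "\<And>z h. norm h < d \<Longrightarrow> \<bar>\<psi> (z + h) - \<psi> z - h \<bullet> D z\<bar> \<le> e * norm h"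
      using C1_compact_support_uniform[OF \<psi> D K \<open>e > 0\<close>] by blast
    define h where "h = (min d 1 / 2 / norm I) *\<^sub>R I"
    have h: "norm h = min d 1 / 2" using False d by (simp add: h_def)
    have hd: "norm h < d" "norm h \<le> 1" "norm h > 0" using h d by auto
    have hI: "h \<bullet> I = norm h * norm I" using False d h
      by (simp add: h_def power2_norm_eq_inner[symmetric] power2_eq_square)
    have int1: "integrable lborel (\<lambda>x. \<psi> (h + x))" using \<psi>int by (simp add: lborel_integral_translation)
    have int2: "integrable lborel (\<lambda>x. h \<bullet> D x)" using Dint by (intro integrable_inner_right)
    have "- (h \<bullet> I) = (\<integral>x. \<psi> (h + x) - \<psi> x - h \<bullet> D x \<partial>lborel)"
      using int1 int2 \<psi>int Dint by (simp add: lborel_integral_translation I_def)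
    then have "norm h * norm I \<le> norm (\<integral>x. \<psi> (h + x) - \<psi> x - h \<bullet> D x \<partial>lborel)"
      using hI by (metis abs_ge_self norm_minus_cancel real_norm_def)
    also have "\<dots> \<le> (\<integral>x. indicator K' x * (e * norm h) \<partial>lborel)"
    proof (rule Bochner_Integration.integral_norm_bound_integral)
      show "integrable lborel (\<lambda>x. \<psi> (h + x) - \<psi> x - h \<bullet> D x)" using int1 int2 \<psi>int by auto
      show "integrable lborel (\<lambda>x. indicator K' x * (e * norm h))" using K'fin by auto
      fix x :: 'a
      have "\<psi> (h + x) - \<psi> x - h \<bullet> D x = 0" if "x \<notin> K'"
      proof -
        have "x \<notin> K" using that unfolding K'_def by (force intro: exI[of _ "0::'a"])
        moreover have "h + x \<notin> K" using that hd unfolding K'_def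
          by simp (metis add_minus_cancel add.commute norm_minus_cancel)
        ultimately show ?thesis using K D0 by simp
      qed
      then show "norm (\<psi> (h + x) - \<psi> x - h \<bullet> D x) \<le> indicator K' x * (e * norm h)"
        using d(2)[OF hd(1), of x] by (cases "x \<in> K'") (auto simp: add.commute)
    qed
    also have "\<dots> = norm h * (e * V)" using K'fin by (simp add: V_def)
    finally show ?thesis using hd by (simp add: mult_le_cancel_left)
  qed
  then have "norm I * 1 \<le> 0"
  proof -
    have "norm I \<le> x" if "x > 0" for x
      using \<open>\<And>e. e > 0 \<Longrightarrow> norm I \<le> e * V\<close>[of "x / (V + 1)"] that mult_left_mono[of V "V + 1" "x / (V + 1)"]
      by (auto simp: V_def add_nonneg_pos intro: order_trans)
    then show ?thesis by (metis field_le_epsilon add_0 mult.right_neutral)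
  qed
  then show ?thesis by (simp add: I_def)
qed

section \<open>Convolution with a C^1 kernel\<close>

lemma integrable_bounded_mult:
  fixes f :: "'a \<Rightarrow> 'b::{banach, second_countable_topology}" and c :: "'a \<Rightarrow> real"
  assumes "integrable M f" "c \<in> borel_measurable M" "\<And>x. \<bar>c x\<bar> \<le> B"
  shows "integrable M (\<lambda>x. c x *\<^sub>R f x)"
proof (rule Bochner_Integration.integrable_bound)
  show "integrable M (\<lambda>x. B * norm (f x))" using assms by auto
  show "AE x in M. norm (c x *\<^sub>R f x) \<le> norm (B * norm (f x))"
    using assms(3) by (intro AE_I2) (auto simp: abs_mult intro!: mult_right_mono intro: order_trans[OF _ abs_ge_self])
qed (use assms in auto)

lemma compact_support_bounded:
  fixes f :: "'a::t2_space \<Rightarrow> 'b::real_normed_vector"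
  assumes "continuous_on UNIV f" "compact K" "\<And>x. x \<notin> K \<Longrightarrow> f x = 0"
  obtains B where "B \<ge> 0" "\<And>x. norm (f x) \<le> B"
proof -
  have "bounded (f ` K)" using assms by (intro compact_imp_bounded compact_continuous_image) (auto intro: continuous_on_subset)
  then obtain B where "\<And>x. x \<in> K \<Longrightarrow> norm (f x) \<le> B" by (auto simp: bounded_iff)
  then have "norm (f x) \<le> max 0 B" for x using assms(3)[of x] by (cases "x \<in> K") (auto simp: le_max_iff_disj)
  then show ?thesis by (intro that[of "max 0 B"]) auto
qed

text \<open>The linearisation error of the kernel is small uniformly in \<open>y\<close>, so
  integrating it against \<open>\<bar>f y\<bar>\<close> costs only the factor \<open>N\<close>, the
  L^1 norm of \<open>f\<close>. The minus sign in \<open>F'\<close> comes from the argument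
  \<open>y - x\<close>, in which \<open>x\<close> is the variable. Dividing by \<open>N + 1\<close>
  instead of \<open>N\<close> later covers the case that \<open>f\<close> vanishes almost
  everywhere.\<close>

lemma GDERIV_convolution:
  fixes \<psi> :: "'a::euclidean_space \<Rightarrow> real"
  assumes \<psi>: "\<And>x. GDERIV \<psi> x :> D x" and D: "continuous_on UNIV D"
    and K: "compact K" "\<And>x. x \<notin> K \<Longrightarrow> \<psi> x = 0" and f: "integrable lborel f"
  defines "F \<equiv> \<lambda>x. \<integral>y. \<psi> (y - x) *\<^sub>R f y \<partial>lborel" and "F' \<equiv> \<lambda>x. - (\<integral>y. f y *\<^sub>R D (y - x) \<partial>lborel)"
  shows "GDERIV F x :> F' x" and "continuous_on UNIV F'"
proof -
  have D0: "D x = 0" if "x \<notin> K" for x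
    using GDERIV_zero_outside[OF \<psi>, of K] K that by (auto simp: compact_imp_closed)
  have \<psi>c: "continuous_on UNIV \<psi>" using \<psi> by (rule continuous_on_GDERIV)
  have [measurable]: "\<psi> \<in> borel_measurable borel" "D \<in> borel_measurable borel" "f \<in> borel_measurable borel"
    using \<psi>c D f by (auto intro: borel_measurable_continuous_onI)
  obtain B where B: "\<And>x. norm (\<psi> x) \<le> B" using compact_support_bounded[OF \<psi>c K] by metis
  obtain B' where B': "\<And>x. norm (D x) \<le> B'" using compact_support_bounded[OF D K(1) D0] by metis
  have int1: "integrable lborel (\<lambda>y. \<psi> (y - x) *\<^sub>R f y)" for x
    using f B by (intro integrable_bounded_mult[where B=B]) auto
  have int2: "integrable lborel (\<lambda>y. f y *\<^sub>R D (y - x))" for x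
  proof (rule Bochner_Integration.integrable_bound)
    show "integrable lborel (\<lambda>y. B' * f y)" using f by auto
    show "AE y in lborel. norm (f y *\<^sub>R D (y - x)) \<le> norm (B' * f y)"
      using order_trans[OF B' abs_ge_self] by (intro AE_I2) (auto simp: abs_mult mult.commute[of "\<bar>B'\<bar>"] intro!: mult_left_mono)
  qed auto
  define N where "N = (\<integral>y. \<bar>f y\<bar> \<partial>lborel)"
  have N: "N \<ge> 0" by (simp add: N_def)
  have est: "\<exists>\<delta>>0. \<forall>x h. norm h < \<delta> \<longrightarrow> norm (F' (x + h) - F' x) \<le> e * N \<and> \<bar>F (x + h) - F x - h \<bullet> F' x\<bar> \<le> e * N * norm h"
    if e: "e > 0" for e
  proof -
    obtain d where d: "d > 0" "\<And>z h. norm h < d \<Longrightarrow> norm (D (z + h) - D z) \<le> e"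
       "\<And>z h. norm h < d \<Longrightarrow> \<bar>\<psi> (z + h) - \<psi> z - h \<bullet> D z\<bar> \<le> e * norm h"
      using C1_compact_support_uniform[OF \<psi> D K e] by blast
    show ?thesis
    proof (intro exI[of _ d] conjI allI impI d(1))
      fix x h :: 'a assume h: "norm h < d"
      have "norm (F' (x + h) - F' x) = norm (\<integral>y. f y *\<^sub>R (D (y - x) - D (y - (x + h))) \<partial>lborel)"
        using int2 by (simp add: F'_def scaleR_diff_right)
      also have "\<dots> \<le> (\<integral>y. e * \<bar>f y\<bar> \<partial>lborel)"
      proof (rule Bochner_Integration.integral_norm_bound_integral)
        show "integrable lborel (\<lambda>y. f y *\<^sub>R (D (y - x) - D (y - (x + h))))" using int2 by (simp add: scaleR_diff_right)
        show "norm (f y *\<^sub>R (D (y - x) - D (y - (x + h)))) \<le> e * \<bar>f y\<bar>" for y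
          using d(2)[of "-h" "y - x"] h by (auto simp: diff_diff_eq mult.commute[of e] norm_minus_commute simp flip: scaleR_diff_right intro!: mult_left_mono)
      qed (use f in auto)
      finally show "norm (F' (x + h) - F' x) \<le> e * N" by (simp add: N_def)
      have "\<bar>F (x + h) - F x - h \<bullet> F' x\<bar> = norm (\<integral>y. f y * (\<psi> (y - (x + h)) - \<psi> (y - x) - (- h) \<bullet> D (y - x)) \<partial>lborel)"
      proof -
        have "h \<bullet> F' x = - (\<integral>y. h \<bullet> (f y *\<^sub>R D (y - x)) \<partial>lborel)"
          unfolding F'_def using int2[of x] by (subst integral_inner_right) (auto simp del: inner_scaleR_right)
        moreover have "integrable lborel (\<lambda>y. h \<bullet> (f y *\<^sub>R D (y - x)))" using int2 by (intro integrable_inner_right)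
        ultimately show ?thesis
          using int1[of "x + h"] int1[of x] unfolding F_def by (simp add: algebra_simps)
      qed
      also have "\<dots> \<le> (\<integral>y. (e * norm h) * \<bar>f y\<bar> \<partial>lborel)"
      proof (rule Bochner_Integration.integral_norm_bound_integral)
        have "integrable lborel (\<lambda>y. h \<bullet> (f y *\<^sub>R D (y - x)))" using int2 by (intro integrable_inner_right)
        then show "integrable lborel (\<lambda>y. f y * (\<psi> (y - (x + h)) - \<psi> (y - x) - (- h) \<bullet> D (y - x)))"
          using int1[of "x + h"] int1[of x] by (simp add: algebra_simps)
        show "norm (f y * (\<psi> (y - (x + h)) - \<psi> (y - x) - - h \<bullet> D (y - x))) \<le> (e * norm h) * \<bar>f y\<bar>" for y
        proof -
          have "\<bar>\<psi> (y - (x + h)) - \<psi> (y - x) - - h \<bullet> D (y - x)\<bar> \<le> e * norm h"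
            using d(3)[of "-h" "y - x"] h by (simp add: algebra_simps)
          then show ?thesis by (auto simp: abs_mult mult.commute[of _ "\<bar>f y\<bar>"] intro!: mult_left_mono)
        qed
      qed (use f in auto)
      finally show "\<bar>F (x + h) - F x - h \<bullet> F' x\<bar> \<le> e * N * norm h" by (simp add: N_def mult_ac)
    qed
  qed
  have est': "\<exists>\<delta>>0. \<forall>x h. norm h < \<delta> \<longrightarrow> norm (F' (x + h) - F' x) \<le> e \<and> \<bar>F (x + h) - F x - h \<bullet> F' x\<bar> \<le> e * norm h"
    if e: "e > 0" for e
  proof -
    have e': "e / (N + 1) > 0" using e N by simp
    have "e / (N + 1) * N \<le> e" using N e by (simp add: field_simps)
    then have "e / (N + 1) * N * norm h \<le> e * norm h" for h :: 'a by (intro mult_right_mono) auto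
    with est[OF e'] \<open>e / (N + 1) * N \<le> e\<close> show ?thesis by (meson order_trans)
  qed
  show "GDERIV F x :> F' x"
    unfolding gderiv_def has_derivative_at_alt
  proof (intro conjI allI impI)
    show "bounded_linear (\<lambda>h. h \<bullet> F' x)" by (rule bounded_linear_inner_left)
    fix e :: real assume "e > 0"
    then obtain d where "d > 0" "\<forall>x h. norm h < d \<longrightarrow> \<bar>F (x + h) - F x - h \<bullet> F' x\<bar> \<le> e * norm h"
      using est' by metis
    then show "\<exists>d>0. \<forall>y. norm (y - x) < d \<longrightarrow> norm (F y - F x - (y - x) \<bullet> F' x) \<le> e * norm (y - x)"
      by (intro exI[of _ d]) (metis add_diff_cancel_left' diff_add_cancel add.commute real_norm_def)
  qed
  show "continuous_on UNIV F'"
    unfolding continuous_on_iff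
  proof (intro ballI allI impI)
    fix x :: 'a and e :: real assume "e > 0"
    then have "e / 2 > 0" by simp
    then obtain d where "d > 0" and d: "\<And>x h. norm h < d \<Longrightarrow> norm (F' (x + h) - F' x) \<le> e/2"
      using est' by metis
    then show "\<exists>d>0. \<forall>x'\<in>UNIV. dist x' x < d \<longrightarrow> dist (F' x') (F' x) < e"
      using d[of "_ - x" x] \<open>e > 0\<close> by (intro exI[of _ d]) (force simp: dist_norm)
  qed
qed

text \<open>As \<open>\<eta>\<close> has integral 1, the difference between the mollified function
  and \<open>f\<close> is the average of \<open>f (x + z) - f x\<close> with weight
  \<open>\<eta> z\<close>. Taking norms and exchanging the integrals leaves the L^1 distance of
  \<open>f\<close> to its translates, and only \<open>norm z < \<delta>\<close> contributes.\<close>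

lemma L1_mollify:
  fixes f :: "'a::euclidean_space \<Rightarrow> 'b::euclidean_space"
  assumes f: "integrable lborel f"
    and e: "\<And>h. norm h < \<delta> \<Longrightarrow> (\<integral>\<^sup>+x. norm (f (x + h) - f x) \<partial>lborel) \<le> ennreal e"
    and \<eta>: "continuous_on UNIV \<eta>" "\<And>x. 0 \<le> \<eta> x" "\<And>x. \<delta> \<le> norm x \<Longrightarrow> \<eta> x = 0" "integrable lborel \<eta>" "(\<integral>x. \<eta> x \<partial>lborel) = (1::real)"
  shows "integrable lborel (\<lambda>x. \<integral>y. \<eta> (y - x) *\<^sub>R f y \<partial>lborel)" (is ?A)
    "(\<integral>\<^sup>+x. norm ((\<integral>y. \<eta> (y - x) *\<^sub>R f y \<partial>lborel) - f x) \<partial>lborel) \<le> e" (is ?B)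
proof -
  have [measurable]: "\<eta> \<in> borel_measurable borel" "f \<in> borel_measurable borel"
    using \<eta> f by (auto intro: borel_measurable_continuous_onI)
  obtain B where B: "\<And>x. norm (\<eta> x) \<le> B" 
    using compact_support_bounded[OF \<eta>(1), of "cball 0 \<delta>"] \<eta>(3) by (metis compact_cball dist_0_norm linear mem_cball)
  have fx: "integrable lborel (\<lambda>z. f (x + z))" for x using f by (simp add: lborel_integral_translation)
  have int: "integrable lborel (\<lambda>z. \<eta> z *\<^sub>R f (x + z))" for x
    using fx B by (intro integrable_bounded_mult[where B=B]) auto
  have eq: "(\<integral>y. \<eta> (y - x) *\<^sub>R f y \<partial>lborel) = (\<integral>z. \<eta> z *\<^sub>R f (x + z) \<partial>lborel)" for x
    by (subst lborel_integral_translation(2)[of _ x, symmetric]) simp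
  have diff: "(\<integral>y. \<eta> (y - x) *\<^sub>R f y \<partial>lborel) - f x = (\<integral>z. \<eta> z *\<^sub>R (f (x + z) - f x) \<partial>lborel)" for x
    unfolding eq using int \<eta> by (simp add: scaleR_diff_right)
  have "(\<integral>\<^sup>+x. norm ((\<integral>y. \<eta> (y - x) *\<^sub>R f y \<partial>lborel) - f x) \<partial>lborel) \<le> (\<integral>\<^sup>+x. \<integral>\<^sup>+z. ennreal (\<eta> z) * ennreal (norm (f (x + z) - f x)) \<partial>lborel \<partial>lborel)"
  proof (rule nn_integral_mono)
    fix x
    have "ennreal (norm ((\<integral>y. \<eta> (y - x) *\<^sub>R f y \<partial>lborel) - f x)) \<le> (\<integral>\<^sup>+z. norm (\<eta> z *\<^sub>R (f (x + z) - f x)) \<partial>lborel)"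
      unfolding diff by (rule integral_norm_bound_ennreal) (use int \<eta> in \<open>simp add: scaleR_diff_right\<close>)
    then show "ennreal (norm ((\<integral>y. \<eta> (y - x) *\<^sub>R f y \<partial>lborel) - f x)) \<le> (\<integral>\<^sup>+z. ennreal (\<eta> z) * ennreal (norm (f (x + z) - f x)) \<partial>lborel)"
      using \<eta>(2) by (simp add: ennreal_mult)
  qed
  also have "\<dots> = (\<integral>\<^sup>+z. \<integral>\<^sup>+x. ennreal (\<eta> z) * ennreal (norm (f (x + z) - f x)) \<partial>lborel \<partial>lborel)"
    by (rule lborel_pair.Fubini'[symmetric]) measurable
  also have "\<dots> = (\<integral>\<^sup>+z. ennreal (\<eta> z) * (\<integral>\<^sup>+x. ennreal (norm (f (x + z) - f x)) \<partial>lborel) \<partial>lborel)"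
    by (intro nn_integral_cong nn_integral_cmult) measurable
  also have "\<dots> \<le> (\<integral>\<^sup>+z. ennreal (\<eta> z) * ennreal e \<partial>lborel)"
  proof (rule nn_integral_mono)
    fix z
    show "ennreal (\<eta> z) * (\<integral>\<^sup>+x. ennreal (norm (f (x + z) - f x)) \<partial>lborel) \<le> ennreal (\<eta> z) * ennreal e"
      using e[of z] \<eta>(3)[of z] by (cases "norm z < \<delta>") (auto intro!: mult_left_mono)
  qed
  also have "\<dots> = (\<integral>\<^sup>+z. ennreal (\<eta> z) \<partial>lborel) * ennreal e" by (rule nn_integral_multc) measurable
  also have "(\<integral>\<^sup>+z. ennreal (\<eta> z) \<partial>lborel) = 1" using \<eta> by (subst nn_integral_eq_integral) auto
  finally show 1: ?B by simp
  have [measurable]: "(\<lambda>x. \<integral>y. \<eta> (y - x) *\<^sub>R f y \<partial>lborel) \<in> borel_measurable borel"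
    by measurable
  have "integrable lborel (\<lambda>x. (\<integral>y. \<eta> (y - x) *\<^sub>R f y \<partial>lborel) - f x)"
    using 1 by (intro integrableI_bounded) (auto simp: top_unique less_top intro: le_less_trans)
  from Bochner_Integration.integrable_add[OF this f] show ?A by simp
qed

section \<open>Weak gradients in Euclidean space\<close>

lemma compact_neighbourhood:
  fixes K :: "'a::euclidean_space set"
  assumes "compact K" "open U" "K \<subseteq> U"
  obtains e K' where "e > 0" "compact K'" "K' \<subseteq> U" "\<And>x. x \<in> K \<Longrightarrow> cball x e \<subseteq> K'"
proof -
  obtain e where e: "e > 0" "(\<Union>x\<in>K. cball x e) \<subseteq> U"
    using compact_subset_open_imp_cball_epsilon_subset[OF assms] .
  define K' where "K' = {x + y | x y. x \<in> K \<and> y \<in> cball 0 e}"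
  have eq: "K' = (\<Union>x\<in>K. cball x e)"
  proof (intro set_eqI iffI)
    fix z assume "z \<in> (\<Union>x\<in>K. cball x e)"
    then obtain x where "x \<in> K" "dist x z \<le> e" by auto
    then show "z \<in> K'" unfolding K'_def 
      by (intro CollectI exI[of _ x] exI[of _ "z - x"]) (auto simp: dist_norm norm_minus_commute)
  qed (auto simp: K'_def dist_norm intro!: bexI)
  have "compact K'" unfolding K'_def using assms by (intro compact_sums) auto
  then show ?thesis using e eq by (intro that[of e K']) auto
qed

lemma mollifier_for:
  fixes f :: "'a::euclidean_space \<Rightarrow> 'b::euclidean_space"
  assumes "integrable lborel f" "r > 0" "e > (0::real)"
  shows "\<exists>(\<eta>::'a \<Rightarrow> real) D. (\<forall>x. GDERIV \<eta> x :> D x) \<and> continuous_on UNIV D \<and> (\<forall>x. 0 \<le> \<eta> x)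
    \<and> (\<forall>x. r \<le> norm x \<longrightarrow> \<eta> x = 0) \<and> integrable lborel \<eta> \<and> (\<integral>x. \<eta> x \<partial>lborel) = 1 \<and>
    integrable lborel (\<lambda>x. \<integral>y. \<eta> (y - x) *\<^sub>R f y \<partial>lborel) \<and>
    (\<integral>\<^sup>+x. norm ((\<integral>y. \<eta> (y - x) *\<^sub>R f y \<partial>lborel) - f x) \<partial>lborel) \<le> e"
proof -
  obtain \<delta> where \<delta>: "\<delta> > 0" "\<And>h. norm h < \<delta> \<Longrightarrow> (\<integral>\<^sup>+x. norm (f (x + h) - f x) \<partial>lborel) \<le> e"
    using L1_translation_continuous[OF assms(1,3)] by blast
  obtain \<eta> :: "'a \<Rightarrow> real" and D where \<eta>: "\<And>x. GDERIV \<eta> x :> D x" "continuous_on UNIV D" "\<And>x. 0 \<le> \<eta> x"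
    "\<And>x. min r \<delta> \<le> norm x \<Longrightarrow> \<eta> x = 0" "integrable lborel \<eta>" "(\<integral>x. \<eta> x \<partial>lborel) = 1"
    using mollifier_exists[of "min r \<delta>"] \<delta> assms by auto
  have c: "continuous_on UNIV \<eta>" using \<eta>(1) by (rule continuous_on_GDERIV)
  show ?thesis
  proof (intro exI[of _ \<eta>] exI[of _ D] conjI allI impI)
    show "integrable lborel (\<lambda>x. \<integral>y. \<eta> (y - x) *\<^sub>R f y \<partial>lborel)"
      by (rule L1_mollify(1)[of f \<delta>]) (use \<eta> \<delta> assms c in auto)
    show "(\<integral>\<^sup>+x. norm ((\<integral>y. \<eta> (y - x) *\<^sub>R f y \<partial>lborel) - f x) \<partial>lborel) \<le> e"
      by (rule L1_mollify(2)[of f \<delta>]) (use \<eta> \<delta> assms c in auto)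
  qed (use \<eta> in auto)
qed

section \<open>Jensen's inequality and dominated convergence with varying majorants\<close>

lemma GDERIV_translate: "(\<And>x. GDERIV \<psi> x :> D x) \<Longrightarrow> GDERIV (\<lambda>y. \<psi> (y - c)) y :> D (y - c)"
  unfolding gderiv_def
  by (rule has_derivative_compose[of "\<lambda>y. y - c" "\<lambda>h. h", simplified]) (auto intro!: derivative_eq_intros)

text \<open>Jensen's inequality for the density \<open>\<eta>\<close> and the convex function
  \<open>t powr p\<close>. Young's inequality says that the tangent at \<open>c\<close>, the mean of
  \<open>norm (g x)\<close>, lies below the graph (\<open>tang\<close>); integrating the tangent at
  \<open>t = norm (g x)\<close> returns exactly \<open>c powr p\<close>.\<close>

lemma norm_powr_integral_le:
  fixes g :: "'a \<Rightarrow> 'b::{banach, second_countable_topology}"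
  assumes p: "p \<ge> 1" and \<eta>: "\<And>x. 0 \<le> \<eta> x" "integrable M \<eta>" "(\<integral>x. \<eta> x \<partial>M) = 1"
    and g: "integrable M (\<lambda>x. \<eta> x *\<^sub>R g x)" "integrable M (\<lambda>x. \<eta> x * norm (g x) powr p)"
  shows "norm (\<integral>x. \<eta> x *\<^sub>R g x \<partial>M) powr p \<le> (\<integral>x. \<eta> x * norm (g x) powr p \<partial>M)"
proof -
  define c where "c = (\<integral>x. \<eta> x * norm (g x) \<partial>M)"
  have int: "integrable M (\<lambda>x. \<eta> x * norm (g x))"
    using integrable_norm[OF g(1)] \<eta>(1) by simp
  have "norm (\<integral>x. \<eta> x *\<^sub>R g x \<partial>M) \<le> c"
    unfolding c_def using integral_norm_bound[of M "\<lambda>x. \<eta> x *\<^sub>R g x"] \<eta>(1) by simp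
  then have "norm (\<integral>x. \<eta> x *\<^sub>R g x \<partial>M) powr p \<le> c powr p" using p by (intro powr_mono2) auto
  also have "c powr p \<le> (\<integral>x. \<eta> x * norm (g x) powr p \<partial>M)"
  proof (cases "p = 1")
    case True
    then show ?thesis using \<eta>(1) by (simp add: c_def)
  next
    case False
    then have p1: "p > 1" using p by simp
    have c0: "c \<ge> 0" unfolding c_def using \<eta>(1) by simp
    have tang: "p * c powr (p - 1) * t - (p - 1) * c powr p \<le> t powr p" if "t \<ge> 0" for t
    proof -
      have "t * c powr (p - 1) \<le> t powr p / p + (c powr (p - 1)) powr (p / (p - 1)) / (p / (p - 1))"
        by (rule Youngs_inequality) (use p1 that in \<open>auto simp: field_simps\<close>)
      also have "(c powr (p - 1)) powr (p / (p - 1)) = c powr p" using p1 by (simp add: powr_powr)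
      finally have "p * (t * c powr (p - 1)) \<le> p * (t powr p / p + c powr p / (p / (p - 1)))"
        using p1 by (intro mult_left_mono) auto
      also have "\<dots> = t powr p + (p - 1) * c powr p" using p1 by (simp add: field_simps)
      finally show ?thesis by (simp add: mult_ac)
    qed
    have "c powr p = p * c powr (p - 1) * c - (p - 1) * c powr p"
    proof -
      have "c powr (p - 1) * c = c powr p" using c0 by (cases "c = 0") (auto simp: powr_diff)
      then show ?thesis by (simp add: algebra_simps)
    qed
    also have "\<dots> = (\<integral>x. p * c powr (p - 1) * (\<eta> x * norm (g x)) - (p - 1) * c powr p * \<eta> x \<partial>M)"
      using int \<eta> by (simp add: c_def)
    also have "\<dots> \<le> (\<integral>x. \<eta> x * norm (g x) powr p \<partial>M)"
    proof (intro integral_mono)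
      fix x
      show "p * c powr (p - 1) * (\<eta> x * norm (g x)) - (p - 1) * c powr p * \<eta> x \<le> \<eta> x * norm (g x) powr p"
        using mult_left_mono[OF tang[of "norm (g x)"] \<eta>(1)[of x]] by (simp add: algebra_simps)
    qed (use int \<eta> g in auto)
    finally show ?thesis .
  qed
  finally show ?thesis .
qed

text \<open>From \<open>norm (F k x - f x) \<le> B k x + b x\<close> it follows that the left side
  is at most \<open>m k x + \<bar>B k x - b x\<bar>\<close>. The truncated difference
  \<open>m k\<close> has the fixed majorant \<open>2 * b\<close>, so ordinary dominated convergence
  applies to it, and the rest tends to 0 by assumption.\<close>

lemma tendsto_integral_generalized_dominated:
  fixes F :: "nat \<Rightarrow> 'a \<Rightarrow> 'b::{banach, second_countable_topology}"
  assumes [measurable]: "\<And>k. F k \<in> borel_measurable M" "f \<in> borel_measurable M"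
    and B: "\<And>k. integrable M (B k)" "integrable M b"
    and lim: "AE x in M. (\<lambda>k. F k x) \<longlonglongrightarrow> f x" "AE x in M. (\<lambda>k. B k x) \<longlonglongrightarrow> b x"
    and bound: "\<And>k. AE x in M. norm (F k x) \<le> B k x"
    and L1: "(\<lambda>k. \<integral>\<^sup>+x. \<bar>B k x - b x\<bar> \<partial>M) \<longlonglongrightarrow> 0"
  shows "integrable M f" "\<And>k. integrable M (F k)" "(\<lambda>k. \<integral>x. F k x \<partial>M) \<longlonglongrightarrow> (\<integral>x. f x \<partial>M)"
proof -
  have [measurable]: "\<And>k. B k \<in> borel_measurable M" "b \<in> borel_measurable M" using B by auto
  have fb: "AE x in M. norm (f x) \<le> b x"
  proof -
    have "AE x in M. \<forall>k. norm (F k x) \<le> B k x" using bound by (simp add: AE_all_countable)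
    with lim show ?thesis
    proof eventually_elim
      case (elim x)
      have "(\<lambda>k. norm (F k x)) \<longlonglongrightarrow> norm (f x)" using elim by (intro tendsto_norm)
      then show ?case by (rule LIMSEQ_le[OF _ elim(2)]) (use elim in auto)
    qed
  qed
  show f: "integrable M f"
    by (rule Bochner_Integration.integrable_bound[OF B(2)]) (use fb in auto)
  show F: "integrable M (F k)" for k
    by (rule Bochner_Integration.integrable_bound[OF B(1)[of k]]) (use bound[of k] in auto)
  define m where "m k x = min (norm (F k x - f x)) (2 * b x)" for k x
  have [measurable]: "m k \<in> borel_measurable M" for k unfolding m_def by measurable
  have "(\<lambda>k. \<integral>\<^sup>+x. ennreal (m k x) \<partial>M) \<longlonglongrightarrow> (\<integral>\<^sup>+x. 0 \<partial>M)"
  proof (rule nn_integral_dominated_convergence[where w="\<lambda>x. ennreal (2 * \<bar>b x\<bar>)"])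
    show "(\<integral>\<^sup>+x. ennreal (2 * \<bar>b x\<bar>) \<partial>M) < \<infinity>"
      using integrable_iff_bounded[of M "\<lambda>x. 2 * b x"] B by (auto simp: abs_mult)
    show "AE x in M. (\<lambda>k. ennreal (m k x)) \<longlonglongrightarrow> 0"
      using lim(1) fb
    proof eventually_elim
      case (elim x)
      have "b x \<ge> 0" using elim by (metis norm_ge_zero order_trans)
      have "(\<lambda>k. m k x) \<longlonglongrightarrow> min (norm (f x - f x)) (2 * b x)"
        unfolding m_def using elim by (intro tendsto_intros)
      then have "(\<lambda>k. ennreal (m k x)) \<longlonglongrightarrow> ennreal 0"
        using \<open>b x \<ge> 0\<close> by (intro tendsto_ennrealI) auto
      then show ?case by simp
    qed
    show "AE x in M. ennreal (m k x) \<le> ennreal (2 * \<bar>b x\<bar>)" for k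
      by (intro AE_I2 ennreal_leI) (auto simp: m_def min_def)
  qed auto
  then have "(\<lambda>k. (\<integral>\<^sup>+x. ennreal (m k x) \<partial>M) + (\<integral>\<^sup>+x. \<bar>B k x - b x\<bar> \<partial>M)) \<longlonglongrightarrow> 0 + 0"
    by (intro tendsto_add L1) simp
  then have *: "(\<lambda>k. (\<integral>\<^sup>+x. ennreal (m k x) \<partial>M) + (\<integral>\<^sup>+x. \<bar>B k x - b x\<bar> \<partial>M)) \<longlonglongrightarrow> 0"
    by simp
  have "(\<integral>\<^sup>+x. norm (F k x - f x) \<partial>M) \<le> (\<integral>\<^sup>+x. ennreal (m k x) \<partial>M) + (\<integral>\<^sup>+x. \<bar>B k x - b x\<bar> \<partial>M)" for k
  proof -
    have "(\<integral>\<^sup>+x. norm (F k x - f x) \<partial>M) \<le> (\<integral>\<^sup>+x. ennreal (m k x) + ennreal \<bar>B k x - b x\<bar> \<partial>M)"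
    proof (rule nn_integral_mono_AE)
      show "AE x in M. ennreal (norm (F k x - f x)) \<le> ennreal (m k x) + ennreal \<bar>B k x - b x\<bar>"
        using fb bound[of k]
      proof eventually_elim
        case (elim x)
        have "b x \<ge> 0" using elim by (metis norm_ge_zero order_trans)
        have "norm (F k x - f x) \<le> B k x + b x" using norm_triangle_ineq4[of "F k x" "f x"] elim by linarith
        then have "norm (F k x - f x) \<le> m k x + \<bar>B k x - b x\<bar>" unfolding m_def by linarith
        moreover have "0 \<le> m k x" using \<open>b x \<ge> 0\<close> by (simp add: m_def)
        ultimately show ?case by (simp add: ennreal_leI flip: ennreal_plus)
      qed
    qed
    then show ?thesis by (simp add: nn_integral_add)
  qed
  then have "(\<lambda>k. \<integral>\<^sup>+x. norm (F k x - f x) \<partial>M) \<longlonglongrightarrow> 0"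
    by (intro tendsto_sandwich[OF _ _ tendsto_const *]) auto
  then show "(\<lambda>k. \<integral>x. F k x \<partial>M) \<longlonglongrightarrow> (\<integral>x. f x \<partial>M)"
    by (intro tendsto_L1_int F f)
qed

section \<open>Weak gradients: definition, fundamental lemma, approximation\<close>

definition locally_integrable_on :: "('a::euclidean_space \<Rightarrow> 'b::{banach, second_countable_topology}) \<Rightarrow> 'a set \<Rightarrow> bool" where
  "locally_integrable_on f U \<longleftrightarrow> (\<forall>K. compact K \<and> K \<subseteq> U \<longrightarrow> set_integrable lborel K f)"

text \<open>\<open>K\<close> is any compact set off which \<open>\<psi>\<close> vanishes, possibly
  larger than the support. This lets a whole family of translated kernels share one set. The
  gradient is carried along as \<open>D\<close>.\<close>

definition test_function :: "'a::euclidean_space set \<Rightarrow> ('a \<Rightarrow> real) \<Rightarrow> ('a \<Rightarrow> 'a) \<Rightarrow> bool" where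
  "test_function K \<psi> D \<longleftrightarrow> compact K \<and> (\<forall>x. GDERIV \<psi> x :> D x) \<and> continuous_on UNIV D \<and> (\<forall>x. x \<notin> K \<longrightarrow> \<psi> x = 0)"

definition weak_gradient :: "'a::euclidean_space set \<Rightarrow> ('a \<Rightarrow> real) \<Rightarrow> ('a \<Rightarrow> 'a) \<Rightarrow> bool" where
  "weak_gradient U f G \<longleftrightarrow> locally_integrable_on f U \<and> locally_integrable_on G U \<and>
    (\<forall>K \<psi> D. K \<subseteq> U \<and> test_function K \<psi> D \<longrightarrow>
      (LINT x:K|lborel. f x *\<^sub>R D x) = - (LINT x:K|lborel. \<psi> x *\<^sub>R G x))"

lemma AE_open_from_compact:
  fixes U :: "'a::euclidean_space set"
  assumes "open U" "\<And>K. compact K \<Longrightarrow> K \<subseteq> U \<Longrightarrow> AE x in lborel. x \<in> K \<longrightarrow> P x"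
  shows "AE x in lborel. x \<in> U \<longrightarrow> P x"
proof -
  obtain C :: "nat \<Rightarrow> 'a set" where C: "\<And>n. compact (C n)" "\<And>n. C n \<subseteq> U" "\<Union>(range C) = U"
    using open_Union_compact_subsets[OF assms(1)] by metis
  have "AE x in lborel. \<forall>n. x \<in> C n \<longrightarrow> P x"
    unfolding AE_all_countable using assms(2) C by blast
  then show ?thesis by eventually_elim (use C(3) in blast)
qed

lemma test_function_mollifier:
  assumes "\<And>x. GDERIV \<eta> x :> D x" "continuous_on UNIV D" "\<And>y. r \<le> norm y \<Longrightarrow> \<eta> y = 0" "compact K" "cball x r \<subseteq> K"
  shows "test_function K (\<lambda>y. \<eta> (y - x)) (\<lambda>y. D (y - x))"
  unfolding test_function_def
proof (intro conjI allI impI)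
  show "GDERIV (\<lambda>y. \<eta> (y - x)) y :> D (y - x)" for y by (rule GDERIV_translate) fact
  show "continuous_on UNIV (\<lambda>y. D (y - x))"
    by (rule continuous_on_compose2[OF assms(2)]) (auto intro!: continuous_intros)
  show "\<eta> (y - x) = 0" if "y \<notin> K" for y
    using that assms(3)[of "y - x"] assms(5) by (force simp: dist_norm norm_minus_commute)
qed fact

text \<open>The fundamental lemma of the calculus of variations. For \<open>x\<close> in
  \<open>K\<close> the kernel centred at \<open>x\<close> is a test function in \<open>K'\<close>,
  so the mollification of \<open>w\<close> vanishes on \<open>K\<close>. It is also within any given
  \<open>e\<close> of \<open>w\<close> in L^1.\<close>

lemma AE_zero_if_orthogonal_test_functions:
  fixes v :: "'a::euclidean_space \<Rightarrow> 'b::euclidean_space"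
  assumes U: "open U" and v: "locally_integrable_on v U"
    and orth: "\<And>K \<psi> D. K \<subseteq> U \<Longrightarrow> test_function K \<psi> D \<Longrightarrow> (LINT x:K|lborel. \<psi> x *\<^sub>R v x) = 0"
  shows "AE x in lborel. x \<in> U \<longrightarrow> v x = 0"
proof (rule AE_open_from_compact[OF U])
  fix K assume K: "compact K" "K \<subseteq> U"
  obtain r K' where K': "r > 0" "compact K'" "K' \<subseteq> U" "\<And>x. x \<in> K \<Longrightarrow> cball x r \<subseteq> K'"
    using compact_neighbourhood[OF K(1) U K(2)] by metis
  define w where "w x = indicator K' x *\<^sub>R v x" for x
  have w: "integrable lborel w"
    using v K' unfolding locally_integrable_on_def set_integrable_def w_def by auto
  have [measurable]: "w \<in> borel_measurable borel" "K \<in> sets borel" using w K by (auto simp: borel_compact)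
  have "(\<integral>\<^sup>+x. ennreal (norm (w x)) * indicator K x \<partial>lborel) \<le> ennreal e" if e: "e > 0" for e
  proof -
    obtain \<eta> :: "'a \<Rightarrow> real" and D where \<eta>: "\<And>x. GDERIV \<eta> x :> D x" "continuous_on UNIV D" 
      "\<And>x. r \<le> norm x \<Longrightarrow> \<eta> x = 0"
      "(\<integral>\<^sup>+x. norm ((\<integral>y. \<eta> (y - x) *\<^sub>R w y \<partial>lborel) - w x) \<partial>lborel) \<le> e"
      using mollifier_for[OF w K'(1) e] by blast
    have "(\<integral>y. \<eta> (y - x) *\<^sub>R w y \<partial>lborel) = 0" if "x \<in> K" for x
    proof -
      have "(\<integral>y. \<eta> (y - x) *\<^sub>R w y \<partial>lborel) = (LINT y:K'|lborel. \<eta> (y - x) *\<^sub>R v y)"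
        by (simp add: w_def set_lebesgue_integral_def mult.commute)
      also have "\<dots> = 0"
        by (rule orth[OF K'(3)]) (rule test_function_mollifier[OF \<eta>(1-3) K'(2) K'(4)[OF that]])
      finally show ?thesis .
    qed
    then have "(\<integral>\<^sup>+x. ennreal (norm (w x)) * indicator K x \<partial>lborel) \<le> (\<integral>\<^sup>+x. norm ((\<integral>y. \<eta> (y - x) *\<^sub>R w y \<partial>lborel) - w x) \<partial>lborel)"
      by (intro nn_integral_mono) (auto simp: indicator_def)
    with \<eta>(4) show ?thesis by (rule order_trans[rotated])
  qed
  note small = this
  have "(\<integral>\<^sup>+x. ennreal (norm (w x)) * indicator K x \<partial>lborel) \<le> 0"
  proof (rule ennreal_le_epsilon)
    fix e :: real assume "0 < e"
    then show "(\<integral>\<^sup>+x. ennreal (norm (w x)) * indicator K x \<partial>lborel) \<le> 0 + ennreal e" using small by simp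
  qed
  then have "AE x in lborel. ennreal (norm (w x)) * indicator K x = 0"
    by (subst (asm) le_zero_eq, subst (asm) nn_integral_0_iff_AE) auto
  then show "AE x in lborel. x \<in> K \<longrightarrow> v x = 0"
  proof eventually_elim
    case (elim x)
    show ?case
    proof
      assume "x \<in> K"
      then have "x \<in> K'" using K'(1) K'(4)[of x] by auto
      with elim \<open>x \<in> K\<close> show "v x = 0" by (simp add: w_def)
    qed
  qed
qed

text \<open>Mollification by a common sequence of kernels of \<open>f\<close>, of \<open>G\<close>
  and of \<open>norm (G x) powr p\<close>, each cut off to a neighbourhood \<open>K'\<close> of
  \<open>K\<close>. The third family \<open>H\<close> consists of majorants for the gradients
  \<open>DF\<close>, by Jensen's inequality. They depend on \<open>k\<close> but converge in L^1 on
  \<open>K\<close>, as dominated convergence with varying majorants requires. A nonnegative kernel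
  keeps \<open>F\<close> nonnegative, which is the last, conditional conclusion.\<close>

lemma weak_gradient_approx:
  fixes f :: "'a::euclidean_space \<Rightarrow> real"
  assumes U: "open U" and fG: "weak_gradient U f G" and K: "compact K" "K \<subseteq> U"
    and p: "p \<ge> 1" and Gp: "locally_integrable_on (\<lambda>x. norm (G x) powr p) U"
  obtains F DF H where
    "\<And>k x. GDERIV (F k) x :> DF k x" "\<And>k. continuous_on UNIV (DF k)"
    "\<And>k. integrable lborel (H k)"
    "AE x in lborel. x \<in> K \<longrightarrow> (\<lambda>k. F k x) \<longlonglongrightarrow> f x"
    "AE x in lborel. x \<in> K \<longrightarrow> (\<lambda>k. DF k x) \<longlonglongrightarrow> G x"
    "AE x in lborel. x \<in> K \<longrightarrow> (\<lambda>k. H k x) \<longlonglongrightarrow> norm (G x) powr p"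
    "\<And>k x. x \<in> K \<Longrightarrow> norm (DF k x) powr p \<le> H k x"
    "(\<lambda>k. \<integral>\<^sup>+x. ennreal \<bar>H k x - norm (G x) powr p\<bar> * indicator K x \<partial>lborel) \<longlonglongrightarrow> 0"
    "AE x in lborel. x \<in> U \<longrightarrow> 0 \<le> f x \<Longrightarrow> (\<forall>k x. 0 \<le> F k x)"
proof -
  obtain r K' where K': "r > 0" "compact K'" "K' \<subseteq> U" "\<And>x. x \<in> K \<Longrightarrow> cball x r \<subseteq> K'"
    using compact_neighbourhood[OF K(1) U K(2)] by metis
  have KK': "K \<subseteq> K'" using K'(1,4) by fastforce
  define w1 where "w1 x = indicator K' x *\<^sub>R f x" for x
  define w2 where "w2 x = indicator K' x *\<^sub>R G x" for x
  define w3 where "w3 x = indicator K' x *\<^sub>R norm (G x) powr p" for x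
  \<comment> \<open>Bundled into one function with values in a product space, the three functions
    are approximated by the same kernel and along the same subsequence.\<close>
  define w where "w x = (w1 x, w2 x, w3 x)" for x
  have w1: "integrable lborel w1" and w2: "integrable lborel w2" and w3: "integrable lborel w3"
    using fG Gp K' unfolding weak_gradient_def locally_integrable_on_def set_integrable_def w1_def[abs_def] w2_def[abs_def] w3_def[abs_def]
    by blast+
  have w: "integrable lborel w"
  proof (rule Bochner_Integration.integrable_bound)
    show "integrable lborel (\<lambda>x. norm (w1 x) + (norm (w2 x) + norm (w3 x)))" using w1 w2 w3 by auto
    have [measurable]: "w1 \<in> borel_measurable borel" "w2 \<in> borel_measurable borel" "w3 \<in> borel_measurable borel"
      using w1 w2 w3 by auto
    show "w \<in> borel_measurable lborel" unfolding w_def by measurable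
    show "AE x in lborel. norm (w x) \<le> norm (norm (w1 x) + (norm (w2 x) + norm (w3 x)))"
    proof (rule AE_I2)
      fix x
      have "norm (w x) \<le> norm (w1 x) + norm (w2 x, w3 x)" unfolding w_def by (rule norm_Pair_le)
      also have "norm (w2 x, w3 x) \<le> norm (w2 x) + norm (w3 x)" by (rule norm_Pair_le)
      finally show "norm (w x) \<le> norm (norm (w1 x) + (norm (w2 x) + norm (w3 x)))" by simp
    qed
  qed
  have "\<forall>k. \<exists>(\<eta>::'a \<Rightarrow> real) D. (\<forall>x. GDERIV \<eta> x :> D x) \<and> continuous_on UNIV D \<and> (\<forall>x. 0 \<le> \<eta> x)
    \<and> (\<forall>x. r \<le> norm x \<longrightarrow> \<eta> x = 0) \<and> integrable lborel \<eta> \<and> (\<integral>x. \<eta> x \<partial>lborel) = 1 \<and>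
    integrable lborel (\<lambda>x. \<integral>y. \<eta> (y - x) *\<^sub>R w y \<partial>lborel) \<and>
    (\<integral>\<^sup>+x. norm ((\<integral>y. \<eta> (y - x) *\<^sub>R w y \<partial>lborel) - w x) \<partial>lborel) \<le> ennreal (1 / real (Suc k))"
    using mollifier_for[OF w K'(1)] by simp
  from choice[OF this] obtain \<eta> :: "nat \<Rightarrow> 'a \<Rightarrow> real" where "\<forall>k. \<exists>D. (\<forall>x. GDERIV (\<eta> k) x :> D x) \<and> continuous_on UNIV D \<and> (\<forall>x. 0 \<le> \<eta> k x)
    \<and> (\<forall>x. r \<le> norm x \<longrightarrow> \<eta> k x = 0) \<and> integrable lborel (\<eta> k) \<and> (\<integral>x. \<eta> k x \<partial>lborel) = 1 \<and>
    integrable lborel (\<lambda>x. \<integral>y. \<eta> k (y - x) *\<^sub>R w y \<partial>lborel) \<and>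
    (\<integral>\<^sup>+x. norm ((\<integral>y. \<eta> k (y - x) *\<^sub>R w y \<partial>lborel) - w x) \<partial>lborel) \<le> ennreal (1 / real (Suc k))" ..
  from choice[OF this] obtain D where 
    \<eta>: "\<And>k x. GDERIV (\<eta> k) x :> D k x" "\<And>k. continuous_on UNIV (D k)" "\<And>k x. 0 \<le> \<eta> k x"
    "\<And>k x. r \<le> norm x \<Longrightarrow> \<eta> k x = 0" "\<And>k. integrable lborel (\<eta> k)" "\<And>k. (\<integral>x. \<eta> k x \<partial>lborel) = 1"
    and mw: "\<And>k. integrable lborel (\<lambda>x. \<integral>y. \<eta> k (y - x) *\<^sub>R w y \<partial>lborel)"
    "\<And>k. (\<integral>\<^sup>+x. norm ((\<integral>y. \<eta> k (y - x) *\<^sub>R w y \<partial>lborel) - w x) \<partial>lborel) \<le> ennreal (1 / real (Suc k))"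
    by blast
  have \<eta>c: "continuous_on UNIV (\<eta> k)" for k using \<eta>(1) by (rule continuous_on_GDERIV)
  have [measurable]: "\<eta> k \<in> borel_measurable borel" for k using \<eta>c by (rule borel_measurable_continuous_onI)
  have "\<exists>B. \<forall>x. \<bar>\<eta> k x\<bar> \<le> B" for k
    using compact_support_bounded[OF \<eta>c, of "cball 0 r" k] \<eta>(4)[of _ k] by (metis compact_cball linear mem_cball_0 real_norm_def)
  then obtain B where B: "\<And>k x. \<bar>\<eta> k x\<bar> \<le> B k" by metis
  have bm: "integrable lborel (\<lambda>y. \<eta> k (y - x) *\<^sub>R h y)" if "integrable lborel h" for k x and h :: "'a \<Rightarrow> 'c::euclidean_space"
    using that B[of k] by (intro integrable_bounded_mult[where B="B k"]) auto
  define F where "F k x = (\<integral>y. \<eta> k (y - x) *\<^sub>R w1 y \<partial>lborel)" for k x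
  define DF where "DF k x = - (\<integral>y. w1 y *\<^sub>R D k (y - x) \<partial>lborel)" for k x
  define H where "H k x = (\<integral>y. \<eta> k (y - x) *\<^sub>R w3 y \<partial>lborel)" for k x
  define M2 where "M2 k x = (\<integral>y. \<eta> k (y - x) *\<^sub>R w2 y \<partial>lborel)" for k x
  have triple: "(\<integral>y. \<eta> k (y - x) *\<^sub>R w y \<partial>lborel) = (F k x, M2 k x, H k x)" for k x
  proof -
    note i = bm[OF w, of k x]
    have 1: "fst (\<integral>y. \<eta> k (y - x) *\<^sub>R w y \<partial>lborel) = F k x"
      unfolding F_def by (subst integral_bounded_linear[OF bounded_linear_fst i, symmetric]) (simp add: w_def)
    have 2: "fst (snd (\<integral>y. \<eta> k (y - x) *\<^sub>R w y \<partial>lborel)) = M2 k x"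
      unfolding M2_def by (subst integral_bounded_linear[OF bounded_linear_compose[OF bounded_linear_fst bounded_linear_snd] i, symmetric]) (simp add: w_def)
    have 3: "snd (snd (\<integral>y. \<eta> k (y - x) *\<^sub>R w y \<partial>lborel)) = H k x"
      unfolding H_def by (subst integral_bounded_linear[OF bounded_linear_compose[OF bounded_linear_snd bounded_linear_snd] i, symmetric]) (simp add: w_def)
    show ?thesis using 1 2 3 by (metis prod.collapse)
  qed
  \<comment> \<open>In \<open>DF\<close> the derivative falls on the kernel. For \<open>x\<close> in
    \<open>K\<close> the translated kernel is a test function in \<open>K'\<close>, so the
    definition of the weak gradient moves the derivative over to \<open>f\<close> and yields the
    mollified \<open>G\<close>.\<close>
  have DFM2: "DF k x = M2 k x" if "x \<in> K" for k x
  proof -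
    have "(LINT y:K'|lborel. f y *\<^sub>R D k (y - x)) = - (LINT y:K'|lborel. \<eta> k (y - x) *\<^sub>R G y)"
      using fG K'(3) test_function_mollifier[OF \<eta>(1,2,4) K'(2) K'(4)[OF that]] unfolding weak_gradient_def by blast
    then show ?thesis
      by (simp add: DF_def M2_def w1_def w2_def set_lebesgue_integral_def mult.commute)
  qed
  define u where "u k x = (F k x, M2 k x, H k x) - w x" for k x
  have ui: "integrable lborel (u k)" for k
    unfolding u_def using mw(1)[of k] w unfolding triple by (rule Bochner_Integration.integrable_diff)
  have un: "(\<integral>\<^sup>+x. norm (u k x) \<partial>lborel) \<le> ennreal (1 / real (Suc k))" for k
    using mw(2)[of k] unfolding triple u_def .
  have "(\<integral>x. norm (u k x) \<partial>lborel) \<le> 1 / real (Suc k)" for k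
    using un[of k] ui[of k] by (subst (asm) nn_integral_eq_integral) auto
  then have "(\<lambda>k. \<integral>x. norm (u k x) \<partial>lborel) \<longlonglongrightarrow> 0"
    by (intro tendsto_sandwich[OF _ _ tendsto_const LIMSEQ_Suc[OF lim_const_over_n[of 1]]]) auto
  \<comment> \<open>Convergence in L^1 gives pointwise convergence almost everywhere along a
    subsequence only; everything is passed to it.\<close>
  from tendsto_L1_AE_subseq[OF ui this] obtain s where s: "strict_mono s" "AE x in lborel. (\<lambda>n. u (s n) x) \<longlonglongrightarrow> 0"
    by blast
  have "(\<lambda>k. \<integral>\<^sup>+x. norm (u k x) \<partial>lborel) \<longlonglongrightarrow> 0"
  proof (rule tendsto_sandwich[OF _ _ tendsto_const])
    have "(\<lambda>k. ennreal (1 / real (Suc k))) \<longlonglongrightarrow> ennreal 0"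
      by (intro tendsto_ennrealI LIMSEQ_Suc[OF lim_const_over_n[of 1]])
    then show "(\<lambda>k. ennreal (1 / real (Suc k))) \<longlonglongrightarrow> 0" by simp
  qed (use un in auto)
  then have us: "(\<lambda>k. \<integral>\<^sup>+x. norm (u (s k) x) \<partial>lborel) \<longlonglongrightarrow> 0"
    using LIMSEQ_subseq_LIMSEQ[OF _ s(1)] by (fastforce simp: o_def)
  have conv: "AE x in lborel. x \<in> K \<longrightarrow> (\<lambda>k. F (s k) x) \<longlonglongrightarrow> f x \<and> (\<lambda>k. M2 (s k) x) \<longlonglongrightarrow> G x \<and> (\<lambda>k. H (s k) x) \<longlonglongrightarrow> norm (G x) powr p"
    using s(2)
  proof eventually_elim
    case (elim x)
    show ?case
    proof
      assume "x \<in> K"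
      then have wx: "w x = (f x, G x, norm (G x) powr p)" using KK' by (auto simp: w_def w1_def w2_def w3_def)
      have "(\<lambda>k. u (s k) x + w x) \<longlonglongrightarrow> 0 + w x" using elim by (intro tendsto_intros)
      then have *: "(\<lambda>k. (F (s k) x, M2 (s k) x, H (s k) x)) \<longlonglongrightarrow> (f x, G x, norm (G x) powr p)"
        using wx by (simp add: u_def)
      show "(\<lambda>k. F (s k) x) \<longlonglongrightarrow> f x \<and> (\<lambda>k. M2 (s k) x) \<longlonglongrightarrow> G x \<and> (\<lambda>k. H (s k) x) \<longlonglongrightarrow> norm (G x) powr p"
        using tendsto_fst[OF *] tendsto_fst[OF tendsto_snd[OF *]] tendsto_snd[OF tendsto_snd[OF *]] by simp
    qed
  qed
  show ?thesis
  proof (rule that[of "\<lambda>k. F (s k)" "\<lambda>k. DF (s k)" "\<lambda>k. H (s k)"])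
    fix k x
    have ts: "compact (cball (0::'a) r)" "y \<notin> cball 0 r \<Longrightarrow> \<eta> (s k) y = 0" for y :: 'a
      using \<eta>(4)[of y "s k"] by auto
    show "GDERIV (F (s k)) x :> DF (s k) x"
      unfolding F_def[abs_def] DF_def by (rule GDERIV_convolution(1)[OF \<eta>(1,2) ts w1])
    show "continuous_on UNIV (DF (s k))"
      unfolding DF_def[abs_def] by (rule GDERIV_convolution(2)[OF \<eta>(1,2) ts w1])
    have "integrable lborel (\<lambda>x. snd (snd (F (s k) x, M2 (s k) x, H (s k) x)))"
      using mw(1)[of "s k"] unfolding triple
      by (intro integrable_bounded_linear[OF bounded_linear_compose[OF bounded_linear_snd bounded_linear_snd]])
    then show "integrable lborel (H (s k))" by simp
    show "norm (DF (s k) x) powr p \<le> H (s k) x" if "x \<in> K"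
    proof -
      have "norm (\<integral>y. \<eta> (s k) (y - x) *\<^sub>R w2 y \<partial>lborel) powr p \<le> (\<integral>y. \<eta> (s k) (y - x) * norm (w2 y) powr p \<partial>lborel)"
      proof (rule norm_powr_integral_le[OF p])
        show "integrable lborel (\<lambda>y. \<eta> (s k) (y - x))"
          using \<eta>(5)[of "s k"] lborel_integral_translation(1)[of "\<eta> (s k)" "-x"] by simp
        show "(\<integral>y. \<eta> (s k) (y - x) \<partial>lborel) = 1"
          using \<eta>(6)[of "s k"] lborel_integral_translation(2)[of "\<eta> (s k)" "-x"] by simp
        show "integrable lborel (\<lambda>y. \<eta> (s k) (y - x) * norm (w2 y) powr p)"
        proof -
          have "norm (w2 y) powr p = w3 y" for y using p by (auto simp: w2_def w3_def indicator_def)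
          then show ?thesis using bm[OF w3, of "s k" x] by simp
        qed
      qed (use \<eta> bm w2 in auto)
      also have "(\<integral>y. \<eta> (s k) (y - x) * norm (w2 y) powr p \<partial>lborel) = H (s k) x"
        unfolding H_def by (intro Bochner_Integration.integral_cong) (use p in \<open>auto simp: w2_def w3_def indicator_def\<close>)
      finally show ?thesis using DFM2[OF that] by (simp add: M2_def)
    qed
  next
    show "AE x in lborel. x \<in> K \<longrightarrow> (\<lambda>k. F (s k) x) \<longlonglongrightarrow> f x" using conv by auto
    show "AE x in lborel. x \<in> K \<longrightarrow> (\<lambda>k. DF (s k) x) \<longlonglongrightarrow> G x" using conv by eventually_elim (simp add: DFM2)
    show "AE x in lborel. x \<in> K \<longrightarrow> (\<lambda>k. H (s k) x) \<longlonglongrightarrow> norm (G x) powr p" using conv by auto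
    show "(\<lambda>k. \<integral>\<^sup>+x. ennreal \<bar>H (s k) x - norm (G x) powr p\<bar> * indicator K x \<partial>lborel) \<longlonglongrightarrow> 0"
    proof (rule tendsto_sandwich[OF _ _ tendsto_const us]; intro always_eventually allI)
      fix k
      show "(\<integral>\<^sup>+x. ennreal \<bar>H (s k) x - norm (G x) powr p\<bar> * indicator K x \<partial>lborel) \<le> (\<integral>\<^sup>+x. norm (u (s k) x) \<partial>lborel)"
      proof (rule nn_integral_mono)
        fix x
        have "\<bar>snd (snd (u (s k) x))\<bar> \<le> norm (u (s k) x)"
          by (cases "u (s k) x") (metis norm_snd_le order_trans real_norm_def snd_conv)
        then show "ennreal \<bar>H (s k) x - norm (G x) powr p\<bar> * indicator K x \<le> ennreal (norm (u (s k) x))"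
          using KK' by (auto simp: indicator_def u_def w_def w3_def intro!: ennreal_leI)
      qed
    qed auto
  next
    assume nn: "AE x in lborel. x \<in> U \<longrightarrow> 0 \<le> f x"
    have "0 \<le> F k x" for k x
      unfolding F_def
    proof (rule integral_nonneg_AE)
      show "AE y in lborel. 0 \<le> \<eta> k (y - x) *\<^sub>R w1 y"
        using nn by eventually_elim (use K'(3) \<eta>(3) in \<open>auto simp: w1_def indicator_def\<close>)
    qed
    then show "\<forall>k x. 0 \<le> F (s k) x" by auto
  qed
qed

section \<open>Chain rule and uniqueness for weak gradients\<close>

lemma test_function_gradient_zero: "test_function K \<psi> D \<Longrightarrow> x \<notin> K \<Longrightarrow> D x = 0"
  unfolding test_function_def by (metis GDERIV_zero_outside compact_imp_closed)

lemma test_function_bounds: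
  assumes "test_function K \<psi> D"
  obtains C where "C \<ge> 0" "\<And>x. \<bar>\<psi> x\<bar> \<le> C" "\<And>x. norm (D x) \<le> C"
proof -
  have "continuous_on UNIV \<psi>" using assms continuous_on_GDERIV unfolding test_function_def by blast
  then obtain C1 where "\<And>x. norm (\<psi> x) \<le> C1"
    using compact_support_bounded[of \<psi> K] assms unfolding test_function_def by metis
  moreover obtain C2 where "C2 \<ge> 0" "\<And>x. norm (D x) \<le> C2"
    using compact_support_bounded[of D K] assms test_function_gradient_zero[OF assms] unfolding test_function_def by metis
  ultimately show ?thesis by (intro that[of "max C1 C2"]) (auto simp: le_max_iff_disj)
qed

lemma test_function_continuous:
  assumes "test_function K \<psi> D" shows "continuous_on UNIV \<psi>" "continuous_on UNIV D"
  using assms continuous_on_GDERIV unfolding test_function_def by blast+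

lemma set_integrable_bounded_scaleR:
  fixes f :: "'a \<Rightarrow> 'b::{banach, second_countable_topology}" and c :: "'a \<Rightarrow> real"
  assumes "set_integrable M A f" "c \<in> borel_measurable M" "\<And>x. \<bar>c x\<bar> \<le> B"
  shows "set_integrable M A (\<lambda>x. c x *\<^sub>R f x)"
  using integrable_bounded_mult[OF assms[unfolded set_integrable_def]] unfolding set_integrable_def
  by (simp add: mult.commute)

lemma set_integrable_scaleR_bounded:
  fixes f :: "'a \<Rightarrow> real" and D :: "'a \<Rightarrow> 'b::{banach, second_countable_topology}"
  assumes "set_integrable M A f" "D \<in> borel_measurable M" "\<And>x. norm (D x) \<le> B"
  shows "set_integrable M A (\<lambda>x. f x *\<^sub>R D x)"
  unfolding set_integrable_def
proof (rule Bochner_Integration.integrable_bound)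
  have f: "integrable M (\<lambda>x. indicator A x *\<^sub>R f x)" using assms(1) by (simp add: set_integrable_def)
  show "integrable M (\<lambda>x. B * (indicator A x *\<^sub>R f x))" using f by (rule integrable_mult_right)
  have "(\<lambda>x. (indicator A x *\<^sub>R f x) *\<^sub>R D x) \<in> borel_measurable M"
    using borel_measurable_integrable[OF f] assms(2) by measurable
  then show "(\<lambda>x. indicator A x *\<^sub>R f x *\<^sub>R D x) \<in> borel_measurable M" by simp
  show "AE x in M. norm (indicator A x *\<^sub>R f x *\<^sub>R D x) \<le> norm (B * (indicator A x *\<^sub>R f x))"
    using order_trans[OF assms(3) abs_ge_self]
    by (intro AE_I2) (auto simp: abs_mult indicator_def mult.commute[of "\<bar>B\<bar>"] intro!: mult_left_mono)
qed

text \<open>Measurability of \<open>f\<close> is known on \<open>K\<close> only. Applying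
  \<open>\<Phi>\<close> to the cut-off function instead changes no value on
  \<open>K\<close>.\<close>

lemma set_measurable_compose:
  fixes f :: "'a::euclidean_space \<Rightarrow> real" and \<Phi> :: "real \<Rightarrow> real"
  assumes "set_integrable lborel K f" "\<Phi> \<in> borel_measurable borel" "K \<in> sets borel"
  shows "(\<lambda>x. indicator K x *\<^sub>R \<Phi> (f x)) \<in> borel_measurable borel"
proof -
  have [measurable]: "(\<lambda>x. indicator K x *\<^sub>R f x) \<in> borel_measurable borel" "\<Phi> \<in> borel_measurable borel" "K \<in> sets borel"
    using assms by (auto simp: set_integrable_def dest: borel_measurable_integrable)
  have "(\<lambda>x. indicator K x *\<^sub>R \<Phi> (indicator K x *\<^sub>R f x)) \<in> borel_measurable borel" by measurable
  also have "(\<lambda>x. indicator K x *\<^sub>R \<Phi> (indicator K x *\<^sub>R f x)) = (\<lambda>x. indicator K x *\<^sub>R \<Phi> (f x))"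
    by (auto simp: indicator_def fun_eq_iff)
  finally show ?thesis .
qed

text \<open>For a C^1 approximation \<open>F k\<close> the product of \<open>\<Phi> (F k x)\<close>
  and \<open>\<psi> x\<close> is C^1 with compact support, so its gradient has integral zero. This
  identity passes to the limit because \<open>\<Phi>\<close>, \<open>\<Phi>'\<close>,
  \<open>\<psi>\<close> and \<open>D\<close> are bounded, which leaves \<open>norm (DF k x)\<close>
  as the only factor to be controlled.\<close>

lemma weak_gradient_chain:
  fixes f :: "'a::euclidean_space \<Rightarrow> real"
  assumes U: "open U" and fG: "weak_gradient U f G"
    and \<Phi>: "\<And>t. (\<Phi> has_real_derivative \<Phi>' t) (at t)" "continuous_on UNIV \<Phi>'"
    and B: "\<And>t. \<bar>\<Phi> t\<bar> \<le> B" "\<And>t. \<bar>\<Phi>' t\<bar> \<le> B"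
  shows "weak_gradient U (\<lambda>x. \<Phi> (f x)) (\<lambda>x. \<Phi>' (f x) *\<^sub>R G x)"
proof -
  have B0: "B \<ge> 0" using B(1)[of 0] by linarith
  have \<Phi>c: "continuous_on UNIV \<Phi>" using \<Phi>(1) by (meson DERIV_isCont continuous_at_imp_continuous_on)
  have [measurable]: "\<Phi> \<in> borel_measurable borel" "\<Phi>' \<in> borel_measurable borel"
    using \<Phi>c \<Phi>(2) by (auto intro: borel_measurable_continuous_onI)
  have li: "set_integrable lborel K f" "set_integrable lborel K G" if "compact K" "K \<subseteq> U" for K
    using fG that unfolding weak_gradient_def locally_integrable_on_def by auto
  have i1: "set_integrable lborel K (\<lambda>x. \<Phi> (f x))" if K: "compact K" "K \<subseteq> U" for K
    unfolding set_integrable_def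
  proof (rule Bochner_Integration.integrable_bound)
    show "integrable lborel (\<lambda>x. indicator K x *\<^sub>R B)"
      using K by (intro borel_integrable_compact) auto
    show "(\<lambda>x. indicator K x *\<^sub>R \<Phi> (f x)) \<in> borel_measurable lborel"
      using set_measurable_compose[OF li(1)[OF K]] K by (simp add: borel_compact)
    show "AE x in lborel. norm (indicator K x *\<^sub>R \<Phi> (f x)) \<le> norm (indicator K x *\<^sub>R B)"
      using order_trans[OF B(1) abs_ge_self] by (auto simp: indicator_def)
  qed
  have i2: "set_integrable lborel K (\<lambda>x. \<Phi>' (f x) *\<^sub>R G x)" if K: "compact K" "K \<subseteq> U" for K
    unfolding set_integrable_def
  proof (rule Bochner_Integration.integrable_bound)
    have G: "integrable lborel (\<lambda>x. indicator K x *\<^sub>R G x)" using li(2)[OF K] by (simp add: set_integrable_def)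
    then show "integrable lborel (\<lambda>x. B *\<^sub>R (indicator K x *\<^sub>R G x))" by (rule integrable_scaleR_right)
    have "(\<lambda>x. indicator K x *\<^sub>R \<Phi>' (f x)) \<in> borel_measurable borel"
      using set_measurable_compose[OF li(1)[OF K]] K by (simp add: borel_compact)
    then have "(\<lambda>x. (indicator K x *\<^sub>R \<Phi>' (f x)) *\<^sub>R (indicator K x *\<^sub>R G x)) \<in> borel_measurable lborel"
      using borel_measurable_scaleR[OF _ borel_measurable_integrable[OF G]] by simp
    also have "(\<lambda>x. (indicator K x *\<^sub>R \<Phi>' (f x)) *\<^sub>R (indicator K x *\<^sub>R G x)) = (\<lambda>x. indicator K x *\<^sub>R \<Phi>' (f x) *\<^sub>R G x)"
      by (auto simp: indicator_def fun_eq_iff)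
    finally show "(\<lambda>x. indicator K x *\<^sub>R \<Phi>' (f x) *\<^sub>R G x) \<in> borel_measurable lborel" .
    show "AE x in lborel. norm (indicator K x *\<^sub>R \<Phi>' (f x) *\<^sub>R G x) \<le> norm (B *\<^sub>R (indicator K x *\<^sub>R G x))"
      using order_trans[OF B(2) abs_ge_self] by (auto simp: indicator_def intro!: mult_right_mono)
  qed
  have "(LINT x:K|lborel. \<Phi> (f x) *\<^sub>R D x) = - (LINT x:K|lborel. \<psi> x *\<^sub>R \<Phi>' (f x) *\<^sub>R G x)"
    if K: "K \<subseteq> U" and t: "test_function K \<psi> D" for K \<psi> D
  proof -
    have Kc: "compact K" using t by (simp add: test_function_def)
    have [measurable]: "K \<in> sets borel" "\<psi> \<in> borel_measurable borel" "D \<in> borel_measurable borel"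
      using Kc test_function_continuous[OF t] by (auto simp: borel_compact intro: borel_measurable_continuous_onI)
    have Kfin: "emeasure lborel K < \<infinity>" using Kc by (rule emeasure_compact_finite)
    obtain C where C: "C \<ge> 0" "\<And>x. \<bar>\<psi> x\<bar> \<le> C" "\<And>x. norm (D x) \<le> C" using test_function_bounds[OF t] by blast
    \<comment> \<open>The approximation is used with exponent 1, for which its integrability
      condition is just the local integrability of \<open>G\<close>.\<close>
    have lG: "locally_integrable_on (\<lambda>x. norm (G x) powr 1) U"
      using fG unfolding weak_gradient_def locally_integrable_on_def by (auto intro: set_integrable_norm)
    obtain F DF H where
      F: "\<And>k x. GDERIV (F k) x :> DF k x" "\<And>k. continuous_on UNIV (DF k)"
      and H: "\<And>k. integrable lborel (H k)"
      and lim: "AE x in lborel. x \<in> K \<longrightarrow> (\<lambda>k. F k x) \<longlonglongrightarrow> f x"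
        "AE x in lborel. x \<in> K \<longrightarrow> (\<lambda>k. DF k x) \<longlonglongrightarrow> G x"
        "AE x in lborel. x \<in> K \<longrightarrow> (\<lambda>k. H k x) \<longlonglongrightarrow> norm (G x) powr 1"
      and le: "\<And>k x. x \<in> K \<Longrightarrow> norm (DF k x) powr 1 \<le> H k x"
      and L1: "(\<lambda>k. \<integral>\<^sup>+x. ennreal \<bar>H k x - norm (G x) powr 1\<bar> * indicator K x \<partial>lborel) \<longlonglongrightarrow> 0"
      by (rule weak_gradient_approx[OF U fG Kc K order_refl lG]) (rule that; assumption)
    have Fc: "continuous_on UNIV (F k)" for k using F(1) by (rule continuous_on_GDERIV)
    have [measurable]: "F k \<in> borel_measurable borel" "DF k \<in> borel_measurable borel" "H k \<in> borel_measurable borel" for k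
      using Fc F(2) H by (auto intro: borel_measurable_continuous_onI)
    define A where "A k x = \<Phi> (F k x) *\<^sub>R D x + \<psi> x *\<^sub>R \<Phi>' (F k x) *\<^sub>R DF k x" for k x
    define a where "a x = indicator K x *\<^sub>R (\<Phi> (f x) *\<^sub>R D x) + indicator K x *\<^sub>R (\<psi> x *\<^sub>R \<Phi>' (f x) *\<^sub>R G x)" for x
    have A0: "(\<integral>x. A k x \<partial>lborel) = 0" for k
      unfolding A_def
    proof (rule integral_GDERIV_compact_support[of "\<lambda>x. \<Phi> (F k x) * \<psi> x", OF _ _ Kc])
      show "GDERIV (\<lambda>x. \<Phi> (F k x) * \<psi> x) x :> \<Phi> (F k x) *\<^sub>R D x + \<psi> x *\<^sub>R \<Phi>' (F k x) *\<^sub>R DF k x" for x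
        using t by (intro GDERIV_mult GDERIV_DERIV_compose[OF F(1) \<Phi>(1)]) (auto simp: test_function_def)
      show "continuous_on UNIV (\<lambda>x. \<Phi> (F k x) *\<^sub>R D x + \<psi> x *\<^sub>R \<Phi>' (F k x) *\<^sub>R DF k x)"
        using test_function_continuous[OF t] Fc F(2)
        by (intro continuous_intros continuous_on_compose2[OF \<Phi>c] continuous_on_compose2[OF \<Phi>(2)]) auto
      show "\<Phi> (F k x) * \<psi> x = 0" if "x \<notin> K" for x using t that by (simp add: test_function_def)
    qed
    have 1: "set_integrable lborel K (\<lambda>x. \<Phi> (f x) *\<^sub>R D x)"
      by (rule set_integrable_scaleR_bounded[OF i1[OF Kc K], of _ C]) (use C in auto)
    have 2: "set_integrable lborel K (\<lambda>x. \<psi> x *\<^sub>R \<Phi>' (f x) *\<^sub>R G x)"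
      by (rule set_integrable_bounded_scaleR[OF i2[OF Kc K], of _ C]) (use C in auto)
    have iG: "integrable lborel (\<lambda>x. indicator K x * norm (G x))"
      using set_integrable_norm[OF li(2)[OF Kc K]] by (simp add: set_integrable_def)
    \<comment> \<open>The first summand bounds the term with \<open>D\<close>, the second the term
      with \<open>DF k\<close>, whose norm is at most \<open>H k\<close>. With exponent 1 the limit
      of \<open>H k\<close> on \<open>K\<close> is \<open>norm (G x)\<close>, whence
      \<open>b\<close>.\<close>
    define Bk where "Bk k x = indicator K x * (B * C) + indicator K x * ((C * B) * H k x)" for k x
    define b where "b x = indicator K x * (B * C) + (C * B) * (indicator K x * norm (G x))" for x
    have "(\<lambda>k. \<integral>x. A k x \<partial>lborel) \<longlonglongrightarrow> (\<integral>x. a x \<partial>lborel)"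
    proof (rule tendsto_integral_generalized_dominated(3)[where B=Bk and b=b])
      show "A k \<in> borel_measurable lborel" for k unfolding A_def by measurable
      show "a \<in> borel_measurable lborel"
        unfolding a_def using 1 2 by (auto simp: set_integrable_def)
      show "integrable lborel (Bk k)" for k
        unfolding Bk_def mult.commute[of "indicator K _"] using H Kfin by (intro Bochner_Integration.integrable_add integrable_real_mult_indicator integrable_mult_right) auto
      show "integrable lborel b"
        unfolding b_def using iG Kfin by (intro Bochner_Integration.integrable_add integrable_mult_right) auto
      show "AE x in lborel. (\<lambda>k. A k x) \<longlonglongrightarrow> a x"
        using lim(1,2)
      proof eventually_elim
        case (elim x)
        show ?case
        proof (cases "x \<in> K")
          case True
          have "(\<lambda>k. \<Phi> (F k x)) \<longlonglongrightarrow> \<Phi> (f x)" "(\<lambda>k. \<Phi>' (F k x)) \<longlonglongrightarrow> \<Phi>' (f x)"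
            using elim True \<Phi>c \<Phi>(2) by (auto intro: continuous_on_tendsto_compose)
          then have "(\<lambda>k. A k x) \<longlonglongrightarrow> \<Phi> (f x) *\<^sub>R D x + \<psi> x *\<^sub>R \<Phi>' (f x) *\<^sub>R G x"
            unfolding A_def using elim True by (intro tendsto_intros) auto
          then show ?thesis using True by (simp add: a_def)
        next
          case False
          then show ?thesis using t test_function_gradient_zero[OF t False] by (simp add: A_def a_def test_function_def)
        qed
      qed
      show "AE x in lborel. (\<lambda>k. Bk k x) \<longlonglongrightarrow> b x"
        using lim(3)
      proof eventually_elim
        case (elim x)
        show ?case
        proof (cases "x \<in> K")
          case True
          with elim have "(\<lambda>k. H k x) \<longlonglongrightarrow> norm (G x)" by simp
          then have "(\<lambda>k. indicator K x * (B * C) + indicator K x * ((C * B) * H k x)) \<longlonglongrightarrow> indicator K x * (B * C) + indicator K x * ((C * B) * norm (G x))"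
            by (intro tendsto_intros)
          then show ?thesis using True by (simp add: Bk_def b_def)
        qed (simp add: Bk_def b_def)
      qed
      show "AE x in lborel. norm (A k x) \<le> Bk k x" for k
      proof (rule AE_I2)
        fix x
        show "norm (A k x) \<le> Bk k x"
        proof (cases "x \<in> K")
          case True
          have "norm (A k x) \<le> \<bar>\<Phi> (F k x)\<bar> * norm (D x) + \<bar>\<psi> x\<bar> * (\<bar>\<Phi>' (F k x)\<bar> * norm (DF k x))"
            unfolding A_def by (rule order_trans[OF norm_triangle_ineq]) (simp add: abs_mult)
          also have "\<dots> \<le> B * C + C * (B * H k x)"
            using B C B0 le[OF True] by (intro add_mono mult_mono) auto
          finally show ?thesis using True by (simp add: Bk_def)
        next
          case False
          then show ?thesis using t test_function_gradient_zero[OF t False] by (simp add: A_def Bk_def test_function_def)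
        qed
      qed
      have "(\<integral>\<^sup>+x. \<bar>Bk k x - b x\<bar> \<partial>lborel) = ennreal (C * B) * (\<integral>\<^sup>+x. ennreal \<bar>H k x - norm (G x) powr 1\<bar> * indicator K x \<partial>lborel)" for k
      proof -
        have [measurable]: "(\<lambda>x. indicator K x * norm (G x)) \<in> borel_measurable borel"
          using borel_measurable_integrable[OF iG] by simp
        define w where "w x = indicator K x * norm (G x)" for x
        have [measurable]: "w \<in> borel_measurable borel" unfolding w_def[abs_def] by fact
        have "ennreal \<bar>Bk k x - b x\<bar> = ennreal (C * B) * (ennreal \<bar>H k x - w x\<bar> * indicator K x)" for x
          using C(1) B0 by (auto simp: Bk_def b_def w_def indicator_def abs_mult simp flip: right_diff_distrib ennreal_mult)
        moreover have "(\<integral>\<^sup>+x. ennreal (C * B) * (ennreal \<bar>H k x - w x\<bar> * indicator K x) \<partial>lborel) 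
           = ennreal (C * B) * (\<integral>\<^sup>+x. (ennreal \<bar>H k x - w x\<bar> * indicator K x) \<partial>lborel)"
          by (intro nn_integral_cmult) measurable
        moreover have "(\<integral>\<^sup>+x. (ennreal \<bar>H k x - w x\<bar> * indicator K x) \<partial>lborel) = (\<integral>\<^sup>+x. ennreal \<bar>H k x - norm (G x) powr 1\<bar> * indicator K x \<partial>lborel)"
          by (intro nn_integral_cong) (auto simp: indicator_def w_def)
        ultimately show ?thesis by simp
      qed
      moreover have "(\<lambda>k. ennreal (C * B) * (\<integral>\<^sup>+x. ennreal \<bar>H k x - norm (G x) powr 1\<bar> * indicator K x \<partial>lborel)) \<longlonglongrightarrow> ennreal (C * B) * 0"
        using L1 by (intro ennreal_tendsto_cmult) auto
      ultimately show "(\<lambda>k. \<integral>\<^sup>+x. \<bar>Bk k x - b x\<bar> \<partial>lborel) \<longlonglongrightarrow> 0" by simp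
    qed
    then have "(\<integral>x. a x \<partial>lborel) = 0" unfolding A0 by (simp add: LIMSEQ_const_iff)
    moreover have "(\<integral>x. a x \<partial>lborel) = (LINT x:K|lborel. \<Phi> (f x) *\<^sub>R D x) + (LINT x:K|lborel. \<psi> x *\<^sub>R \<Phi>' (f x) *\<^sub>R G x)"
      unfolding a_def set_lebesgue_integral_def using 1 2 unfolding set_integrable_def by (rule Bochner_Integration.integral_add)
    ultimately show ?thesis by (simp add: eq_neg_iff_add_eq_0)
  qed
  then show ?thesis unfolding weak_gradient_def locally_integrable_on_def using i1 i2 by blast
qed

text \<open>Integration by parts sees the function only up to null sets, so the difference of the
  two gradients is orthogonal to every test function.\<close>

lemma weak_gradient_unique:
  fixes f h :: "'a::euclidean_space \<Rightarrow> real"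
  assumes U: "open U" and f: "weak_gradient U f G" and h: "weak_gradient U h H"
    and eq: "AE x in lborel. x \<in> U \<longrightarrow> f x = h x"
  shows "AE x in lborel. x \<in> U \<longrightarrow> G x = H x"
proof -
  have GH: "set_integrable lborel K G" "set_integrable lborel K H" "set_integrable lborel K f" "set_integrable lborel K h" if "compact K" "K \<subseteq> U" for K
    using f h that unfolding weak_gradient_def locally_integrable_on_def by auto
  have "AE x in lborel. x \<in> U \<longrightarrow> G x - H x = 0"
  proof (rule AE_zero_if_orthogonal_test_functions[OF U])
    show "locally_integrable_on (\<lambda>x. G x - H x) U"
      using f h unfolding weak_gradient_def locally_integrable_on_def by (auto intro: set_integral_diff)
    fix K \<psi> D assume K: "K \<subseteq> U" and t: "test_function K \<psi> D"
    have Kc: "compact K" using t by (simp add: test_function_def)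
    have [measurable]: "K \<in> sets borel" "\<psi> \<in> borel_measurable borel" "D \<in> borel_measurable borel"
      using Kc test_function_continuous[OF t] by (auto simp: borel_compact intro: borel_measurable_continuous_onI)
    obtain C where C: "C \<ge> 0" "\<And>x. \<bar>\<psi> x\<bar> \<le> C" "\<And>x. norm (D x) \<le> C" using test_function_bounds[OF t] by blast
    note GH' = GH[OF Kc K]
    have fm: "(\<lambda>x. indicator K x *\<^sub>R f x) \<in> borel_measurable borel" "(\<lambda>x. indicator K x *\<^sub>R h x) \<in> borel_measurable borel"
      using GH' by (auto simp: set_integrable_def dest: borel_measurable_integrable)
    have 1: "set_integrable lborel K (\<lambda>x. \<psi> x *\<^sub>R G x)" "set_integrable lborel K (\<lambda>x. \<psi> x *\<^sub>R H x)"
      by (rule set_integrable_bounded_scaleR[of _ _ _ _ C]; use GH' C in auto)+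
    have "(LINT x:K|lborel. \<psi> x *\<^sub>R (G x - H x)) = (LINT x:K|lborel. \<psi> x *\<^sub>R G x) - (LINT x:K|lborel. \<psi> x *\<^sub>R H x)"
      unfolding scaleR_diff_right using 1 by (rule set_integral_diff)
    also have "\<dots> = (LINT x:K|lborel. h x *\<^sub>R D x) - (LINT x:K|lborel. f x *\<^sub>R D x)"
      using f h K t unfolding weak_gradient_def by simp
    also have "(LINT x:K|lborel. h x *\<^sub>R D x) = (LINT x:K|lborel. f x *\<^sub>R D x)"
    proof -
      have "(\<integral>x. (indicator K x *\<^sub>R h x) *\<^sub>R D x \<partial>lborel) = (\<integral>x. (indicator K x *\<^sub>R f x) *\<^sub>R D x \<partial>lborel)"
        by (rule integral_cong_AE) (use eq fm K in \<open>auto elim!: eventually_mono simp: indicator_def\<close>)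
      then show ?thesis by (simp add: set_lebesgue_integral_def)
    qed
    finally show "(LINT x:K|lborel. \<psi> x *\<^sub>R (G x - H x)) = 0" by simp
  qed
  then show ?thesis by eventually_elim auto
qed

text \<open>The functions \<open>s / (1 + n s\<^sup>2)\<close> tend to \<open>0\<close>, while their derivatives tend to the indicator of \<open>{0}\<close>.\<close>

lemma weak_gradient_eq_0_on_zero_set:
  fixes f :: "'a::euclidean_space \<Rightarrow> real"
  assumes U: "open U" and fG: "weak_gradient U f G"
  shows "AE x in lborel. x \<in> U \<longrightarrow> f x = 0 \<longrightarrow> G x = 0"
proof -
  define v where "v x = (if f x = 0 then G x else 0)" for x
  have fGi: "set_integrable lborel K G" "set_integrable lborel K f" if "compact K" "K \<subseteq> U" for K
    using fG that unfolding weak_gradient_def locally_integrable_on_def by auto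
  have vi: "set_integrable lborel K v" if K: "compact K" "K \<subseteq> U" for K
    unfolding set_integrable_def
  proof (rule Bochner_Integration.integrable_bound)
    show "integrable lborel (\<lambda>x. indicator K x *\<^sub>R G x)" using fGi(1)[OF K] by (simp add: set_integrable_def)
    then have [measurable]: "(\<lambda>x. indicator K x *\<^sub>R G x) \<in> borel_measurable borel" by (auto dest: borel_measurable_integrable)
    have [measurable]: "(\<lambda>x. indicator K x *\<^sub>R f x) \<in> borel_measurable borel" using fGi(2)[OF K] by (auto simp: set_integrable_def dest: borel_measurable_integrable)
    have "(\<lambda>x. if indicator K x *\<^sub>R f x = 0 then indicator K x *\<^sub>R G x else 0) \<in> borel_measurable borel" by measurable
    also have "(\<lambda>x. if indicator K x *\<^sub>R f x = 0 then indicator K x *\<^sub>R G x else 0) = (\<lambda>x. indicator K x *\<^sub>R v x)"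
      by (auto simp: v_def indicator_def fun_eq_iff)
    finally show "(\<lambda>x. indicator K x *\<^sub>R v x) \<in> borel_measurable lborel" by simp
    show "AE x in lborel. norm (indicator K x *\<^sub>R v x) \<le> norm (indicator K x *\<^sub>R G x)"
      by (auto simp: v_def indicator_def)
  qed
  have "AE x in lborel. x \<in> U \<longrightarrow> v x = 0"
  proof (rule AE_zero_if_orthogonal_test_functions[OF U])
    show "locally_integrable_on v U" using vi by (auto simp: locally_integrable_on_def)
    fix K \<psi> D assume K: "K \<subseteq> U" and t: "test_function K \<psi> D"
    have Kc: "compact K" using t by (simp add: test_function_def)
    have [measurable]: "K \<in> sets borel" "\<psi> \<in> borel_measurable borel" "D \<in> borel_measurable borel"
      using Kc test_function_continuous[OF t] by (auto simp: borel_compact intro: borel_measurable_continuous_onI)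
    obtain C where C: "C \<ge> 0" "\<And>x. \<bar>\<psi> x\<bar> \<le> C" "\<And>x. norm (D x) \<le> C" using test_function_bounds[OF t] by blast
    define \<Phi> where "\<Phi> n s = s / (1 + real (Suc n) * s\<^sup>2)" for n s
    define \<Phi>' where "\<Phi>' n s = (1 - real (Suc n) * s\<^sup>2) / (1 + real (Suc n) * s\<^sup>2)\<^sup>2" for n s
    have pos: "1 + real (Suc n) * s\<^sup>2 > 0" for n s by (simp add: add_pos_nonneg)
    have D\<Phi>: "(\<Phi> n has_real_derivative \<Phi>' n s) (at s)" for n s
      unfolding \<Phi>_def \<Phi>'_def using pos[of n s]
      by (auto intro!: derivative_eq_intros simp: power2_eq_square algebra_simps)
    have c\<Phi>': "continuous_on UNIV (\<Phi>' n)" for n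
      unfolding \<Phi>'_def using pos[of n] by (intro continuous_intros) (auto simp: less_imp_neq[symmetric])
    have c\<Phi>: "continuous_on UNIV (\<Phi> n)" for n
      unfolding \<Phi>_def using pos[of n] by (intro continuous_intros) (auto simp: less_imp_neq[symmetric])
    have [measurable]: "\<Phi> n \<in> borel_measurable borel" "\<Phi>' n \<in> borel_measurable borel" for n
      using c\<Phi> c\<Phi>' by (auto intro: borel_measurable_continuous_onI)
    have b\<Phi>: "\<bar>\<Phi> n s\<bar> \<le> 1" for n s
    proof -
      have "2 * \<bar>s\<bar> \<le> 1 + s\<^sup>2" using sum_squares_bound[of 1 "\<bar>s\<bar>"] by simp
      also have "\<dots> \<le> 1 + real (Suc n) * s\<^sup>2" by (simp add: mult_le_cancel_right1)
      finally have "\<bar>s\<bar> \<le> 1 + real (Suc n) * s\<^sup>2" by simp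
      then show ?thesis using pos[of n s] unfolding \<Phi>_def by (simp only: abs_divide abs_of_pos divide_le_eq_1_pos)
    qed
    \<comment> \<open>The bound does not depend on \<open>n\<close>. It provides the majorant for
      the passage to the limit in the term with \<open>G\<close>, where the derivatives select the
      zero set of \<open>f\<close>, that is, \<open>v\<close>.\<close>
    have b\<Phi>': "\<bar>\<Phi>' n s\<bar> \<le> 1" for n s
    proof -
      have "\<bar>1 - real (Suc n) * s\<^sup>2\<bar> \<le> 1 + real (Suc n) * s\<^sup>2" by (auto simp: abs_le_iff)
      also have "\<dots> \<le> (1 + real (Suc n) * s\<^sup>2)\<^sup>2" by (intro self_le_power) auto
      finally show ?thesis using pos[of n s] by (simp add: \<Phi>'_def)
    qed
    have wg: "(LINT x:K|lborel. \<Phi> n (f x) *\<^sub>R D x) = - (LINT x:K|lborel. \<psi> x *\<^sub>R \<Phi>' n (f x) *\<^sub>R G x)" for n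
      using weak_gradient_chain[OF U fG D\<Phi> c\<Phi>' b\<Phi> b\<Phi>', of n] K t unfolding weak_gradient_def by blast
    have to_inf: "filterlim (\<lambda>n. 1 + real (Suc n) * s\<^sup>2) at_top sequentially" if "s \<noteq> 0" for s :: real
      using that by (intro filterlim_tendsto_add_at_top[OF tendsto_const] filterlim_at_top_mult_tendsto_pos[OF tendsto_const]
          filterlim_compose[OF filterlim_real_sequentially filterlim_Suc]) auto
    have l1: "(\<lambda>n. \<Phi> n s) \<longlonglongrightarrow> 0" for s
    proof (cases "s = 0")
      case False
      then show ?thesis unfolding \<Phi>_def
        by (intro real_tendsto_divide_at_top[OF tendsto_const] to_inf)
    qed (simp add: \<Phi>_def)
    have l2: "(\<lambda>n. \<Phi>' n s) \<longlonglongrightarrow> (if s = 0 then 1 else 0)" for s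
    proof (cases "s = 0")
      case False
      have "\<bar>\<Phi>' n s\<bar> \<le> 1 / (1 + real (Suc n) * s\<^sup>2)" for n
      proof -
        have "\<bar>1 - real (Suc n) * s\<^sup>2\<bar> \<le> 1 + real (Suc n) * s\<^sup>2" by (auto simp: abs_le_iff)
        then show ?thesis using pos[of n s] by (simp add: \<Phi>'_def divide_simps power2_eq_square)
      qed
      then have "\<forall>\<^sub>F n in sequentially. norm (\<Phi>' n s) \<le> 1 / (1 + real (Suc n) * s\<^sup>2)" by simp
      then have "(\<lambda>n. \<Phi>' n s) \<longlonglongrightarrow> 0"
        by (rule Lim_null_comparison) (rule real_tendsto_divide_at_top[OF tendsto_const to_inf[OF False]])
      then show ?thesis using False by simp
    qed (simp add: \<Phi>'_def)
    have K1: "integrable lborel (\<lambda>x. indicator K x *\<^sub>R C)" using Kc by (intro borel_integrable_compact) auto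
    have KG: "integrable lborel (\<lambda>x. C * norm (indicator K x *\<^sub>R G x))"
      using integrable_norm[OF fGi(1)[OF Kc K, unfolded set_integrable_def]] by (rule integrable_mult_right)
    have mG: "(\<lambda>x. indicator K x *\<^sub>R G x) \<in> borel_measurable borel"
      using fGi(1)[OF Kc K] by (auto simp: set_integrable_def dest: borel_measurable_integrable)
    have m\<Phi>: "(\<lambda>x. indicator K x *\<^sub>R \<Phi> n (f x)) \<in> borel_measurable borel" "(\<lambda>x. indicator K x *\<^sub>R \<Phi>' n (f x)) \<in> borel_measurable borel" for n
      using set_measurable_compose[OF fGi(2)[OF Kc K], of "\<Phi> n"] set_measurable_compose[OF fGi(2)[OF Kc K], of "\<Phi>' n"] by auto
    have "(\<lambda>n. LINT x:K|lborel. \<Phi> n (f x) *\<^sub>R D x) \<longlonglongrightarrow> (LINT x::'a|lborel. 0)"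
      unfolding set_lebesgue_integral_def
    proof (rule integral_dominated_convergence[OF _ _ K1])
      show "(\<lambda>x. indicator K x *\<^sub>R \<Phi> n (f x) *\<^sub>R D x) \<in> borel_measurable lborel" for n
        using borel_measurable_scaleR[OF m\<Phi>(1)[of n], of D] by simp
      show "AE x in lborel. (\<lambda>n. indicator K x *\<^sub>R \<Phi> n (f x) *\<^sub>R D x) \<longlonglongrightarrow> 0"
        by (intro AE_I2) (auto intro!: tendsto_eq_intros l1)
      show "AE x in lborel. norm (indicator K x *\<^sub>R \<Phi> n (f x) *\<^sub>R D x) \<le> indicator K x *\<^sub>R C" for n
        using mult_mono[OF b\<Phi>[of n] C(3)] by (intro AE_I2) (auto simp: indicator_def)
    qed auto
    moreover have "(\<lambda>n. LINT x:K|lborel. \<psi> x *\<^sub>R \<Phi>' n (f x) *\<^sub>R G x) \<longlonglongrightarrow> (LINT x:K|lborel. \<psi> x *\<^sub>R v x)"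
      unfolding set_lebesgue_integral_def
    proof (rule integral_dominated_convergence[OF _ _ KG])
      show "(\<lambda>x. indicator K x *\<^sub>R \<psi> x *\<^sub>R v x) \<in> borel_measurable lborel"
        using set_integrable_bounded_scaleR[OF vi[OF Kc K], of \<psi> C] C by (auto simp: set_integrable_def dest: borel_measurable_integrable)
      have eq: "(\<lambda>x. indicator K x *\<^sub>R \<psi> x *\<^sub>R \<Phi>' n (f x) *\<^sub>R G x) = (\<lambda>x. \<psi> x *\<^sub>R (indicator K x *\<^sub>R \<Phi>' n (f x)) *\<^sub>R (indicator K x *\<^sub>R G x))" for n
        by (auto simp: indicator_def fun_eq_iff)
      show "(\<lambda>x. indicator K x *\<^sub>R \<psi> x *\<^sub>R \<Phi>' n (f x) *\<^sub>R G x) \<in> borel_measurable lborel" for n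
        unfolding eq using m\<Phi>(2)[of n] mG by measurable
      show "AE x in lborel. (\<lambda>n. indicator K x *\<^sub>R \<psi> x *\<^sub>R \<Phi>' n (f x) *\<^sub>R G x) \<longlonglongrightarrow> indicator K x *\<^sub>R \<psi> x *\<^sub>R v x"
      proof (rule AE_I2)
        fix x
        have "(\<lambda>n. indicator K x *\<^sub>R \<psi> x *\<^sub>R \<Phi>' n (f x) *\<^sub>R G x) \<longlonglongrightarrow> indicator K x *\<^sub>R \<psi> x *\<^sub>R (if f x = 0 then 1 else 0) *\<^sub>R G x"
          by (intro tendsto_intros l2)
        also have "(if f x = 0 then 1 else 0) *\<^sub>R G x = v x" by (simp add: v_def)
        finally show "(\<lambda>n. indicator K x *\<^sub>R \<psi> x *\<^sub>R \<Phi>' n (f x) *\<^sub>R G x) \<longlonglongrightarrow> indicator K x *\<^sub>R \<psi> x *\<^sub>R v x" .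
      qed
      show "AE x in lborel. norm (indicator K x *\<^sub>R \<psi> x *\<^sub>R \<Phi>' n (f x) *\<^sub>R G x) \<le> C * norm (indicator K x *\<^sub>R G x)" for n
      proof (rule AE_I2)
        fix x
        have "\<bar>\<psi> x\<bar> * (\<bar>\<Phi>' n (f x)\<bar> * norm (G x)) \<le> C * (1 * norm (G x))"
          using C b\<Phi>'[of n "f x"] by (intro mult_mono) auto
        then show "norm (indicator K x *\<^sub>R \<psi> x *\<^sub>R \<Phi>' n (f x) *\<^sub>R G x) \<le> C * norm (indicator K x *\<^sub>R G x)"
          by (simp add: indicator_def abs_mult mult.assoc)
      qed
    qed
    ultimately show "(LINT x:K|lborel. \<psi> x *\<^sub>R v x) = 0"
      unfolding wg using LIMSEQ_unique[OF tendsto_minus] by fastforce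
  qed
  then show ?thesis by eventually_elim (auto simp: v_def)
qed

section \<open>Powers and their weak gradients\<close>

lemma powr_mult_le_add:
  assumes "p > (1::real)" "0 \<le> a" "0 \<le> b"
  shows "a powr (p - 1) * b \<le> a powr p + b powr p"
proof (cases "a \<le> b")
  case True
  have "a powr (p - 1) * b \<le> b powr (p - 1) * b" using assms True by (intro mult_right_mono powr_mono2) auto
  also have "\<dots> = b powr p" using assms by (cases "b = 0") (auto simp: powr_diff)
  finally show ?thesis using powr_ge_zero[of a p] by linarith
next
  case False
  have "a powr (p - 1) * b \<le> a powr (p - 1) * a" using False by (intro mult_left_mono) auto
  also have "\<dots> = a powr p" using assms by (cases "a = 0") (auto simp: powr_diff)
  finally show ?thesis using powr_ge_zero[of b p] by linarith
qed

lemma powr_minus_1_le: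
  assumes "p > (1::real)" "0 \<le> a"
  shows "a powr (p - 1) \<le> 1 + a powr p"
  using powr_mult_le_add[OF assms, of 1] by simp

lemma DERIV_max_0_powr:
  assumes p: "p > 1"
  shows "((\<lambda>t::real. (max 0 t) powr p) has_real_derivative p * (max 0 t) powr (p - 1)) (at t)"
proof -
  consider "t > 0" | "t < 0" | "t = 0" by linarith
  then show ?thesis
  proof cases
    case 1
    have "((\<lambda>t. t powr p) has_real_derivative p * t powr (p - 1)) (at t)"
      using 1 by (auto intro!: derivative_eq_intros)
    then have "((\<lambda>t. (max 0 t) powr p) has_real_derivative p * t powr (p - 1)) (at t)"
      by (rule has_field_derivative_transform_within_open[where S="{0<..}"]) (use 1 in auto)
    then show ?thesis using 1 by simp
  next
    case 2
    have "((\<lambda>t::real. 0) has_real_derivative 0) (at t)" by (auto intro!: derivative_eq_intros)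
    then have "((\<lambda>t. (max 0 t) powr p) has_real_derivative 0) (at t)"
      by (rule has_field_derivative_transform_within_open[where S="{..<0}"]) (use 2 in auto)
    then show ?thesis using 2 by simp
  next
    case 3
    have "(\<lambda>h::real. (max 0 h) powr p / h) \<midarrow>0\<rightarrow> 0"
    proof (rule Lim_null_comparison[where g="\<lambda>h. (max 0 h) powr (p - 1)"])
      show "\<forall>\<^sub>F h in at 0. norm ((max 0 h) powr p / h) \<le> (max 0 h) powr (p - 1)"
        by (auto simp: max_def powr_diff)
      have "continuous_on UNIV (\<lambda>h::real. (max 0 h) powr (p - 1))"
        using p by (intro continuous_intros continuous_on_powr') auto
      then have "isCont (\<lambda>h::real. (max 0 h) powr (p - 1)) 0" by (simp add: continuous_on_eq_continuous_at)
      then show "(\<lambda>h::real. (max 0 h) powr (p - 1)) \<midarrow>0\<rightarrow> 0" using p by (simp add: isCont_def)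
    qed
    then show ?thesis using 3 p by (simp add: DERIV_def)
  qed
qed

text \<open>If \<open>\<rho> = d\<^sup>\<alpha>\<close> and \<open>q = \<beta> |\<alpha>|\<close>, then \<open>pow_cut q d\<close> equals \<open>pow_cut \<beta> \<rho>\<close> or \<open>1 - pow_cut \<beta> \<rho>\<close>, according to
  the sign of \<open>\<alpha>\<close>. Hence the chain rule for bounded functions with bounded derivative, applied to both sides,
  relates the gradients of \<open>d\<close> and \<open>\<rho>\<close> also when \<open>t \<mapsto> t\<^sup>\<alpha>\<close> is not Lipschitz.\<close>

definition pow_cut :: "real \<Rightarrow> real \<Rightarrow> real" where
  "pow_cut q t = (max 0 t) powr q / (1 + (max 0 t) powr q)"

definition pow_cut' :: "real \<Rightarrow> real \<Rightarrow> real" where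
  "pow_cut' q t = q * (max 0 t) powr (q - 1) / (1 + (max 0 t) powr q)\<^sup>2"

text \<open>The numerator of the derivative is dominated through
  \<open>t powr (q - 1) \<le> 1 + t powr q\<close>. For negative arguments the truncation makes both
  functions vanish; with \<open>q \<ge> 2\<close> the derivative is continuous at 0.\<close>

lemma pow_cut:
  assumes q: "q \<ge> 2"
  shows "(pow_cut q has_real_derivative pow_cut' q t) (at t)" "continuous_on UNIV (pow_cut' q)"
    "\<bar>pow_cut q t\<bar> \<le> q" "\<bar>pow_cut' q t\<bar> \<le> q"
proof -
  have pos: "1 + (max 0 t) powr r > 0" for t r :: real by (simp add: add_pos_nonneg)
  show "continuous_on UNIV (pow_cut' q)"
    unfolding pow_cut'_def using pos[of _ q] q
    by (intro continuous_intros continuous_on_powr') (auto simp: less_imp_neq[symmetric])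
  have "(max 0 t) powr q / (1 + (max 0 t) powr q) \<le> 1" by (simp add: divide_le_eq_1 add_pos_nonneg)
  then show "\<bar>pow_cut q t\<bar> \<le> q" using q by (simp add: pow_cut_def)
  show "\<bar>pow_cut' q t\<bar> \<le> q"
  proof (cases "t > 0")
    case True
    have "t powr (q - 1) \<le> (1 + t powr q) * 1" using powr_minus_1_le[of q t] True q by simp
    also have "\<dots> \<le> (1 + t powr q) * (1 + t powr q)" by (intro mult_left_mono) auto
    finally have "t powr (q - 1) / (1 + t powr q)\<^sup>2 \<le> 1" using pos[of t q] True by (simp add: power2_eq_square)
    then have "q * (t powr (q - 1) / (1 + t powr q)\<^sup>2) \<le> q * 1" using q by (intro mult_left_mono) auto
    then show ?thesis using True q by (simp add: pow_cut'_def max_def)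
  qed (use q in \<open>simp add: pow_cut'_def max_def\<close>)
  have "((\<lambda>y. y / (1 + y)) has_real_derivative 1 / (1 + (max 0 t) powr q)\<^sup>2) (at ((max 0 t) powr q))"
    using pos[of t q] by (auto intro!: derivative_eq_intros simp: power2_eq_square)
  from DERIV_chain2[OF this DERIV_max_0_powr] q
  show "(pow_cut q has_real_derivative pow_cut' q t) (at t)"
    unfolding pow_cut_def[abs_def] pow_cut'_def by simp
qed

text \<open>\<open>pow_cut q (d x)\<close> and \<open>\<Psi> (\<rho> x)\<close> agree almost
  everywhere, and both have weak gradients by the bounded chain rule. Uniqueness equates these
  gradients. The factor in front of the gradient of \<open>\<rho>\<close> is nonzero where
  \<open>\<rho>\<close> is positive, so it can be cancelled.\<close>

lemma weak_gradient_powr: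
  fixes d \<rho> :: "'a::euclidean_space \<Rightarrow> real"
  assumes U: "open U" and d: "weak_gradient U d Gd" and \<rho>: "weak_gradient U \<rho> G\<rho>"
    and \<alpha>: "\<alpha> \<noteq> 0" and eq: "AE x in lborel. x \<in> U \<longrightarrow> 0 < d x \<and> \<rho> x = d x powr \<alpha>"
  shows "AE x in lborel. x \<in> U \<longrightarrow> G\<rho> x = (\<alpha> * d x powr (\<alpha> - 1)) *\<^sub>R Gd x"
proof -
  \<comment> \<open>Chosen so that both exponents are at least 2: \<open>\<beta>\<close> equals
    \<open>2 + 2 / \<bar>\<alpha>\<bar>\<close>.\<close>
  define q where "q = 2 + 2 * \<bar>\<alpha>\<bar>"
  define \<beta> where "\<beta> = q / \<bar>\<alpha>\<bar>"
  have q: "q \<ge> 2" and \<beta>: "\<beta> \<ge> 2" using \<alpha> by (auto simp: q_def \<beta>_def field_simps)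
  have wd: "weak_gradient U (\<lambda>x. pow_cut q (d x)) (\<lambda>x. pow_cut' q (d x) *\<^sub>R Gd x)"
    by (rule weak_gradient_chain[OF U d, of _ _ q]) (use pow_cut[OF q] in auto)
  define \<sigma> where "\<sigma> = sgn \<alpha>"
  \<comment> \<open>For negative \<alpha> the power of \<rho> is the reciprocal of
    \<open>T = t powr q\<close>, and \<open>T / (1 + T) = 1 - (1 / T) / (1 + 1 / T)\<close> accounts
    for the constant 1 and the sign.\<close>
  define \<Psi> where "\<Psi> t = (if \<alpha> > 0 then 0 else 1) + \<sigma> * pow_cut \<beta> t" for t
  have \<sigma>: "\<bar>\<sigma>\<bar> = 1" using \<alpha> by (simp add: \<sigma>_def)
  have w\<rho>: "weak_gradient U (\<lambda>x. \<Psi> (\<rho> x)) (\<lambda>x. (\<sigma> * pow_cut' \<beta> (\<rho> x)) *\<^sub>R G\<rho> x)"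
  proof (rule weak_gradient_chain[OF U \<rho>, of _ _ "1 + \<beta>"])
    show "(\<Psi> has_real_derivative \<sigma> * pow_cut' \<beta> t) (at t)" for t
      unfolding \<Psi>_def using pow_cut(1)[OF \<beta>, of t] by (auto intro!: derivative_eq_intros)
    show "continuous_on UNIV (\<lambda>t. \<sigma> * pow_cut' \<beta> t)" using pow_cut(2)[OF \<beta>] by (intro continuous_intros)
    show "\<bar>\<Psi> t\<bar> \<le> 1 + \<beta>" for t
      using pow_cut(3)[OF \<beta>, of t] \<sigma> abs_triangle_ineq[of "if \<alpha> > 0 then 0 else 1" "\<sigma> * pow_cut \<beta> t"]
      by (auto simp: \<Psi>_def abs_mult split: if_splits)
    show "\<bar>\<sigma> * pow_cut' \<beta> t\<bar> \<le> 1 + \<beta>" for t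
      using pow_cut(4)[OF \<beta>, of t] \<sigma> by (simp add: abs_mult)
  qed
  have eq1: "pow_cut q t = \<Psi> (t powr \<alpha>)" if "t > 0" for t
  proof -
    have "t powr q > 0" using that by simp
    show ?thesis
    proof (cases "\<alpha> > 0")
      case True
      then have "(t powr \<alpha>) powr \<beta> = t powr q" by (simp add: powr_powr \<beta>_def)
      then show ?thesis using True that by (simp add: \<Psi>_def \<sigma>_def pow_cut_def)
    next
      case False
      then have "(t powr \<alpha>) powr \<beta> = t powr (- q)" using \<alpha> by (simp add: powr_powr \<beta>_def)
      then have "(t powr \<alpha>) powr \<beta> = 1 / t powr q" by (simp add: powr_minus_divide)
      moreover have "1 - (1 / T) / (1 + 1 / T) = T / (1 + T)" if "T > 0" for T :: real
        using that by (simp add: field_simps)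
      ultimately show ?thesis using False \<alpha> that \<open>t powr q > 0\<close> by (simp add: \<Psi>_def \<sigma>_def pow_cut_def)
    qed
  qed
  \<comment> \<open>The identity of the derivatives is not computed: both sides are derivatives of
    the same function at \<open>t\<close>, by \<open>eq1\<close> on the positive half-line.\<close>
  have eq2: "pow_cut' q t = \<sigma> * pow_cut' \<beta> (t powr \<alpha>) * (\<alpha> * t powr (\<alpha> - 1))" if "t > 0" for t
  proof -
    have D: "((\<lambda>t. t powr \<alpha>) has_real_derivative \<alpha> * t powr (\<alpha> - 1)) (at t)"
      using that by (auto intro!: derivative_eq_intros)
    have "(\<Psi> has_real_derivative \<sigma> * pow_cut' \<beta> (t powr \<alpha>)) (at (t powr \<alpha>))"
      unfolding \<Psi>_def using pow_cut(1)[OF \<beta>] by (auto intro!: derivative_eq_intros)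
    then have "((\<lambda>t. \<Psi> (t powr \<alpha>)) has_real_derivative \<sigma> * pow_cut' \<beta> (t powr \<alpha>) * (\<alpha> * t powr (\<alpha> - 1))) (at t)"
      using D by (rule DERIV_chain2)
    then have "(pow_cut q has_real_derivative \<sigma> * pow_cut' \<beta> (t powr \<alpha>) * (\<alpha> * t powr (\<alpha> - 1))) (at t)"
      by (rule has_field_derivative_transform_within_open[where S="{0<..}"]) (use that eq1 in auto)
    then show ?thesis using pow_cut(1)[OF q, of t] by (rule DERIV_unique[rotated])
  qed
  have "AE x in lborel. x \<in> U \<longrightarrow> pow_cut q (d x) = \<Psi> (\<rho> x)"
    using eq by eventually_elim (auto simp: eq1)
  from weak_gradient_unique[OF U wd w\<rho> this] eq show ?thesis
  proof eventually_elim
    case (elim x)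
    show ?case
    proof
      assume x: "x \<in> U"
      with elim have dx: "d x > 0" "\<rho> x = d x powr \<alpha>" by auto
      have nz: "\<sigma> * pow_cut' \<beta> (\<rho> x) \<noteq> 0"
        using dx \<beta> \<sigma> add_pos_nonneg[of 1 "\<rho> x powr \<beta>"] by (auto simp: pow_cut'_def)
      have "(\<sigma> * pow_cut' \<beta> (\<rho> x)) *\<^sub>R G\<rho> x = (\<sigma> * pow_cut' \<beta> (\<rho> x)) *\<^sub>R ((\<alpha> * d x powr (\<alpha> - 1)) *\<^sub>R Gd x)"
        using elim x dx eq2[of "d x"] by simp
      then show "G\<rho> x = (\<alpha> * d x powr (\<alpha> - 1)) *\<^sub>R Gd x" using nz by (simp only: scaleR_cancel_left) auto
    qed
  qed
qed

section \<open>\<open>C\<^sup>1\<close> functions on a manifold\<close>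

lemma continuous_on_matrix_vector_mult:
  fixes B :: "'a::topological_space \<Rightarrow> real ^ 'n ^ 'm" and v :: "'a \<Rightarrow> real ^ 'n"
  assumes "continuous_on S B" "continuous_on S v"
  shows "continuous_on S (\<lambda>x. B x *v v x)"
  unfolding matrix_vector_mult_def using assms by (intro continuous_intros)

lemma continuous_on_transpose:
  fixes B :: "'a::topological_space \<Rightarrow> real ^ 'n ^ 'm"
  assumes "continuous_on S B"
  shows "continuous_on S (\<lambda>x. transpose (B x))"
  unfolding transpose_def using assms by (intro continuous_intros)

lemma continuous_on_det:
  fixes B :: "'a::topological_space \<Rightarrow> real ^ 'n ^ 'n"
  assumes "continuous_on S B"
  shows "continuous_on S (\<lambda>x. det (B x))"
  unfolding det_def using assms by (intro continuous_intros)

lemma matrix_inv_mult_vec: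
  fixes B :: "real ^ 'n ^ 'n"
  assumes "invertible B"
  shows "B *v (matrix_inv B *v v) = v" "matrix_inv B *v (B *v v) = v"
proof -
  have "B ** matrix_inv B = mat 1 \<and> matrix_inv B ** B = mat 1"
    unfolding matrix_inv_def using assms[unfolded invertible_def] by (rule someI_ex)
  then show "B *v (matrix_inv B *v v) = v" "matrix_inv B *v (B *v v) = v"
    by (simp_all add: matrix_vector_mul_assoc)
qed

lemma inner_transpose_mult: "x \<bullet> (transpose B *v y) = (B *v x) \<bullet> (y :: real ^ 'n)" for B :: "real ^ 'm ^ 'n"
  by (metis dot_lmul_matrix inner_commute vector_transpose_matrix transpose_matrix_vector)

definition pos_def_matrix :: "real ^ 'n ^ 'n \<Rightarrow> bool" where
  "pos_def_matrix B \<longleftrightarrow> transpose B = B \<and> (\<forall>v. v \<noteq> 0 \<longrightarrow> 0 < v \<bullet> (B *v v))"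

lemma pos_def_nonneg: "pos_def_matrix B \<Longrightarrow> 0 \<le> v \<bullet> (B *v v)"
  unfolding pos_def_matrix_def by (metis inner_zero_left less_eq_real_def)

lemma pos_def_sym: "pos_def_matrix B \<Longrightarrow> v \<bullet> (B *v w) = w \<bullet> (B *v v)"
  unfolding pos_def_matrix_def by (metis inner_commute inner_transpose_mult)

lemma pos_def_invertible:
  assumes "pos_def_matrix B" shows "invertible B"
proof -
  have "inj ((*v) B)"
  proof (rule injI)
    fix x y assume "B *v x = B *v y"
    then have "(x - y) \<bullet> (B *v (x - y)) = 0" by (simp add: matrix_vector_mult_diff_distrib)
    then show "x = y" using assms unfolding pos_def_matrix_def by (metis eq_iff_diff_eq_0 less_irrefl)
  qed
  then show ?thesis by (simp add: invertible_left_inverse matrix_left_invertible_injective)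
qed

text \<open>The segment from the identity to \<open>B\<close> consists of positive definite, hence
  invertible, matrices. Along it the determinant is continuous, starts at 1 and never vanishes, so
  it cannot end at a value that is not positive.\<close>

lemma pos_def_det_pos:
  fixes B :: "real ^ 'n ^ 'n"
  assumes B: "pos_def_matrix B" shows "0 < det B"
proof (rule ccontr)
  assume "\<not> 0 < det B"
  define C :: "real \<Rightarrow> real ^ 'n ^ 'n" where "C t = (1 - t) *\<^sub>R mat 1 + t *\<^sub>R B" for t
  have "continuous_on {0..1} (\<lambda>t. det (C t))"
    unfolding C_def by (intro continuous_on_det continuous_intros)
  moreover have "det (C 1) \<le> 0" "0 \<le> det (C 0)" using \<open>\<not> 0 < det B\<close> by (auto simp: C_def)
  ultimately obtain t where t: "0 \<le> t" "t \<le> 1" "det (C t) = 0"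
    using IVT2'[of "\<lambda>t. det (C t)" 1 0 0] by auto
  have "pos_def_matrix (C t)"
    unfolding pos_def_matrix_def
  proof (intro conjI allI impI)
    show "transpose (C t) = C t"
      using B unfolding C_def pos_def_matrix_def by (simp add: transpose_def vec_eq_iff mat_def)
    fix v :: "real ^ 'n" assume "v \<noteq> 0"
    have eq: "v \<bullet> (C t *v v) = (1 - t) * (v \<bullet> v) + t * (v \<bullet> (B *v v))"
      unfolding C_def by (simp add: matrix_vector_mult_add_rdistrib scaleR_matrix_vector_assoc[symmetric] inner_add_right)
    have "0 < v \<bullet> v" "0 < v \<bullet> (B *v v)" using B \<open>v \<noteq> 0\<close> by (auto simp: pos_def_matrix_def)
    then show "0 < v \<bullet> (C t *v v)"
      unfolding eq using t by (cases "t = 0") (auto intro!: add_nonneg_pos mult_pos_pos mult_nonneg_nonneg)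
  qed
  then show False using t pos_def_invertible invertible_det_nz by blast
qed

lemma pos_def_Cauchy_Schwarz:
  assumes B: "pos_def_matrix B"
  shows "\<bar>v \<bullet> (B *v w)\<bar> \<le> sqrt (v \<bullet> (B *v v)) * sqrt (w \<bullet> (B *v w))"
proof -
  define a b c where "a = v \<bullet> (B *v v)" and "b = v \<bullet> (B *v w)" and "c = w \<bullet> (B *v w)"
  have "b\<^sup>2 \<le> a * c"
  proof (cases "w = 0")
    case True then show ?thesis by (simp add: a_def b_def c_def)
  next
    case False
    then have c: "c > 0" using B by (auto simp: c_def pos_def_matrix_def)
    \<comment> \<open>Up to the factor \<open>c\<close> this is the component of \<open>v\<close>
      orthogonal to \<open>w\<close> with respect to the form of \<open>B\<close>.\<close>
    have "0 \<le> (c *\<^sub>R v - b *\<^sub>R w) \<bullet> (B *v (c *\<^sub>R v - b *\<^sub>R w))" using pos_def_nonneg[OF B] .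
    also have "\<dots> = c * (a * c - b\<^sup>2)"
      using pos_def_sym[OF B, of w v]
      by (simp add: a_def b_def c_def matrix_vector_mult_diff_distrib matrix_vector_mult_scaleR inner_diff_left inner_diff_right power2_eq_square algebra_simps)
    finally show ?thesis using c by (simp add: zero_le_mult_iff)
  qed
  then have "sqrt (b\<^sup>2) \<le> sqrt (a * c)" by (rule real_sqrt_le_mono)
  then show ?thesis by (simp add: real_sqrt_mult a_def b_def c_def)
qed

section \<open>Functions of class C^1 near a point\<close>

definition C1_near :: "('a::euclidean_space \<Rightarrow> real) \<Rightarrow> 'a \<Rightarrow> bool" where
  "C1_near f x \<longleftrightarrow> (\<exists>S D. open S \<and> x \<in> S \<and> continuous_on S D \<and> (\<forall>y\<in>S. GDERIV f y :> D y))"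

lemma C1_near_cong:
  assumes "C1_near f x" "open T" "x \<in> T" "\<And>y. y \<in> T \<Longrightarrow> f y = h y"
  shows "C1_near h x"
proof -
  obtain S D where S: "open S" "x \<in> S" "continuous_on S D" "\<And>y. y \<in> S \<Longrightarrow> GDERIV f y :> D y"
    using assms(1) unfolding C1_near_def by blast
  show ?thesis unfolding C1_near_def
  proof (intro exI[of _ "S \<inter> T"] exI[of _ D] conjI ballI)
    show "continuous_on (S \<inter> T) D" using S(3) by (rule continuous_on_subset) auto
    fix y assume y: "y \<in> S \<inter> T"
    then have "(f has_derivative (\<lambda>h. h \<bullet> D y)) (at y)" using S(4) by (simp add: gderiv_def)
    then show "GDERIV h y :> D y" unfolding gderiv_def
      by (rule has_derivative_transform_within_open[OF _ assms(2)]) (use y assms(4) in auto)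
  qed (use S assms in auto)
qed

lemma C1_near_mult: "C1_near f x \<Longrightarrow> C1_near h x \<Longrightarrow> C1_near (\<lambda>y. f y * h y) x"
  unfolding C1_near_def
proof (elim exE conjE)
  fix S D T E assume *: "open S" "x \<in> S" "continuous_on S D" "\<forall>y\<in>S. GDERIV f y :> D y"
    "open T" "x \<in> T" "continuous_on T E" "\<forall>y\<in>T. GDERIV h y :> E y"
  show "\<exists>S D. open S \<and> x \<in> S \<and> continuous_on S D \<and> (\<forall>y\<in>S. GDERIV (\<lambda>y. f y * h y) y :> D y)"
  proof (intro exI[of _ "S \<inter> T"] exI[of _ "\<lambda>y. f y *\<^sub>R E y + h y *\<^sub>R D y"] conjI ballI GDERIV_mult)
    have "continuous_on S f" "continuous_on T h" using *(4,8) continuous_on_GDERIV by blast+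
    then show "continuous_on (S \<inter> T) (\<lambda>y. f y *\<^sub>R E y + h y *\<^sub>R D y)"
      using * by (intro continuous_intros) (auto intro: continuous_on_subset)
  qed (use * in auto)
qed

lemma C1_near_add: "C1_near f x \<Longrightarrow> C1_near h x \<Longrightarrow> C1_near (\<lambda>y. f y + h y) x"
  unfolding C1_near_def
proof (elim exE conjE)
  fix S D T E assume *: "open S" "x \<in> S" "continuous_on S D" "\<forall>y\<in>S. GDERIV f y :> D y"
    "open T" "x \<in> T" "continuous_on T E" "\<forall>y\<in>T. GDERIV h y :> E y"
  show "\<exists>S D. open S \<and> x \<in> S \<and> continuous_on S D \<and> (\<forall>y\<in>S. GDERIV (\<lambda>y. f y + h y) y :> D y)"
    by (intro exI[of _ "S \<inter> T"] exI[of _ "\<lambda>y. D y + E y"] conjI ballI GDERIV_add continuous_intros)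
       (use * in \<open>auto intro: continuous_on_subset\<close>)
qed

lemma C1_near_const: "C1_near (\<lambda>_. k) x"
  unfolding C1_near_def by (intro exI[of _ UNIV] exI[of _ "\<lambda>_. 0"]) (auto intro: GDERIV_const)

lemma C1_near_compose:
  assumes "C1_near f x" "open R" "f x \<in> R" "continuous_on R \<Phi>'" "\<And>t. t \<in> R \<Longrightarrow> (\<Phi> has_real_derivative \<Phi>' t) (at t)"
  shows "C1_near (\<lambda>y. \<Phi> (f y)) x"
proof -
  obtain S D where S: "open S" "x \<in> S" "continuous_on S D" "\<And>y. y \<in> S \<Longrightarrow> GDERIV f y :> D y"
    using assms(1) unfolding C1_near_def by blast
  have fc: "continuous_on S f" using S(4) by (rule continuous_on_GDERIV)
  define T where "T = S \<inter> f -` R"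
  have T: "open T" unfolding T_def using fc assms(2) S(1) by (metis Int_commute continuous_open_preimage)
  show ?thesis unfolding C1_near_def
  proof (intro exI[of _ T] exI[of _ "\<lambda>y. \<Phi>' (f y) *\<^sub>R D y"] conjI ballI T)
    show "continuous_on T (\<lambda>y. \<Phi>' (f y) *\<^sub>R D y)"
      using S(3) fc by (intro continuous_intros continuous_on_compose2[OF assms(4)]) (auto simp: T_def intro: continuous_on_subset)
    show "GDERIV (\<lambda>y. \<Phi> (f y)) y :> \<Phi>' (f y) *\<^sub>R D y" if "y \<in> T" for y
      using that S(4) assms(5) by (intro GDERIV_DERIV_compose) (auto simp: T_def)
  qed (use S assms in \<open>auto simp: T_def\<close>)
qed

text \<open>The gradient is assembled from the directional derivatives along the basis.
  \<open>C1_near\<close> is a property of single points, so products, compositions, changes of chart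
  and extensions by zero can be checked point by point and translated back to \<open>Ck_on\<close>
  only here.\<close>

lemma Ck_on_1_iff:
  fixes f :: "'a::euclidean_space \<Rightarrow> real"
  assumes "open S"
  shows "Ck_on 1 f S \<longleftrightarrow> (\<forall>x\<in>S. C1_near f x)"
proof
  assume f: "Ck_on 1 f S"
  show "\<forall>x\<in>S. C1_near f x"
  proof
    fix x assume "x \<in> S"
    show "C1_near f x" unfolding C1_near_def
    proof (intro exI[of _ S] exI[of _ "\<lambda>y. \<Sum>b\<in>Basis. frechet_derivative f (at y) b *\<^sub>R b"] conjI ballI)
      show "continuous_on S (\<lambda>y. \<Sum>b\<in>Basis. frechet_derivative f (at y) b *\<^sub>R b)"
        using f by (intro continuous_intros) (auto simp: One_nat_def)
      fix y assume "y \<in> S"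
      then have "f differentiable (at y)" using f assms by (auto simp: One_nat_def differentiable_on_eq_differentiable_at)
      then have d: "(f has_derivative frechet_derivative f (at y)) (at y)" by (simp add: frechet_derivative_works)
      then interpret bounded_linear "frechet_derivative f (at y)" by (rule has_derivative_bounded_linear)
      have "frechet_derivative f (at y) h = h \<bullet> (\<Sum>b\<in>Basis. frechet_derivative f (at y) b *\<^sub>R b)" for h
      proof -
        have "frechet_derivative f (at y) h = frechet_derivative f (at y) (\<Sum>b\<in>Basis. (h \<bullet> b) *\<^sub>R b)"
          by (simp add: euclidean_representation)
        also have "\<dots> = (\<Sum>b\<in>Basis. (h \<bullet> b) * frechet_derivative f (at y) b)" by (simp add: sum scaleR)
        finally show ?thesis by (simp add: inner_sum_right mult.commute)
      qed
      then show "GDERIV f y :> (\<Sum>b\<in>Basis. frechet_derivative f (at y) b *\<^sub>R b)"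
        using d unfolding gderiv_def by (metis (no_types, lifting) ext)
    qed (use assms \<open>x \<in> S\<close> in auto)
  qed
next
  assume f: "\<forall>x\<in>S. C1_near f x"
  have diff: "f differentiable (at x)" if "x \<in> S" for x
    using f that unfolding C1_near_def gderiv_def differentiable_def by blast
  have "continuous_on S (\<lambda>x. frechet_derivative f (at x) v)" for v
    unfolding continuous_on_eq_continuous_at[OF assms]
  proof
    fix x assume "x \<in> S"
    then have "C1_near f x" using f by blast
    then obtain T D where T: "open T" "x \<in> T" "continuous_on T D" "\<And>y. y \<in> T \<Longrightarrow> GDERIV f y :> D y"
      unfolding C1_near_def by blast
    have eq: "frechet_derivative f (at y) v = v \<bullet> D y" if "y \<in> T" for y
      using T(4)[OF that] unfolding gderiv_def by (metis frechet_derivative_at)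
    have "continuous_on T (\<lambda>y. v \<bullet> D y)" using T(3) by (intro continuous_intros)
    then have "continuous_on T (\<lambda>x. frechet_derivative f (at x) v)" using eq by (simp cong: continuous_on_cong)
    then show "isCont (\<lambda>x. frechet_derivative f (at x) v) x" using T by (simp add: continuous_on_eq_continuous_at)
  qed
  then show "Ck_on 1 f S" using diff assms by (auto simp: One_nat_def differentiable_on_eq_differentiable_at)
qed

lemma compact_support_inI:
  fixes f :: "'a::t2_space \<Rightarrow> real"
  assumes "compact T" "T \<subseteq> \<Omega>" "{x. f x \<noteq> 0} \<subseteq> T"
  shows "compact_support_in f \<Omega>"
proof -
  have "closure {x. f x \<noteq> 0} \<subseteq> T" using assms by (intro closure_minimal compact_imp_closed)
  moreover have "compact (T \<inter> closure {x. f x \<noteq> 0})" using assms(1) by (intro compact_Int_closed) auto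
  ultimately show ?thesis using assms(2) unfolding compact_support_in_def by (simp add: Int_absorb1 Int_absorb2 inf.absorb2)
qed

section \<open>Charts, C^1 functions and coordinate gradients\<close>

locale riemannian_volume_space =
  fixes A :: "('m::{t2_space, second_countable_topology}, 'n::finite) chart set"
    and g :: "('m, 'n) metric" and dv :: "'m measure"
  assumes atlas: "smooth_atlas A" and metric: "riemannian_metric A g" and vol: "riemannian_volume A g dv"
begin

abbreviation img :: "('m, 'n) chart \<Rightarrow> (real ^ 'n) set" where "img c \<equiv> snd c ` fst c"

lemma sets_dv[measurable_cong, simp]: "sets dv = sets borel"
  using vol by (simp add: riemannian_volume_def)

lemma space_dv[simp]: "space dv = UNIV"
  using sets_eq_imp_space_eq[OF sets_dv] by simp

lemma charts_cover: "\<exists>c\<in>A. m \<in> fst c"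
  using atlas unfolding smooth_atlas_def by blast

lemma chart_at: "chart_at A m \<in> A" "m \<in> fst (chart_at A m)"
  unfolding chart_at_def using someI_ex[of "\<lambda>c. c \<in> A \<and> m \<in> fst c"] charts_cover by blast+

context
  fixes c assumes c: "c \<in> A"
begin

lemma chart_open: "open (fst c)" "open (img c)"
  and chart_homeo: "homeomorphism (fst c) (img c) (snd c) (chart_inv c)"
  using atlas c unfolding smooth_atlas_def by blast+

lemma chart_inv[simp]: "m \<in> fst c \<Longrightarrow> chart_inv c (snd c m) = m"
  "x \<in> img c \<Longrightarrow> snd c (chart_inv c x) = x" "x \<in> img c \<Longrightarrow> chart_inv c x \<in> fst c"
  using chart_homeo unfolding homeomorphism_def by auto

lemma chart_cont: "continuous_on (fst c) (snd c)" "continuous_on (img c) (chart_inv c)"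
  using chart_homeo unfolding homeomorphism_def by auto

lemma chart_image_eq: "V \<subseteq> fst c \<Longrightarrow> snd c ` V = {x \<in> img c. chart_inv c x \<in> V}"
  by (auto simp: image_iff)

lemma chart_image_open: "open V \<Longrightarrow> V \<subseteq> fst c \<Longrightarrow> open (snd c ` V)"
proof -
  assume V: "open V" "V \<subseteq> fst c"
  have "snd c ` V = img c \<inter> chart_inv c -` V" using chart_image_eq[OF V(2)] by auto
  then show ?thesis using continuous_open_preimage[OF chart_cont(2) chart_open(2) V(1)] by simp
qed

lemma chart_inv_image_open: "open S \<Longrightarrow> open {m \<in> fst c. snd c m \<in> S}"
  using continuous_open_preimage[OF chart_cont(1) chart_open(1), of S] by (simp add: Int_def vimage_def)

lemma metric_pos_def: "m \<in> fst c \<Longrightarrow> pos_def_matrix (g c m)"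
  using metric c unfolding riemannian_metric_def pos_def_matrix_def by blast

lemma metric_cont: "continuous_on (fst c) (g c)"
proof -
  have "continuous_on (img c) (\<lambda>x. g c (chart_inv c x) $ i $ j)" for i j
    using metric c unfolding riemannian_metric_def smooth_on_def by (metis Ck_on.simps(1))
  then have "continuous_on (fst c) (\<lambda>m. g c (chart_inv c (snd c m)) $ i $ j)" for i j
    by (rule continuous_on_compose2[OF _ chart_cont(1)]) auto
  then have "continuous_on (fst c) (\<lambda>m. g c m $ i $ j)" for i j by (simp cong: continuous_on_cong)
  then have "continuous_on (fst c) (\<lambda>m. \<chi> i j. g c m $ i $ j)" by (intro continuous_on_vec_lambda)
  then show ?thesis by simp
qed

lemma metric_cont': "continuous_on (img c) (\<lambda>x. g c (chart_inv c x))"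
  by (rule continuous_on_compose2[OF metric_cont chart_cont(2)]) auto

end

lemma transition_derivative:
  assumes c: "c \<in> A" "c' \<in> A" and m: "m \<in> fst c \<inter> fst c'"
  shows "((snd c' \<circ> chart_inv c) has_derivative (\<lambda>v. transition_jacobian c c' m *v v)) (at (snd c m))"
proof -
  have "Ck_on 1 (snd c' \<circ> chart_inv c) (snd c ` (fst c \<inter> fst c'))"
    using atlas c unfolding smooth_atlas_def smooth_on_def by blast
  then have "(snd c' \<circ> chart_inv c) differentiable_on (snd c ` (fst c \<inter> fst c'))" by (simp add: One_nat_def)
  moreover have "open (snd c ` (fst c \<inter> fst c'))" using c by (intro chart_image_open) (auto simp: chart_open)
  ultimately have "(snd c' \<circ> chart_inv c) differentiable (at (snd c m))"
    using m by (simp add: differentiable_on_eq_differentiable_at)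
  then have d: "((snd c' \<circ> chart_inv c) has_derivative frechet_derivative (snd c' \<circ> chart_inv c) (at (snd c m))) (at (snd c m))"
    by (simp add: frechet_derivative_works)
  then have "linear (frechet_derivative (snd c' \<circ> chart_inv c) (at (snd c m)))" by (rule has_derivative_linear)
  then have "frechet_derivative (snd c' \<circ> chart_inv c) (at (snd c m)) = (\<lambda>v. transition_jacobian c c' m *v v)"
    unfolding transition_jacobian_def by (simp add: matrix_works linear_matrix_vector_mul_eq fun_eq_iff)
  with d show ?thesis by simp
qed

lemma transition_jacobian_cont:
  assumes c: "c \<in> A" "c' \<in> A"
  shows "continuous_on (snd c ` (fst c \<inter> fst c')) (\<lambda>x. transition_jacobian c c' (chart_inv c x))"
proof -
  have k: "Ck_on 1 (snd c' \<circ> chart_inv c) (snd c ` (fst c \<inter> fst c'))"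
    using atlas c unfolding smooth_atlas_def smooth_on_def by blast
  have "continuous_on (snd c ` (fst c \<inter> fst c')) (\<lambda>x. matrix (frechet_derivative (snd c' \<circ> chart_inv c) (at x)))"
    unfolding matrix_def using k by (intro continuous_intros) (auto simp: One_nat_def)
  then show ?thesis
    by (rule continuous_on_eq) (use c in \<open>auto simp: transition_jacobian_def\<close>)
qed

lemma GDERIV_transition:
  assumes c: "c \<in> A" "c' \<in> A" and m: "m \<in> fst c \<inter> fst c'" and h: "GDERIV h (snd c' m) :> D"
  shows "GDERIV (h \<circ> (snd c' \<circ> chart_inv c)) (snd c m) :> transpose (transition_jacobian c c' m) *v D"
proof -
  have "(h has_derivative (\<lambda>v. v \<bullet> D)) (at ((snd c' \<circ> chart_inv c) (snd c m)))"
    using h m c by (simp add: gderiv_def)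
  then have "((h \<circ> (snd c' \<circ> chart_inv c)) has_derivative ((\<lambda>v. v \<bullet> D) \<circ> (\<lambda>v. transition_jacobian c c' m *v v))) (at (snd c m))"
    by (rule diff_chain_at[OF transition_derivative[OF c m]])
  then show ?thesis unfolding gderiv_def inner_transpose_mult by (simp add: o_def)
qed

lemma C1_near_transition:
  assumes c: "c \<in> A" "c' \<in> A" and m: "m \<in> fst c \<inter> fst c'" and h: "C1_near h (snd c' m)"
  shows "C1_near (h \<circ> (snd c' \<circ> chart_inv c)) (snd c m)"
proof -
  obtain S D where S: "open S" "snd c' m \<in> S" "continuous_on S D" "\<And>y. y \<in> S \<Longrightarrow> GDERIV h y :> D y"
    using h unfolding C1_near_def by blast
  define V where "V = {m \<in> fst c \<inter> fst c'. snd c' m \<in> S}"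
  have "V = fst c \<inter> {m \<in> fst c'. snd c' m \<in> S}" by (auto simp: V_def)
  then have V: "open V" using chart_inv_image_open[OF c(2) S(1)] chart_open[OF c(1)] by auto
  have Vc: "V \<subseteq> fst c" by (auto simp: V_def)
  have Vi: "chart_inv c x \<in> V \<and> x \<in> img c" if "x \<in> snd c ` V" for x using that chart_image_eq[OF c(1) Vc] by auto
  have tr: "continuous_on (snd c ` V) (\<lambda>x. snd c' (chart_inv c x))"
    by (rule continuous_on_compose2[OF chart_cont(1)[OF c(2)]], rule continuous_on_subset[OF chart_cont(2)[OF c(1)]])
       (use Vi in \<open>auto simp: V_def\<close>)
  show ?thesis unfolding C1_near_def
  proof (intro exI[of _ "snd c ` V"] exI[of _ "\<lambda>x. transpose (transition_jacobian c c' (chart_inv c x)) *v D (snd c' (chart_inv c x))"] conjI ballI)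
    show "continuous_on (snd c ` V) (\<lambda>x. transpose (transition_jacobian c c' (chart_inv c x)) *v D (snd c' (chart_inv c x)))"
      by (intro continuous_on_matrix_vector_mult continuous_on_transpose continuous_on_compose2[OF S(3) tr]
          continuous_on_subset[OF transition_jacobian_cont[OF c]]) (use Vi in \<open>auto simp: V_def\<close>)
    fix x assume "x \<in> snd c ` V"
    then have x: "chart_inv c x \<in> V" "x \<in> img c" using Vi by auto
    have "GDERIV (h \<circ> (snd c' \<circ> chart_inv c)) (snd c (chart_inv c x)) :> transpose (transition_jacobian c c' (chart_inv c x)) *v D (snd c' (chart_inv c x))"
      by (rule GDERIV_transition[OF c]) (use x S(4) in \<open>auto simp: V_def\<close>)
    then show "GDERIV (h \<circ> (snd c' \<circ> chart_inv c)) x :> transpose (transition_jacobian c c' (chart_inv c x)) *v D (snd c' (chart_inv c x))"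
      using x c by simp
  qed (use V Vc c m S in \<open>auto intro: chart_image_open simp: V_def\<close>)
qed

definition C1_manifold :: "('m \<Rightarrow> real) \<Rightarrow> bool" where
  "C1_manifold u \<longleftrightarrow> (\<forall>c\<in>A. \<forall>m\<in>fst c. C1_near (u \<circ> chart_inv c) (snd c m))"

lemma C01_iff: "u \<in> C01 A \<Omega> \<longleftrightarrow> compact_support_in u \<Omega> \<and> C1_manifold u"
  unfolding C01_def C1_manifold_def using Ck_on_1_iff[OF chart_open(2)] by auto

text \<open>One suitable chart at each point is enough, since the transition maps carry the property
  to every other chart around that point.\<close>

lemma C1_manifoldI:
  assumes "\<And>m. \<exists>c\<in>A. m \<in> fst c \<and> C1_near (u \<circ> chart_inv c) (snd c m)"
  shows "C1_manifold u"
  unfolding C1_manifold_def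
proof (intro ballI)
  fix c m assume c: "c \<in> A" and m: "m \<in> fst c"
  obtain c' where c': "c' \<in> A" "m \<in> fst c'" "C1_near (u \<circ> chart_inv c') (snd c' m)" using assms by blast
  have "C1_near ((u \<circ> chart_inv c') \<circ> (snd c' \<circ> chart_inv c)) (snd c m)"
    using C1_near_transition[OF c c'(1) _ c'(3)] m c' by blast
  then show "C1_near (u \<circ> chart_inv c) (snd c m)"
  proof (rule C1_near_cong[of _ _ "snd c ` (fst c \<inter> fst c')"])
    show "open (snd c ` (fst c \<inter> fst c'))" using c c' by (intro chart_image_open) (auto simp: chart_open)
  qed (use c c' m in auto)
qed

lemma C1_manifold_mult: "C1_manifold u \<Longrightarrow> C1_manifold w \<Longrightarrow> C1_manifold (\<lambda>m. u m * w m)"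
  unfolding C1_manifold_def using C1_near_mult by (fastforce simp: o_def)

lemma C1_manifold_add: "C1_manifold u \<Longrightarrow> C1_manifold w \<Longrightarrow> C1_manifold (\<lambda>m. u m + w m)"
  unfolding C1_manifold_def using C1_near_add by (fastforce simp: o_def)

lemma C1_manifold_const: "C1_manifold (\<lambda>m. k)"
  unfolding C1_manifold_def using C1_near_const by (auto simp: o_def)

lemma C1_manifold_compose:
  assumes "C1_manifold u" "continuous_on UNIV \<Phi>'" "\<And>t. (\<Phi> has_real_derivative \<Phi>' t) (at t)"
  shows "C1_manifold (\<lambda>m. \<Phi> (u m))"
  unfolding C1_manifold_def
proof (intro ballI)
  fix c m assume "c \<in> A" "m \<in> fst c"
  then have "C1_near (u \<circ> chart_inv c) (snd c m)" using assms(1) by (auto simp: C1_manifold_def)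
  from C1_near_compose[OF this open_UNIV UNIV_I assms(2,3)]
  show "C1_near ((\<lambda>m. \<Phi> (u m)) \<circ> chart_inv c) (snd c m)" by (simp add: o_def)
qed

text \<open>The components of the differential \<open>du\<close>. They are covariant and change by
  the transposed Jacobian, while \<open>grad\<close> raises the index with the inverse metric and
  yields a vector field.\<close>

definition cgrad :: "('m, 'n) chart \<Rightarrow> ('m \<Rightarrow> real) \<Rightarrow> 'm \<Rightarrow> real ^ 'n" where
  "cgrad c u m = (\<chi> i. partial (u \<circ> chart_inv c) i (snd c m))"

lemma grad_eq: "grad g u c m = matrix_inv (g c m) *v cgrad c u m"
  by (simp add: grad_def cgrad_def)

lemma cgrad_eq: "GDERIV (u \<circ> chart_inv c) (snd c m) :> D \<Longrightarrow> cgrad c u m = D"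
  unfolding gderiv_def cgrad_def partial_def
  by (drule frechet_derivative_at[symmetric]) (simp add: vec_eq_iff inner_axis' )

lemma GDERIV_cgrad:
  assumes "C1_manifold u" "c \<in> A" "m \<in> fst c"
  shows "GDERIV (u \<circ> chart_inv c) (snd c m) :> cgrad c u m"
proof -
  obtain D where "GDERIV (u \<circ> chart_inv c) (snd c m) :> D"
    using assms unfolding C1_manifold_def C1_near_def by blast
  then show ?thesis using cgrad_eq by metis
qed

lemma cgrad_cont:
  assumes u: "C1_manifold u" and c: "c \<in> A"
  shows "continuous_on (fst c) (cgrad c u)"
proof -
  have "isCont (\<lambda>x. cgrad c u (chart_inv c x)) x" if x: "x \<in> img c" for x
  proof -
    have "C1_near (u \<circ> chart_inv c) (snd c (chart_inv c x))"
      using u c x chart_inv(3)[OF c x] unfolding C1_manifold_def by blast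
    then have "C1_near (u \<circ> chart_inv c) x" using chart_inv(2)[OF c x] by simp
    then obtain S D where S: "open S" "x \<in> S" "continuous_on S D" "\<And>y. y \<in> S \<Longrightarrow> GDERIV (u \<circ> chart_inv c) y :> D y"
      unfolding C1_near_def by blast
    have "continuous_on (S \<inter> img c) D" using S(3) by (rule continuous_on_subset) auto
    then have "continuous_on (S \<inter> img c) (\<lambda>x. cgrad c u (chart_inv c x))"
    proof (rule continuous_on_eq)
      fix y assume y: "y \<in> S \<inter> img c"
      then show "D y = cgrad c u (chart_inv c y)"
        using S(4)[of y] c by (intro cgrad_eq[symmetric]) auto
    qed
    moreover have "open (S \<inter> img c)" "x \<in> S \<inter> img c" using S x chart_open(2)[OF c] by auto
    ultimately show ?thesis by (metis continuous_on_eq_continuous_at)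
  qed
  then have "continuous_on (img c) (\<lambda>x. cgrad c u (chart_inv c x))"
    by (simp add: continuous_at_imp_continuous_on)
  then have "continuous_on (fst c) (\<lambda>m. cgrad c u (chart_inv c (snd c m)))"
    by (rule continuous_on_compose2[OF _ chart_cont(1)[OF c]]) auto
  then show ?thesis using c by (simp cong: continuous_on_cong)
qed

lemma C1_manifold_cont:
  assumes u: "C1_manifold u" shows "continuous_on UNIV u"
proof -
  have "isCont u m" for m
  proof -
    obtain c where c: "c \<in> A" "m \<in> fst c" using charts_cover by blast
    have "continuous_on (img c) (u \<circ> chart_inv c)"
    proof (rule continuous_on_GDERIV)
      fix x assume "x \<in> img c"
      then show "GDERIV (u \<circ> chart_inv c) x :> cgrad c u (chart_inv c x)"
        using GDERIV_cgrad[OF u c(1), of "chart_inv c x"] c by simp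
    qed
    then have "continuous_on (fst c) (\<lambda>m. (u \<circ> chart_inv c) (snd c m))"
      by (rule continuous_on_compose2[OF _ chart_cont(1)[OF c(1)]]) auto
    then have "continuous_on (fst c) u" using c by (simp cong: continuous_on_cong)
    then show ?thesis using c chart_open by (simp add: continuous_on_eq_continuous_at)
  qed
  then show ?thesis by (simp add: continuous_at_imp_continuous_on)
qed

lemma cgrad_transition:
  assumes u: "C1_manifold u" and c: "c \<in> A" "c' \<in> A" and m: "m \<in> fst c \<inter> fst c'"
  shows "cgrad c u m = transpose (transition_jacobian c c' m) *v cgrad c' u m"
proof (rule cgrad_eq)
  have "GDERIV ((u \<circ> chart_inv c') \<circ> (snd c' \<circ> chart_inv c)) (snd c m) :> transpose (transition_jacobian c c' m) *v cgrad c' u m"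
    using GDERIV_transition[OF c m GDERIV_cgrad[OF u c(2)]] m by simp
  then show "GDERIV (u \<circ> chart_inv c) (snd c m) :> transpose (transition_jacobian c c' m) *v cgrad c' u m"
    unfolding gderiv_def
  proof (rule has_derivative_transform_within_open)
    show "open (snd c ` (fst c \<inter> fst c'))" using c by (intro chart_image_open) (auto simp: chart_open)
  qed (use c m in auto)
qed

lemma cgrad_local:
  assumes c: "c \<in> A" "m \<in> fst c" and V: "open V" "m \<in> V" and eq: "\<And>y. y \<in> V \<Longrightarrow> u y = w y" and w: "C1_manifold w"
  shows "cgrad c u m = cgrad c w m"
proof (rule cgrad_eq)
  have "((w \<circ> chart_inv c) has_derivative (\<lambda>h. h \<bullet> cgrad c w m)) (at (snd c m))"
    using GDERIV_cgrad[OF w c] by (simp add: gderiv_def)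
  then show "GDERIV (u \<circ> chart_inv c) (snd c m) :> cgrad c w m"
    unfolding gderiv_def
  proof (rule has_derivative_transform_within_open)
    show "open (snd c ` (fst c \<inter> V))" using c V by (intro chart_image_open) (auto simp: chart_open)
  qed (use c V eq in auto)
qed

lemma cgrad_zero_outside:
  assumes "c \<in> A" "m \<in> fst c" "closed T" "\<And>y. y \<notin> T \<Longrightarrow> u y = 0" "m \<notin> T"
  shows "cgrad c u m = 0"
proof -
  have "cgrad c u m = cgrad c (\<lambda>_. 0) m"
    by (rule cgrad_local[of _ _ "- T"]) (use assms C1_manifold_const in auto)
  also have "\<dots> = 0" by (rule cgrad_eq) (simp add: o_def GDERIV_const)
  finally show ?thesis .
qed

lemma cgrad_add:
  assumes "C1_manifold u" "C1_manifold w" "c \<in> A" "m \<in> fst c"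
  shows "cgrad c (\<lambda>m. u m + w m) m = cgrad c u m + cgrad c w m"
  using GDERIV_add[OF GDERIV_cgrad[OF assms(1,3,4)] GDERIV_cgrad[OF assms(2,3,4)]] assms
  by (intro cgrad_eq) (simp add: o_def)

lemma cgrad_compose:
  assumes "C1_manifold u" "c \<in> A" "m \<in> fst c" "(\<Phi> has_real_derivative t) (at (u m))"
  shows "cgrad c (\<lambda>m. \<Phi> (u m)) m = t *\<^sub>R cgrad c u m"
  using GDERIV_DERIV_compose[OF GDERIV_cgrad[OF assms(1-3)], of \<Phi> t] assms
  by (intro cgrad_eq) (simp add: o_def)

definition push_forward :: "('m, 'n) chart \<Rightarrow> (real ^ 'n \<Rightarrow> real) \<Rightarrow> 'm \<Rightarrow> real" where
  "push_forward c b m = (if m \<in> fst c then b (snd c m) else 0)"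

text \<open>At a point outside the chart domain the extended function vanishes in a whole
  neighbourhood: the image of \<open>S\<close> on the manifold is compact, therefore closed, and
  does not contain the point. This turns functions built in coordinates into global test
  functions.\<close>

lemma push_forward:
  assumes c: "c0 \<in> A" and b: "\<And>x. x \<in> img c0 \<Longrightarrow> C1_near b x"
    and S: "compact S" "S \<subseteq> img c0" "\<And>x. x \<in> img c0 \<Longrightarrow> x \<notin> S \<Longrightarrow> b x = 0"
  shows "C1_manifold (push_forward c0 b)" "{m. push_forward c0 b m \<noteq> 0} \<subseteq> chart_inv c0 ` S" "compact (chart_inv c0 ` S)"
proof -
  show T: "compact (chart_inv c0 ` S)"
    using S chart_cont(2)[OF c] by (auto intro: compact_continuous_image continuous_on_subset)
  show sub: "{m. push_forward c0 b m \<noteq> 0} \<subseteq> chart_inv c0 ` S"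
  proof
    fix m assume "m \<in> {m. push_forward c0 b m \<noteq> 0}"
    then have m: "m \<in> fst c0" "b (snd c0 m) \<noteq> 0" by (auto simp: push_forward_def split: if_splits)
    then have "snd c0 m \<in> S" using S(3) by blast
    then show "m \<in> chart_inv c0 ` S" using m c by (metis chart_inv(1) imageI)
  qed
  show "C1_manifold (push_forward c0 b)"
  proof (rule C1_manifoldI)
    fix m
    show "\<exists>c\<in>A. m \<in> fst c \<and> C1_near (push_forward c0 b \<circ> chart_inv c) (snd c m)"
    proof (cases "m \<in> fst c0")
      case True
      then have "C1_near b (snd c0 m)" using b by auto
      then have "C1_near (push_forward c0 b \<circ> chart_inv c0) (snd c0 m)"
        by (rule C1_near_cong[of _ _ "img c0"]) (use True c in \<open>auto simp: chart_open push_forward_def\<close>)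
      then show ?thesis using True c by blast
    next
      case False
      obtain c' where c': "c' \<in> A" "m \<in> fst c'" using charts_cover by blast
      have "chart_inv c0 ` S \<subseteq> fst c0" using S(2) c by auto
      then have "m \<notin> chart_inv c0 ` S" using False by auto
      have "C1_near (push_forward c0 b \<circ> chart_inv c') (snd c' m)"
      proof (rule C1_near_cong[OF C1_near_const])
        show "open (snd c' ` (fst c' - chart_inv c0 ` S))"
          using c' T by (intro chart_image_open open_Diff) (auto simp: chart_open compact_imp_closed)
        show "snd c' m \<in> snd c' ` (fst c' - chart_inv c0 ` S)" using c' \<open>m \<notin> chart_inv c0 ` S\<close> by blast
        fix y assume "y \<in> snd c' ` (fst c' - chart_inv c0 ` S)"
        then obtain z where "z \<in> fst c'" "z \<notin> chart_inv c0 ` S" "y = snd c' z" by blast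
        then show "0 = (push_forward c0 b \<circ> chart_inv c') y" using sub c' by auto
      qed
      then show ?thesis using c' by blast
    qed
  qed
qed

end

section \<open>Gradients and volume in charts\<close>

lemma compact_pos_lower_bound:
  fixes f :: "'a::topological_space \<Rightarrow> real"
  assumes "compact S" "continuous_on S f" "\<And>x. x \<in> S \<Longrightarrow> 0 < f x"
  obtains m where "m > 0" "\<And>x. x \<in> S \<Longrightarrow> m \<le> f x"
proof (cases "S = {}")
  case True then show ?thesis by (intro that[of 1]) auto
next
  case False
  obtain x where x: "x \<in> S" "\<forall>y\<in>S. f x \<le> f y" using continuous_attains_inf[OF assms(1) False assms(2)] by blast
  then show ?thesis using assms(3) by (intro that[of "f x"]) auto
qed

lemma compact_upper_bound:
  fixes f :: "'a::topological_space \<Rightarrow> real"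
  assumes "compact S" "continuous_on S f"
  obtains M where "M > 0" "\<And>x. x \<in> S \<Longrightarrow> f x \<le> M"
proof (cases "S = {}")
  case True then show ?thesis by (intro that[of 1]) auto
next
  case False
  obtain x where x: "x \<in> S" "\<forall>y\<in>S. f y \<le> f x" using continuous_attains_sup[OF assms(1) False assms(2)] by blast
  then show ?thesis by (intro that[of "max 1 (f x)"]) (auto simp: le_max_iff_disj)
qed

text \<open>Cramer's rule writes the entries as quotients of determinants that depend continuously
  on \<open>x\<close>, with denominators positive by definiteness.\<close>

lemma continuous_on_matrix_inv_mult:
  fixes B :: "'a::topological_space \<Rightarrow> real ^ 'n ^ 'n" and w :: "'a \<Rightarrow> real ^ 'n"
  assumes B: "continuous_on S B" "\<And>x. x \<in> S \<Longrightarrow> pos_def_matrix (B x)" and w: "continuous_on S w"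
  shows "continuous_on S (\<lambda>x. matrix_inv (B x) *v w x)"
proof -
  have nz: "det (B x) \<noteq> 0" if "x \<in> S" for x using pos_def_det_pos[OF B(2)[OF that]] by simp
  have "continuous_on S (\<lambda>x. \<chi> k. det (\<chi> i j. if j = k then w x $ i else B x $ i $ j) / det (B x))"
  proof (intro continuous_on_vec_lambda continuous_on_divide continuous_on_det)
    show "continuous_on S (\<lambda>x. if j = k then w x $ i else B x $ i $ j)" for i j k
      using B(1) w by (cases "j = k") (auto intro!: continuous_intros)
  qed (use B(1) nz in auto)
  then show ?thesis
  proof (rule continuous_on_eq)
    fix x assume "x \<in> S"
    then have "B x *v (matrix_inv (B x) *v w x) = w x" by (intro matrix_inv_mult_vec pos_def_invertible B)
    from iffD1[OF cramer[OF nz[OF \<open>x \<in> S\<close>]] this]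
    show "(\<chi> k. det (\<chi> i j. if j = k then w x $ i else B x $ i $ j) / det (B x)) = matrix_inv (B x) *v w x"
      by (rule sym)
  qed
qed

context riemannian_volume_space
begin

text \<open>Null sets and measurability can be patched together over countably many charts; second
  countability supplies such a subfamily of the atlas.\<close>

lemma countable_atlas:
  obtains A0 where "countable A0" "A0 \<subseteq> A" "(\<Union>c\<in>A0. fst c) = UNIV"
proof -
  obtain F where F: "F \<subseteq> fst ` A" "countable F" "\<Union>F = \<Union>(fst ` A)"
    using Lindelof[of "fst ` A"] chart_open by blast
  obtain A0 where "A0 \<subseteq> A" "F = fst ` A0" "countable A0" using countable_subset_image[of F fst A] F by metis
  then show ?thesis using F charts_cover by (intro that[of A0]) auto
qed

section \<open>The metric on vector fields, gradients and measurability\<close>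

lemma metric_transition:
  assumes "c \<in> A" "c' \<in> A" "m \<in> fst c \<inter> fst c'"
  shows "v \<bullet> (g c m *v w) = (transition_jacobian c c' m *v v) \<bullet> (g c' m *v (transition_jacobian c c' m *v w))"
proof -
  have "g c m = transpose (transition_jacobian c c' m) ** g c' m ** transition_jacobian c c' m"
    using metric assms unfolding riemannian_metric_def by blast
  then have "g c m *v w = transpose (transition_jacobian c c' m) *v (g c' m *v (transition_jacobian c c' m *v w))"
    by (simp only: matrix_vector_mul_assoc matrix_mul_assoc)
  then show ?thesis by (simp only: inner_transpose_mult)
qed

lemma g_inner_chart:
  assumes X: "vector_field_on A \<Omega> X" and Y: "vector_field_on A \<Omega> Y" and c: "c \<in> A" "m \<in> fst c" "m \<in> \<Omega>"
  shows "g_inner A g X Y m = X c m \<bullet> (g c m *v Y c m)"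
proof -
  note c0 = chart_at[of m]
  have "X c m = transition_jacobian (chart_at A m) c m *v X (chart_at A m) m"
    "Y c m = transition_jacobian (chart_at A m) c m *v Y (chart_at A m) m"
    using X Y c c0 unfolding vector_field_on_def by blast+
  then show ?thesis unfolding g_inner_def Let_def using metric_transition[OF c0(1) c(1), of m] c c0 by simp
qed

lemma g_inner_nonneg: "0 \<le> g_inner A g X X m"
  unfolding g_inner_def Let_def using pos_def_nonneg metric_pos_def chart_at by metis

lemma g_norm_nonneg[simp]: "0 \<le> g_norm A g X m"
  unfolding g_norm_def using g_inner_nonneg by simp

lemma g_norm_square: "(g_norm A g X m)\<^sup>2 = g_inner A g X X m"
  unfolding g_norm_def using g_inner_nonneg by simp

lemma g_norm_chart:
  assumes "vector_field_on A \<Omega> X" "c \<in> A" "m \<in> fst c" "m \<in> \<Omega>"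
  shows "g_norm A g X m = sqrt (X c m \<bullet> (g c m *v X c m))"
  unfolding g_norm_def using g_inner_chart[OF assms(1,1) assms(2-)] by simp

lemma g_inner_Cauchy_Schwarz: "\<bar>g_inner A g X Y m\<bar> \<le> g_norm A g X m * g_norm A g Y m"
  unfolding g_norm_def g_inner_def Let_def
  by (rule pos_def_Cauchy_Schwarz) (rule metric_pos_def[OF chart_at])

text \<open>The transformation law is verified by pairing: the metric in \<open>c'\<close>, applied
  to the transported gradient \<open>v\<close>, is compared with \<open>cgrad c' u m\<close> on all
  vectors. Vectors of the form \<open>J *v z\<close> suffice, because \<open>J\<close> respects the
  positive definite forms, hence is injective and so surjective.\<close>

lemma grad_vector_field:
  assumes u: "C1_manifold u" shows "vector_field_on A \<Omega> (grad g u)"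
  unfolding vector_field_on_def
proof (intro ballI)
  fix c c' m assume c: "c \<in> A" "c' \<in> A" and m: "m \<in> fst c \<inter> fst c' \<inter> \<Omega>"
  define J where "J = transition_jacobian c c' m"
  note pd = metric_pos_def[OF c(1)] metric_pos_def[OF c(2)]
  have pd1: "pos_def_matrix (g c m)" and pd2: "pos_def_matrix (g c' m)" using pd m by auto
  have tr: "v \<bullet> (g c m *v w) = (J *v v) \<bullet> (g c' m *v (J *v w))" for v w
    unfolding J_def using metric_transition[OF c] m by blast
  have "inj ((*v) J)"
  proof (rule injI)
    fix x y assume "J *v x = J *v y"
    then have "J *v (x - y) = 0" by (simp add: matrix_vector_mult_diff_distrib)
    then have "(x - y) \<bullet> (g c m *v (x - y)) = 0" by (simp add: tr)
    then show "x = y" using pd1 unfolding pos_def_matrix_def by (metis eq_iff_diff_eq_0 less_irrefl)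
  qed
  then have surj: "surj ((*v) J)" by (rule linear_injective_imp_surjective[OF matrix_vector_mul_linear _ refl])
  define v where "v = J *v grad g u c m"
  have "w \<bullet> (g c' m *v v) = w \<bullet> cgrad c' u m" for w
  proof -
    obtain z where z: "w = J *v z" using surj by (metis surjD)
    have "w \<bullet> (g c' m *v v) = z \<bullet> (g c m *v grad g u c m)" unfolding z v_def tr ..
    also have "g c m *v grad g u c m = cgrad c u m"
      unfolding grad_eq by (rule matrix_inv_mult_vec(1)[OF pos_def_invertible[OF pd1]])
    also have "cgrad c u m = transpose J *v cgrad c' u m"
      unfolding J_def using cgrad_transition[OF u c] m by blast
    also have "z \<bullet> (transpose J *v cgrad c' u m) = w \<bullet> cgrad c' u m" unfolding z by (rule inner_transpose_mult)
    finally show ?thesis .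
  qed
  then have "g c' m *v v = cgrad c' u m" by (metis inner_commute vector_eq_rdot)
  then have "v = matrix_inv (g c' m) *v cgrad c' u m"
    using matrix_inv_mult_vec(2)[OF pos_def_invertible[OF pd2]] by metis
  then show "grad g u c' m = transition_jacobian c c' m *v grad g u c m"
    by (simp add: grad_eq[of u c'] v_def J_def)
qed

text \<open>The metric cancels against the inverse metric in \<open>grad\<close>, leaving
  \<open>du\<close> applied to \<open>X\<close>. In this form the pairing is linear in the
  differential and computable by the product and chain rules in coordinates.\<close>

lemma g_inner_grad:
  assumes "vector_field_on A \<Omega> X" "C1_manifold u" "c \<in> A" "m \<in> fst c" "m \<in> \<Omega>"
  shows "g_inner A g X (grad g u) m = X c m \<bullet> cgrad c u m"
  using g_inner_chart[OF assms(1) grad_vector_field[OF assms(2)] assms(3-)]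
    matrix_inv_mult_vec(1)[OF pos_def_invertible[OF metric_pos_def[OF assms(3,4)]]]
  by (simp add: grad_eq)

lemma measurable_by_charts:
  assumes \<Omega>: "\<Omega> \<in> sets borel" and f: "\<And>c. c \<in> A \<Longrightarrow> f \<in> measurable (restrict_space borel (fst c \<inter> \<Omega>)) N"
  shows "f \<in> measurable (restrict_space borel \<Omega>) N"
proof -
  obtain A0 where A0: "countable A0" "A0 \<subseteq> A" "(\<Union>c\<in>A0. fst c) = UNIV" by (rule countable_atlas)
  show ?thesis
  proof (rule measurable_piecewise_restrict[where C="fst ` A0"])
    fix V assume "V \<in> fst ` A0"
    then obtain c where c: "c \<in> A" "V = fst c" using A0 by auto
    have V: "V \<in> sets borel" using c chart_open by auto
    then show "V \<inter> space (restrict_space borel \<Omega>) \<in> sets (restrict_space borel \<Omega>)"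
      using \<Omega> by (auto simp: sets_restrict_space_iff space_restrict_space)
    show "f \<in> measurable (restrict_space (restrict_space borel \<Omega>) V) N"
      using f[OF c(1)] V \<Omega> c by (simp add: restrict_restrict_space Int_commute)
  qed (use A0 in auto)
qed

lemma AE_by_charts:
  assumes "\<And>c. c \<in> A \<Longrightarrow> AE m in dv. m \<in> fst c \<longrightarrow> m \<in> \<Omega> \<longrightarrow> P m"
  shows "AE m in dv. m \<in> \<Omega> \<longrightarrow> P m"
proof -
  obtain A0 where A0: "countable A0" "A0 \<subseteq> A" "(\<Union>c\<in>A0. fst c) = UNIV" by (rule countable_atlas)
  have "AE m in dv. \<forall>c\<in>A0. m \<in> fst c \<longrightarrow> m \<in> \<Omega> \<longrightarrow> P m"
    using A0 assms by (intro AE_ball_countable[THEN iffD2]) auto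
  then show ?thesis by eventually_elim (use A0(3) in blast)
qed

lemma metric_mult_measurable:
  assumes c: "c \<in> A" and [measurable]: "v \<in> borel_measurable (restrict_space borel (fst c \<inter> \<Omega>))"
  shows "(\<lambda>m. g c m *v v m) \<in> borel_measurable (restrict_space borel (fst c \<inter> \<Omega>))"
proof -
  have [measurable]: "g c \<in> borel_measurable (restrict_space borel (fst c \<inter> \<Omega>))"
    by (intro borel_measurable_continuous_on_restrict continuous_on_subset[OF metric_cont[OF c]]) auto
  have mv: "(\<lambda>(B, v). B *v v) \<in> borel_measurable (borel :: ((real^'n^'n) \<times> (real^'n)) measure)"
    by (intro borel_measurable_continuous_onI) (auto simp: case_prod_beta intro!: continuous_on_matrix_vector_mult continuous_intros)
  have "(\<lambda>m. (g c m, v m)) \<in> borel_measurable (restrict_space borel (fst c \<inter> \<Omega>))" by measurable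
  from measurable_compose[OF this mv] show ?thesis by simp
qed

lemma g_inner_measurable:
  assumes "\<Omega> \<in> sets borel" "vector_field_on A \<Omega> X" "vector_field_on A \<Omega> Y"
    and "\<And>c. c \<in> A \<Longrightarrow> X c \<in> borel_measurable (restrict_space borel (fst c \<inter> \<Omega>))"
    and "\<And>c. c \<in> A \<Longrightarrow> Y c \<in> borel_measurable (restrict_space borel (fst c \<inter> \<Omega>))"
  shows "g_inner A g X Y \<in> borel_measurable (restrict_space borel \<Omega>)"
proof (rule measurable_by_charts[OF assms(1)])
  fix c assume c: "c \<in> A"
  have [measurable]: "X c \<in> borel_measurable (restrict_space borel (fst c \<inter> \<Omega>))"
    "Y c \<in> borel_measurable (restrict_space borel (fst c \<inter> \<Omega>))" using assms c by auto
  have "(\<lambda>m. g c m *v Y c m) \<in> borel_measurable (restrict_space borel (fst c \<inter> \<Omega>))"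
    by (rule metric_mult_measurable[OF c]) measurable
  then have "(\<lambda>m. X c m \<bullet> (g c m *v Y c m)) \<in> borel_measurable (restrict_space borel (fst c \<inter> \<Omega>))" by measurable
  also have "?this \<longleftrightarrow> g_inner A g X Y \<in> borel_measurable (restrict_space borel (fst c \<inter> \<Omega>))"
    by (rule measurable_cong) (use g_inner_chart[OF assms(2,3) c] in \<open>auto simp: space_restrict_space\<close>)
  finally show "g_inner A g X Y \<in> borel_measurable (restrict_space borel (fst c \<inter> \<Omega>))" .
qed

lemma grad_chart_cont:
  assumes "C1_manifold u" "c \<in> A" shows "continuous_on (fst c) (grad g u c)"
proof -
  have "continuous_on (fst c) (\<lambda>m. matrix_inv (g c m) *v cgrad c u m)"
    using assms by (intro continuous_on_matrix_inv_mult metric_cont cgrad_cont metric_pos_def)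
  then show ?thesis by (simp add: grad_eq)
qed

lemma g_norm_grad_cont:
  assumes u: "C1_manifold u" shows "continuous_on UNIV (g_norm A g (grad g u))"
proof -
  have "isCont (g_norm A g (grad g u)) m" for m
  proof -
    obtain c where c: "c \<in> A" "m \<in> fst c" using charts_cover by blast
    have "continuous_on (fst c) (\<lambda>m. sqrt (grad g u c m \<bullet> (g c m *v grad g u c m)))"
      by (intro continuous_intros continuous_on_matrix_vector_mult grad_chart_cont[OF u c(1)] metric_cont[OF c(1)])
    then have "continuous_on (fst c) (g_norm A g (grad g u))"
      by (rule continuous_on_eq) (use g_norm_chart[OF grad_vector_field[OF u, of UNIV] c(1)] in auto)
    then show ?thesis using c chart_open by (simp add: continuous_on_eq_continuous_at)
  qed
  then show ?thesis by (simp add: continuous_at_imp_continuous_on)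
qed

section \<open>The volume measure in charts\<close>

definition weight :: "('m, 'n) chart \<Rightarrow> real ^ 'n \<Rightarrow> real" where
  "weight c x = sqrt (det (g c (chart_inv c x)))"

lemma weight_cont: "c \<in> A \<Longrightarrow> continuous_on (img c) (weight c)"
  unfolding weight_def by (intro continuous_intros continuous_on_det metric_cont')

lemma weight_pos: "c \<in> A \<Longrightarrow> x \<in> img c \<Longrightarrow> 0 < weight c x"
  unfolding weight_def using pos_def_det_pos[OF metric_pos_def[OF _ chart_inv(3)]] by simp

lemma weight_measurable: "c \<in> A \<Longrightarrow> (\<lambda>x. ennreal (weight c x) * indicator (img c) x) \<in> borel_measurable borel"
  using borel_measurable_continuous_on_indicator[OF _ weight_cont, of c] chart_open(2)[of c]
  by (subst borel_measurable_restrict_space_iff_ennreal[symmetric])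
     (auto intro!: measurable_compose[OF borel_measurable_continuous_on_restrict measurable_ennreal] weight_cont)

text \<open>The volume is specified by its values on Borel subsets of chart domains. These say that
  \<open>dv\<close> restricted to \<open>fst c\<close> is the image of the weighted Lebesgue measure
  under the inverse chart, and the formula for integrals follows from this equality of
  measures.\<close>

lemma nn_integral_chart:
  assumes c: "c \<in> A" and h: "h \<in> borel_measurable borel"
  shows "(\<integral>\<^sup>+m. h m * indicator (fst c) m \<partial>dv) =
    (\<integral>\<^sup>+x. h (chart_inv c x) * (ennreal (weight c x) * indicator (img c) x) \<partial>lborel)"
proof -
  note [measurable] = weight_measurable[OF c] h
  have fb[measurable]: "fst c \<in> sets borel" "img c \<in> sets borel" using chart_open[OF c] by auto
  \<comment> \<open>Only the values of \<open>chart_inv\<close> on the chart image matter; making it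
    constant elsewhere gives a Borel map on the whole space.\<close>
  define \<phi> where "\<phi> x = (if x \<in> img c then chart_inv c x else undefined)" for x
  have [measurable]: "\<phi> \<in> measurable borel borel"
    unfolding \<phi>_def using fb(2) chart_cont(2)[OF c] by (intro borel_measurable_continuous_on_if) auto
  define W where "W x = ennreal (weight c x) * indicator (img c) x" for x
  have [measurable]: "W \<in> borel_measurable borel" unfolding W_def by measurable
  have "density dv (indicator (fst c)) = distr (density lborel W) borel \<phi>"
  proof (rule measure_eqI)
    fix B assume "B \<in> sets (density dv (indicator (fst c)))"
    then have [measurable]: "B \<in> sets borel" by simp
    have "emeasure (density dv (indicator (fst c))) B = emeasure dv (fst c \<inter> B)"
      by (subst emeasure_density) (auto simp flip: indicator_inter_arith)
    also have "\<dots> = (\<integral>\<^sup>+ x\<in>snd c ` (fst c \<inter> B). ennreal (sqrt (det (g c (chart_inv c x)))) \<partial>lborel)"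
      using vol c unfolding riemannian_volume_def by auto
    also have "\<dots> = (\<integral>\<^sup>+ x. W x * indicator (\<phi> -` B) x \<partial>lborel)"
    proof (rule nn_integral_cong)
      fix x
      have "x \<in> snd c ` (fst c \<inter> B) \<longleftrightarrow> x \<in> img c \<and> \<phi> x \<in> B"
        using chart_image_eq[OF c, of "fst c \<inter> B"] c by (auto simp: \<phi>_def)
      then show "ennreal (sqrt (det (g c (chart_inv c x)))) * indicator (snd c ` (fst c \<inter> B)) x = W x * indicator (\<phi> -` B) x"
        by (auto simp: W_def weight_def indicator_def)
    qed
    also have "\<dots> = emeasure (distr (density lborel W) borel \<phi>) B"
    proof -
      have "\<phi> -` B \<in> sets borel" using measurable_sets[of \<phi> borel borel B] by simp
      then show ?thesis by (subst emeasure_distr, simp, simp, subst emeasure_density) auto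
    qed
    finally show "emeasure (density dv (indicator (fst c))) B = emeasure (distr (density lborel W) borel \<phi>) B" .
  qed simp
  then have "(\<integral>\<^sup>+m. h m \<partial>density dv (indicator (fst c))) = (\<integral>\<^sup>+m. h m \<partial>distr (density lborel W) borel \<phi>)" by simp
  also have "\<dots> = (\<integral>\<^sup>+x. W x * h (\<phi> x) \<partial>lborel)"
    by (subst nn_integral_distr, measurable, subst nn_integral_density) auto
  also have "(\<integral>\<^sup>+m. h m \<partial>density dv (indicator (fst c))) = (\<integral>\<^sup>+m. h m * indicator (fst c) m \<partial>dv)"
    by (subst nn_integral_density) (auto simp: mult.commute)
  also have "(\<integral>\<^sup>+x. W x * h (\<phi> x) \<partial>lborel) = (\<integral>\<^sup>+x. h (chart_inv c x) * (ennreal (weight c x) * indicator (img c) x) \<partial>lborel)"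
    by (intro nn_integral_cong) (auto simp: W_def \<phi>_def indicator_def mult.commute)
  finally show ?thesis .
qed

lemma emeasure_chart:
  assumes c: "c \<in> A" and B: "B \<in> sets borel" "B \<subseteq> fst c"
  shows "emeasure dv B = (\<integral>\<^sup>+ x\<in>snd c ` B. ennreal (weight c x) \<partial>lborel)"
  using vol c B unfolding riemannian_volume_def weight_def by auto

lemma chart_image_borel:
  assumes c: "c \<in> A" and B: "B \<in> sets borel" "B \<subseteq> fst c" shows "snd c ` B \<in> sets borel"
proof -
  have "chart_inv c \<in> measurable (restrict_space borel (img c)) borel"
    by (rule borel_measurable_continuous_on_restrict[OF chart_cont(2)[OF c]])
  from measurable_sets[OF this B(1)] have "chart_inv c -` B \<inter> img c \<in> sets borel"
    using chart_open(2)[OF c] by (auto simp: sets_restrict_space_iff space_restrict_space)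
  also have "chart_inv c -` B \<inter> img c = snd c ` B" using chart_image_eq[OF c B(2)] by auto
  finally show ?thesis .
qed

lemma chart_preimage_borel:
  assumes c: "c \<in> A" and N: "N \<in> sets borel" shows "{m \<in> fst c. snd c m \<in> N} \<in> sets borel"
proof -
  have "snd c \<in> measurable (restrict_space borel (fst c)) borel"
    by (rule borel_measurable_continuous_on_restrict[OF chart_cont(1)[OF c]])
  from measurable_sets[OF this N] have "snd c -` N \<inter> fst c \<in> sets borel"
    using chart_open(1)[OF c] by (auto simp: sets_restrict_space_iff space_restrict_space)
  also have "snd c -` N \<inter> fst c = {m \<in> fst c. snd c m \<in> N}" by auto
  finally show ?thesis .
qed

text \<open>The weight is positive on the chart image, so \<open>dv\<close> and Lebesgue measure
  have corresponding null sets there. Statements about weak gradients, proved for Lebesgue measure,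
  can thereby be moved to the manifold and back.\<close>

lemma AE_chart_iff:
  assumes c: "c \<in> A" and V: "V \<subseteq> fst c"
  shows "(AE m in dv. m \<in> V \<longrightarrow> P m) \<longleftrightarrow> (AE x in lborel. x \<in> snd c ` V \<longrightarrow> P (chart_inv c x))"
proof
  assume "AE m in dv. m \<in> V \<longrightarrow> P m"
  then obtain N where N: "{m \<in> space dv. \<not> (m \<in> V \<longrightarrow> P m)} \<subseteq> N" "emeasure dv N = 0" "N \<in> sets dv" by (rule AE_E)
  define B where "B = N \<inter> fst c"
  have B: "B \<in> sets borel" "B \<subseteq> fst c" using N chart_open(1)[OF c] by (auto simp: B_def)
  have [measurable]: "snd c ` B \<in> sets borel" by (rule chart_image_borel[OF c B])
  have sub: "snd c ` B \<subseteq> img c" using B by auto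
  have "emeasure dv B = 0" using N by (metis B_def emeasure_mono inf_le1 le_zero_eq)
  then have "(\<integral>\<^sup>+ x\<in>snd c ` B. ennreal (weight c x) \<partial>lborel) = 0" using emeasure_chart[OF c B] by simp
  also have "(\<integral>\<^sup>+ x\<in>snd c ` B. ennreal (weight c x) \<partial>lborel) = (\<integral>\<^sup>+ x. (ennreal (weight c x) * indicator (img c) x) * indicator (snd c ` B) x \<partial>lborel)"
    using sub by (intro nn_integral_cong) (auto simp: indicator_def)
  finally have "AE x in lborel. (ennreal (weight c x) * indicator (img c) x) * indicator (snd c ` B) x = 0"
    using weight_measurable[OF c] by (subst (asm) nn_integral_0_iff_AE) auto
  then show "AE x in lborel. x \<in> snd c ` V \<longrightarrow> P (chart_inv c x)"
  proof eventually_elim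
    case (elim x)
    show ?case
    proof (intro impI, rule ccontr)
      assume x: "x \<in> snd c ` V" "\<not> P (chart_inv c x)"
      then have xi: "x \<in> img c" "chart_inv c x \<in> V" using chart_image_eq[OF c V] by auto
      then have "chart_inv c x \<in> B" using x N(1) c by (auto simp: B_def)
      then have "x \<in> snd c ` B" using xi c by (metis chart_inv(2) imageI)
      then show False using elim xi weight_pos[OF c xi(1)] by (auto simp: indicator_def)
    qed
  qed
next
  assume "AE x in lborel. x \<in> snd c ` V \<longrightarrow> P (chart_inv c x)"
  then obtain N where N: "{x \<in> space lborel. \<not> (x \<in> snd c ` V \<longrightarrow> P (chart_inv c x))} \<subseteq> N" "emeasure lborel N = 0" "N \<in> sets lborel" by (rule AE_E)
  define B where "B = {m \<in> fst c. snd c m \<in> N}"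
  have B: "B \<in> sets borel" "B \<subseteq> fst c" using chart_preimage_borel[OF c] N by (auto simp: B_def)
  have "snd c ` B \<subseteq> N" by (auto simp: B_def)
  then have "emeasure dv B \<le> (\<integral>\<^sup>+ x\<in>N. ennreal (weight c x) \<partial>lborel)"
    unfolding emeasure_chart[OF c B] by (intro nn_integral_mono) (auto simp: indicator_def)
  also have "\<dots> = 0" using N by (intro nn_integral_null_set) auto
  finally have "B \<in> null_sets dv" using B by auto
  then have "AE m in dv. m \<notin> B" by (rule AE_not_in)
  then show "AE m in dv. m \<in> V \<longrightarrow> P m"
  proof eventually_elim
    case (elim m)
    show ?case
    proof (intro impI, rule ccontr)
      assume m: "m \<in> V" "\<not> P m"
      then have "chart_inv c (snd c m) = m" using V c by auto
      then have "snd c m \<in> {x \<in> space lborel. \<not> (x \<in> snd c ` V \<longrightarrow> P (chart_inv c x))}" using m by auto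
      then have "snd c m \<in> N" using N(1) by blast
      then show False using elim m V by (auto simp: B_def)
    qed
  qed
qed

text \<open>The quadratic form of the metric is continuous and positive on the compact product of
  \<open>K\<close> with the unit sphere, so by homogeneity it is comparable to the squared Euclidean
  norm. The weight lies between positive bounds on \<open>K\<close> as well. A single constant is
  taken for all four comparisons.\<close>

lemma chart_bounds:
  assumes c: "c \<in> A" and K: "compact K" "K \<subseteq> img c"
  obtains C where "C > 0" "\<And>x v. x \<in> K \<Longrightarrow> norm v \<le> C * sqrt (v \<bullet> (g c (chart_inv c x) *v v))"
    "\<And>x v. x \<in> K \<Longrightarrow> norm (g c (chart_inv c x) *v v) \<le> C * sqrt (v \<bullet> (g c (chart_inv c x) *v v))"
    "\<And>x. x \<in> K \<Longrightarrow> weight c x \<le> C" "\<And>x. x \<in> K \<Longrightarrow> 1 \<le> C * weight c x"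
proof -
  define q where "q = (\<lambda>(x, v). v \<bullet> (g c (chart_inv c x) *v v))"
  have gc: "continuous_on (K \<times> sphere 0 1) (\<lambda>z. g c (chart_inv c (fst z)))"
    by (rule continuous_on_compose2[OF metric_cont'[OF c]]) (use K in \<open>auto intro!: continuous_intros\<close>)
  have qc: "continuous_on (K \<times> sphere (0::real^'n) 1) q"
    unfolding q_def case_prod_beta by (intro continuous_intros continuous_on_matrix_vector_mult gc)
  have cp: "compact (K \<times> sphere (0::real^'n) 1)" using K by (intro compact_Times) auto
  have pd: "pos_def_matrix (g c (chart_inv c x))" if "x \<in> K" for x using that K c by (intro metric_pos_def) auto
  have qpos: "0 < q z" if "z \<in> K \<times> sphere 0 1" for z
  proof -
    have "fst z \<in> K" "snd z \<noteq> 0" using that by (auto simp: mem_Times_iff)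
    then show ?thesis using pd unfolding q_def pos_def_matrix_def by (auto simp: case_prod_beta)
  qed
  obtain m where m: "m > 0" "\<And>z. z \<in> K \<times> sphere 0 1 \<Longrightarrow> m \<le> q z" using compact_pos_lower_bound[OF cp qc qpos] by blast
  obtain M where M: "M > 0" "\<And>z. z \<in> K \<times> sphere 0 1 \<Longrightarrow> q z \<le> M" using compact_upper_bound[OF cp qc] by blast
  have wc: "continuous_on K (weight c)" using K weight_cont[OF c] by (auto intro: continuous_on_subset)
  obtain m' where m': "m' > 0" "\<And>x. x \<in> K \<Longrightarrow> m' \<le> weight c x"
    using compact_pos_lower_bound[OF K(1) wc] weight_pos[OF c] K(2) by blast
  obtain M' where M': "M' > 0" "\<And>x. x \<in> K \<Longrightarrow> weight c x \<le> M'" using compact_upper_bound[OF K(1) wc] by blast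
  have qb: "m * (norm v)\<^sup>2 \<le> v \<bullet> (g c (chart_inv c x) *v v) \<and> v \<bullet> (g c (chart_inv c x) *v v) \<le> M * (norm v)\<^sup>2" if x: "x \<in> K" for x v
  proof (cases "v = 0")
    case False
    define w where "w = (1 / norm v) *\<^sub>R v"
    have "norm w = 1" using False by (simp add: w_def)
    then have *: "m \<le> w \<bullet> (g c (chart_inv c x) *v w)" "w \<bullet> (g c (chart_inv c x) *v w) \<le> M"
      using m(2)[of "(x, w)"] M(2)[of "(x, w)"] x by (auto simp: q_def)
    have v: "v = norm v *\<^sub>R w" using False by (simp add: w_def)
    have "v \<bullet> (g c (chart_inv c x) *v v) = (norm v *\<^sub>R w) \<bullet> (g c (chart_inv c x) *v (norm v *\<^sub>R w))"
      by (rule arg_cong[OF v, where f="\<lambda>v. v \<bullet> (g c (chart_inv c x) *v v)"])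
    also have "\<dots> = (w \<bullet> (g c (chart_inv c x) *v w)) * (norm v)\<^sup>2"
      by (simp add: matrix_vector_mult_scaleR power2_eq_square mult_ac)
    finally have "v \<bullet> (g c (chart_inv c x) *v v) = (w \<bullet> (g c (chart_inv c x) *v w)) * (norm v)\<^sup>2" .
    then show ?thesis using * by (auto intro!: mult_right_mono)
  qed simp
  define C where "C = max (max (1 / sqrt m) (sqrt M)) (max (1 / m') M')"
  have C: "1 / sqrt m \<le> C" "sqrt M \<le> C" "1 / m' \<le> C" "M' \<le> C" by (auto simp: C_def)
  have C0: "C > 0" using C(4) M' by linarith
  show ?thesis
  proof (rule that[of C])
    fix x v assume x: "x \<in> K"
    let ?q = "v \<bullet> (g c (chart_inv c x) *v v)"
    have q0: "0 \<le> ?q" by (rule pos_def_nonneg[OF pd[OF x]])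
    have "sqrt (m * (norm v)\<^sup>2) \<le> sqrt ?q" using qb[OF x] by (intro real_sqrt_le_mono) auto
    then have "norm v \<le> (1 / sqrt m) * sqrt ?q" using m(1) by (simp add: real_sqrt_mult field_simps)
    also have "\<dots> \<le> C * sqrt ?q" using C(1) q0 by (intro mult_right_mono) auto
    finally show "norm v \<le> C * sqrt ?q" .
    let ?w = "g c (chart_inv c x) *v v"
    \<comment> \<open>The squared norm of \<open>?w\<close> is read as the form evaluated at
      \<open>?w\<close> and \<open>v\<close>. Its Cauchy-Schwarz inequality and the upper bound at
      \<open>?w\<close> itself leave one factor \<open>norm ?w\<close>, which cancels.\<close>
    have "norm ?w * norm ?w = \<bar>?w \<bullet> (g c (chart_inv c x) *v v)\<bar>" by (simp add: norm_eq_sqrt_inner)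
    also have "\<dots> \<le> sqrt (?w \<bullet> (g c (chart_inv c x) *v ?w)) * sqrt ?q" by (rule pos_def_Cauchy_Schwarz[OF pd[OF x]])
    also have "\<dots> \<le> sqrt (M * (norm ?w)\<^sup>2) * sqrt ?q"
      using qb[OF x, of ?w] q0 by (intro mult_right_mono real_sqrt_le_mono) auto
    also have "\<dots> = norm ?w * (sqrt M * sqrt ?q)" by (simp add: real_sqrt_mult)
    finally have "norm ?w \<le> sqrt M * sqrt ?q" 
      using q0 M(1) by (cases "norm ?w = 0") (auto simp: mult_le_cancel_left)
    also have "\<dots> \<le> C * sqrt ?q" using C(2) q0 by (intro mult_right_mono) auto
    finally show "norm ?w \<le> C * sqrt ?q" .
  next
    fix x assume x: "x \<in> K"
    show "weight c x \<le> C" using M'(2)[OF x] C(4) by linarith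
    have "1 = (1 / m') * m'" using m' by simp
    also have "\<dots> \<le> C * weight c x" using C(3) m'(2)[OF x] m'(1) C0 by (intro mult_mono) auto
    finally show "1 \<le> C * weight c x" .
  qed (rule C0)
qed

section \<open>Weak gradients on the manifold, read in charts\<close>

lemma chart_inv_measurable:
  assumes c: "c \<in> A" and \<Omega>: "open \<Omega>" and f: "f \<in> borel_measurable (restrict_space borel (fst c \<inter> \<Omega>))"
  shows "(\<lambda>x. f (chart_inv c x)) \<in> borel_measurable (restrict_space borel (snd c ` (fst c \<inter> \<Omega>)))"
proof (rule measurable_compose[OF _ f])
  have eq: "snd c ` (fst c \<inter> \<Omega>) = {x \<in> img c. chart_inv c x \<in> fst c \<inter> \<Omega>}" by (rule chart_image_eq[OF c]) auto
  show "chart_inv c \<in> measurable (restrict_space borel (snd c ` (fst c \<inter> \<Omega>))) (restrict_space borel (fst c \<inter> \<Omega>))"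
  proof (rule measurable_restrict_space2)
    show "chart_inv c \<in> space (restrict_space borel (snd c ` (fst c \<inter> \<Omega>))) \<rightarrow> fst c \<inter> \<Omega>"
      using eq by (auto simp: space_restrict_space)
    show "chart_inv c \<in> borel_measurable (restrict_space borel (snd c ` (fst c \<inter> \<Omega>)))"
      by (intro borel_measurable_continuous_on_restrict continuous_on_subset[OF chart_cont(2)[OF c]]) auto
  qed
qed

lemma nn_integral_chart_compact:
  assumes c: "c \<in> A" and K: "compact K" "K \<subseteq> img c" and h: "(\<lambda>m. h m * indicator (chart_inv c ` K) m) \<in> borel_measurable borel"
  shows "(\<integral>\<^sup>+m\<in>chart_inv c ` K. h m \<partial>dv) = (\<integral>\<^sup>+x\<in>K. h (chart_inv c x) * ennreal (weight c x) \<partial>lborel)"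
proof -
  have "(\<integral>\<^sup>+m\<in>chart_inv c ` K. h m \<partial>dv) = (\<integral>\<^sup>+m. (h m * indicator (chart_inv c ` K) m) * indicator (fst c) m \<partial>dv)"
    using K c by (intro nn_integral_cong) (auto simp: indicator_def)
  also have "\<dots> = (\<integral>\<^sup>+x. (h (chart_inv c x) * indicator (chart_inv c ` K) (chart_inv c x)) * (ennreal (weight c x) * indicator (img c) x) \<partial>lborel)"
    by (rule nn_integral_chart[OF c h])
  also have "\<dots> = (\<integral>\<^sup>+x\<in>K. h (chart_inv c x) * ennreal (weight c x) \<partial>lborel)"
  proof (rule nn_integral_cong)
    fix x
    have "x \<in> K \<longleftrightarrow> chart_inv c x \<in> chart_inv c ` K" if "x \<in> img c"
    proof
      assume "chart_inv c x \<in> chart_inv c ` K"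
      then obtain y where "y \<in> K" "chart_inv c x = chart_inv c y" by blast
      then have "x = y" using that K(2) chart_inv(2)[OF c] by (metis subsetD)
      then show "x \<in> K" using \<open>y \<in> K\<close> by simp
    qed simp
    then show "(h (chart_inv c x) * indicator (chart_inv c ` K) (chart_inv c x)) * (ennreal (weight c x) * indicator (img c) x)
       = h (chart_inv c x) * ennreal (weight c x) * indicator K x"
      using K by (auto simp: indicator_def)
  qed
  finally show ?thesis .
qed

text \<open>On a compact set in the chart, \<open>F\<close> is at most a constant times
  \<open>N\<close>, and Lebesgue measure is at most a constant times the volume. The integral of
  \<open>norm (F x)\<close> is therefore controlled by an integral of \<open>N\<close> over a
  compact subset of \<Omega>.\<close>

lemma locally_integrable_chart:
  fixes F :: "real ^ 'n \<Rightarrow> 'b::{banach, second_countable_topology}"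
  assumes c: "c \<in> A" and \<Omega>: "open \<Omega>"
    and F: "F \<in> borel_measurable (restrict_space borel (snd c ` (fst c \<inter> \<Omega>)))"
    and N: "N \<in> borel_measurable (restrict_space borel \<Omega>)" "\<And>K. compact K \<Longrightarrow> K \<subseteq> \<Omega> \<Longrightarrow> (\<integral>\<^sup>+m\<in>K. ennreal (N m) \<partial>dv) < \<infinity>"
    and le: "\<And>K. compact K \<Longrightarrow> K \<subseteq> img c \<Longrightarrow> \<exists>C. \<forall>x\<in>K. chart_inv c x \<in> \<Omega> \<longrightarrow> norm (F x) \<le> C * N (chart_inv c x) \<and> 0 \<le> N (chart_inv c x)"
  shows "locally_integrable_on F (snd c ` (fst c \<inter> \<Omega>))"
  unfolding locally_integrable_on_def
proof (intro allI impI)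
  fix K assume K: "compact K \<and> K \<subseteq> snd c ` (fst c \<inter> \<Omega>)"
  let ?U = "snd c ` (fst c \<inter> \<Omega>)"
  have Ki: "compact K" "K \<subseteq> img c" using K by auto
  have K\<Omega>: "chart_inv c x \<in> \<Omega>" if "x \<in> K" for x using that K chart_image_eq[OF c, of "fst c \<inter> \<Omega>"] by auto
  have U: "?U \<in> sets borel" using \<Omega> c by (intro borel_open chart_image_open) (auto simp: chart_open)
  have Kb[measurable]: "K \<in> sets borel" using Ki by (simp add: borel_compact)
  have T: "compact (chart_inv c ` K)" using Ki chart_cont(2)[OF c] by (auto intro: compact_continuous_image continuous_on_subset)
  have T\<Omega>: "chart_inv c ` K \<subseteq> \<Omega>" using K\<Omega> by auto
  have Tb[measurable]: "chart_inv c ` K \<in> sets borel" using T by (simp add: compact_imp_closed)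
  obtain C0 where C0: "\<And>x. x \<in> K \<Longrightarrow> norm (F x) \<le> C0 * N (chart_inv c x) \<and> 0 \<le> N (chart_inv c x)"
    using le[OF Ki] K\<Omega> by blast
  \<comment> \<open>The constant provided by \<open>le\<close> carries no sign; a nonnegative one is
    needed as a factor in \<open>ennreal\<close>.\<close>
  define C1 where "C1 = max C0 0"
  have "C0 * N (chart_inv c x) \<le> C1 * N (chart_inv c x)" if "x \<in> K" for x
    using C0[OF that] by (intro mult_right_mono) (auto simp: C1_def)
  then have C1: "C1 \<ge> 0" "\<And>x. x \<in> K \<Longrightarrow> norm (F x) \<le> C1 * N (chart_inv c x)"
    using C0 by (auto simp: C1_def intro: order_trans)
  obtain C2 where C2: "C2 > 0" "\<And>x. x \<in> K \<Longrightarrow> 1 \<le> C2 * weight c x" using chart_bounds[OF c Ki] by metis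
  have "(\<lambda>m. N m * indicator \<Omega> m) \<in> borel_measurable borel"
    using N(1) \<Omega> by (subst (asm) borel_measurable_restrict_space_iff) (auto simp: mult.commute)
  then have "(\<lambda>m. ennreal (N m * indicator \<Omega> m) * indicator (chart_inv c ` K) m) \<in> borel_measurable borel" by measurable
  also have "(\<lambda>m. ennreal (N m * indicator \<Omega> m) * indicator (chart_inv c ` K) m) = (\<lambda>m. ennreal (N m) * indicator (chart_inv c ` K) m)"
    using T\<Omega> by (auto simp: indicator_def fun_eq_iff)
  finally have Nm: "(\<lambda>m. ennreal (N m) * indicator (chart_inv c ` K) m) \<in> borel_measurable borel" .
  have "(\<lambda>x. indicator ?U x *\<^sub>R F x) \<in> borel_measurable borel"
    using F U by (subst (asm) borel_measurable_restrict_space_iff) auto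
  then have "(\<lambda>x. indicator K x *\<^sub>R (indicator ?U x *\<^sub>R F x)) \<in> borel_measurable borel" by measurable
  also have "(\<lambda>x. indicator K x *\<^sub>R (indicator ?U x *\<^sub>R F x)) = (\<lambda>x. indicator K x *\<^sub>R F x)"
    using K by (auto simp: indicator_def fun_eq_iff)
  finally have Fm: "(\<lambda>x. indicator K x *\<^sub>R F x) \<in> borel_measurable borel" .
  have "(\<integral>\<^sup>+x. norm (indicator K x *\<^sub>R F x) \<partial>lborel) \<le> (\<integral>\<^sup>+x. ennreal (C1 * C2) * (ennreal (N (chart_inv c x)) * ennreal (weight c x) * indicator K x) \<partial>lborel)"
  proof (rule nn_integral_mono)
    fix x
    show "ennreal (norm (indicator K x *\<^sub>R F x)) \<le> ennreal (C1 * C2) * (ennreal (N (chart_inv c x)) * ennreal (weight c x) * indicator K x)"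
    proof (cases "x \<in> K")
      case True
      have w: "0 \<le> weight c x" using weight_pos[OF c, of x] Ki True by auto
      have "norm (F x) \<le> (C1 * N (chart_inv c x)) * 1" using C1(2)[OF True] by simp
      also have "\<dots> \<le> (C1 * N (chart_inv c x)) * (C2 * weight c x)" using C2(2)[OF True] C1 C0[OF True] by (intro mult_left_mono) auto
      finally show ?thesis using True C1(1) C2(1) C0[OF True] w by (simp add: mult_ac flip: ennreal_mult)
    qed simp
  qed
  also have "\<dots> = ennreal (C1 * C2) * (\<integral>\<^sup>+x. ennreal (N (chart_inv c x)) * ennreal (weight c x) * indicator K x \<partial>lborel)"
  proof (rule nn_integral_cmult)
    define \<phi> where "\<phi> x = (if x \<in> img c then chart_inv c x else undefined)" for x
    have ib: "img c \<in> sets borel" using chart_open(2)[OF c] by auto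
    have [measurable]: "\<phi> \<in> measurable borel borel"
      unfolding \<phi>_def using ib chart_cont(2)[OF c] by (intro borel_measurable_continuous_on_if) auto
    note [measurable] = weight_measurable[OF c] Nm
    have "(\<lambda>x. (ennreal (N (\<phi> x)) * indicator (chart_inv c ` K) (\<phi> x)) * (ennreal (weight c x) * indicator (img c) x) * indicator K x) \<in> borel_measurable borel"
      using measurable_compose[OF _ Nm, of \<phi> borel] by measurable
    also have "(\<lambda>x. (ennreal (N (\<phi> x)) * indicator (chart_inv c ` K) (\<phi> x)) * (ennreal (weight c x) * indicator (img c) x) * indicator K x)
      = (\<lambda>x. ennreal (N (chart_inv c x)) * ennreal (weight c x) * indicator K x)"
      using Ki by (auto simp: indicator_def fun_eq_iff \<phi>_def)
    finally show "(\<lambda>x. ennreal (N (chart_inv c x)) * ennreal (weight c x) * indicator K x) \<in> borel_measurable lborel" by simp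
  qed
  also have "(\<integral>\<^sup>+x. ennreal (N (chart_inv c x)) * ennreal (weight c x) * indicator K x \<partial>lborel) = (\<integral>\<^sup>+m\<in>chart_inv c ` K. ennreal (N m) \<partial>dv)"
    by (rule nn_integral_chart_compact[OF c Ki Nm, symmetric])
  also have "ennreal (C1 * C2) * \<dots> < \<infinity>" using N(2)[OF T T\<Omega>] by (simp add: ennreal_mult_less_top)
  finally show "set_integrable lborel K F"
    unfolding set_integrable_def using Fm by (intro integrableI_bounded) auto
qed

text \<open>The lowered components of \<open>X\<close>, not \<open>X\<close> itself, form the
  Euclidean weak gradient. \<open>chart_bounds\<close> compares their Euclidean norm with the
  Riemannian norm of \<open>X\<close>, which gives local integrability, and the component identities
  of the definition combine into one vector identity.\<close>

lemma weak_gradient_chart: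
  assumes \<Omega>: "open \<Omega>" and fX: "has_weak_gradient A g dv \<Omega> f X" and c: "c \<in> A"
  shows "weak_gradient (snd c ` (fst c \<inter> \<Omega>)) (\<lambda>x. f (chart_inv c x)) (\<lambda>x. g c (chart_inv c x) *v X c (chart_inv c x))"
    and "Lp_loc dv p \<Omega> (g_norm A g X) \<Longrightarrow> p \<ge> 1 \<Longrightarrow>
      locally_integrable_on (\<lambda>x. norm (g c (chart_inv c x) *v X c (chart_inv c x)) powr p) (snd c ` (fst c \<inter> \<Omega>))"
proof -
  let ?U = "snd c ` (fst c \<inter> \<Omega>)"
  define F where "F x = f (chart_inv c x)" for x
  define G where "G x = g c (chart_inv c x) *v X c (chart_inv c x)" for x
  have vf: "vector_field_on A \<Omega> X" using fX by (simp add: has_weak_gradient_def)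
  have fl: "Lp_loc dv 1 \<Omega> f" "Lp_loc dv 1 \<Omega> (g_norm A g X)" using fX by (auto simp: has_weak_gradient_def)
  have fm: "f \<in> borel_measurable (restrict_space borel \<Omega>)" using fl by (simp add: Lp_loc_def)
  have "f \<in> borel_measurable (restrict_space (restrict_space borel \<Omega>) (fst c))"
    by (rule measurable_restrict_space1[OF fm])
  then have "f \<in> borel_measurable (restrict_space borel (fst c \<inter> \<Omega>))"
    using \<Omega> chart_open[OF c] by (simp add: restrict_restrict_space Int_commute)
  then have Fm: "F \<in> borel_measurable (restrict_space borel ?U)"
    unfolding F_def by (rule chart_inv_measurable[OF c \<Omega>])
  have Gm: "G \<in> borel_measurable (restrict_space borel ?U)"
  proof -
    have "X c \<in> borel_measurable (restrict_space borel (fst c \<inter> \<Omega>))" using fX c by (auto simp: has_weak_gradient_def)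
    then have "(\<lambda>m. g c m *v X c m) \<in> borel_measurable (restrict_space borel (fst c \<inter> \<Omega>))"
      by (rule metric_mult_measurable[OF c])
    then show ?thesis unfolding G_def by (rule chart_inv_measurable[OF c \<Omega>])
  qed
  have Gle: "\<exists>C. C > 0 \<and> (\<forall>x\<in>K. chart_inv c x \<in> \<Omega> \<longrightarrow> norm (G x) \<le> C * g_norm A g X (chart_inv c x))"
    if K: "compact K" "K \<subseteq> img c" for K
  proof -
    obtain C where C: "C > 0" "\<And>x v. x \<in> K \<Longrightarrow> norm (g c (chart_inv c x) *v v) \<le> C * sqrt (v \<bullet> (g c (chart_inv c x) *v v))"
      using chart_bounds[OF c K] by metis
    show ?thesis
    proof (intro exI[of _ C] conjI ballI impI C(1))
      fix x assume x: "x \<in> K" "chart_inv c x \<in> \<Omega>"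
      have "chart_inv c x \<in> fst c" using x K c by auto
      show "norm (G x) \<le> C * g_norm A g X (chart_inv c x)"
        unfolding G_def g_norm_chart[OF vf c \<open>chart_inv c x \<in> fst c\<close> x(2)] by (rule C(2)[OF x(1)])
    qed
  qed
  have liF: "locally_integrable_on F ?U"
  proof (rule locally_integrable_chart[OF c \<Omega> Fm, of "\<lambda>m. \<bar>f m\<bar>"])
    show "(\<lambda>m. \<bar>f m\<bar>) \<in> borel_measurable (restrict_space borel \<Omega>)" using fm by measurable
    show "(\<integral>\<^sup>+m\<in>K. ennreal \<bar>f m\<bar> \<partial>dv) < \<infinity>" if "compact K" "K \<subseteq> \<Omega>" for K
      using fl(1) that by (auto simp: Lp_loc_def)
  qed (auto simp: F_def intro!: exI[of _ 1])
  have nm: "g_norm A g X \<in> borel_measurable (restrict_space borel \<Omega>)" using fl(2) by (simp add: Lp_loc_def)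
  have liG: "locally_integrable_on G ?U"
  proof (rule locally_integrable_chart[OF c \<Omega> Gm nm])
    show "(\<integral>\<^sup>+m\<in>K. ennreal (g_norm A g X m) \<partial>dv) < \<infinity>" if "compact K" "K \<subseteq> \<Omega>" for K
      using fl(2) that by (auto simp: Lp_loc_def)
  qed (use Gle in \<open>auto, blast\<close>)
  show "locally_integrable_on (\<lambda>x. norm (g c (chart_inv c x) *v X c (chart_inv c x)) powr p) ?U"
    if lp: "Lp_loc dv p \<Omega> (g_norm A g X)" and p: "p \<ge> 1"
    unfolding G_def[symmetric]
  proof (rule locally_integrable_chart[OF c \<Omega>, of _ "\<lambda>m. g_norm A g X m powr p"])
    show "(\<lambda>x. norm (G x) powr p) \<in> borel_measurable (restrict_space borel ?U)" using Gm by measurable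
    show "(\<lambda>m. g_norm A g X m powr p) \<in> borel_measurable (restrict_space borel \<Omega>)" using nm by measurable
    show "(\<integral>\<^sup>+m\<in>K. ennreal (g_norm A g X m powr p) \<partial>dv) < \<infinity>" if "compact K" "K \<subseteq> \<Omega>" for K
      using lp that by (auto simp: Lp_loc_def)
    fix K assume K: "compact K" "K \<subseteq> img c"
    obtain C where C: "C > 0" "\<forall>x\<in>K. chart_inv c x \<in> \<Omega> \<longrightarrow> norm (G x) \<le> C * g_norm A g X (chart_inv c x)" using Gle[OF K] by blast
    show "\<exists>C. \<forall>x\<in>K. chart_inv c x \<in> \<Omega> \<longrightarrow> norm (norm (G x) powr p) \<le> C * g_norm A g X (chart_inv c x) powr p \<and> 0 \<le> g_norm A g X (chart_inv c x) powr p"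
    proof (intro exI[of _ "C powr p"] ballI impI conjI)
      fix x assume "x \<in> K" "chart_inv c x \<in> \<Omega>"
      then have "norm (G x) powr p \<le> (C * g_norm A g X (chart_inv c x)) powr p" using C p by (intro powr_mono2) auto
      then show "norm (norm (G x) powr p) \<le> C powr p * g_norm A g X (chart_inv c x) powr p" using C by (simp add: powr_mult)
    qed auto
  qed
  have "(LINT x:K|lborel. F x *\<^sub>R D x) = - (LINT x:K|lborel. \<psi> x *\<^sub>R G x)"
    if K: "K \<subseteq> ?U" and t: "test_function K \<psi> D" for K \<psi> D
  proof -
    have Kc: "compact K" using t by (simp add: test_function_def)
    have [measurable]: "\<psi> \<in> borel_measurable borel" "D \<in> borel_measurable borel"
      using test_function_continuous[OF t] by (auto intro: borel_measurable_continuous_onI)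
    obtain C where C: "C \<ge> 0" "\<And>x. \<bar>\<psi> x\<bar> \<le> C" "\<And>x. norm (D x) \<le> C" using test_function_bounds[OF t] by blast
    have i1: "set_integrable lborel K (\<lambda>x. F x *\<^sub>R D x)"
      using liF Kc K C by (intro set_integrable_scaleR_bounded[where B=C]) (auto simp: locally_integrable_on_def)
    have i2: "set_integrable lborel K (\<lambda>x. \<psi> x *\<^sub>R G x)"
      using liG Kc K C by (intro set_integrable_bounded_scaleR[where B=C]) (auto simp: locally_integrable_on_def)
    have \<psi>0: "\<psi> x = 0" "D x = 0" if "x \<notin> K" for x
      using t that test_function_gradient_zero[OF t that] by (auto simp: test_function_def)
    have GD: "GDERIV \<psi> x :> D x" for x using t by (auto simp: test_function_def)
    have "Ck_on 1 \<psi> UNIV"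
      unfolding Ck_on_1_iff[OF open_UNIV] C1_near_def using t unfolding test_function_def by blast
    moreover have "compact_support_in \<psi> ?U"
      using K Kc \<psi>0 by (intro compact_support_inI[of K]) auto
    ultimately have wk: "(LINT x:?U|lborel. f (chart_inv c x) * partial \<psi> i x) = - (LINT x:?U|lborel. (g c (chart_inv c x) *v X c (chart_inv c x)) $ i * \<psi> x)" for i
      using fX c unfolding has_weak_gradient_def by blast
    have pD: "partial \<psi> i x = D x $ i" for i x
      using frechet_derivative_at[OF GD[of x, unfolded gderiv_def]] unfolding partial_def by (metis inner_axis' real_inner_1_left)
    have "(LINT x:K|lborel. F x *\<^sub>R D x) $ i = (- (LINT x:K|lborel. \<psi> x *\<^sub>R G x)) $ i" for i
    proof -
      have nth: "v $ i = v \<bullet> axis i 1" for v :: "real ^ 'n" by (simp add: inner_axis)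
      have "(LINT x:K|lborel. F x *\<^sub>R D x) $ i = (LINT x|lborel. (indicator K x *\<^sub>R F x *\<^sub>R D x) \<bullet> axis i 1)"
        unfolding nth set_lebesgue_integral_def using i1 unfolding set_integrable_def by (subst integral_inner_left) auto
      also have "\<dots> = (LINT x:?U|lborel. f (chart_inv c x) * partial \<psi> i x)"
        unfolding set_lebesgue_integral_def
        by (intro Bochner_Integration.integral_cong) (use K \<psi>0 in \<open>auto simp: indicator_def F_def inner_axis pD\<close>)
      also have "\<dots> = - (LINT x:?U|lborel. (g c (chart_inv c x) *v X c (chart_inv c x)) $ i * \<psi> x)" by (rule wk)
      also have "(LINT x:?U|lborel. (g c (chart_inv c x) *v X c (chart_inv c x)) $ i * \<psi> x) = (LINT x|lborel. (indicator K x *\<^sub>R \<psi> x *\<^sub>R G x) \<bullet> axis i 1)"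
        unfolding set_lebesgue_integral_def
        by (intro Bochner_Integration.integral_cong) (use K \<psi>0 in \<open>auto simp: indicator_def G_def inner_axis\<close>)
      also have "\<dots> = (LINT x:K|lborel. \<psi> x *\<^sub>R G x) $ i"
        unfolding nth set_lebesgue_integral_def using i2 unfolding set_integrable_def by (subst integral_inner_left) auto
      finally show ?thesis by simp
    qed
    then show ?thesis by (simp add: vec_eq_iff)
  qed
  then show "weak_gradient ?U (\<lambda>x. f (chart_inv c x)) (\<lambda>x. g c (chart_inv c x) *v X c (chart_inv c x))"
    unfolding weak_gradient_def F_def[symmetric] G_def[symmetric] using liF liG by blast
qed

end

section \<open>Testing \<open>p\<close>-superharmonicity\<close>

text \<open>Splitting the derivative into its parts for positive and negative \<open>t\<close> makes
  it visibly continuous, also at 0 and for exponents below 2. Hence the p-th power of the modulus of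
  a C^1 function is again C^1.\<close>

lemma DERIV_abs_powr:
  assumes p: "p > 1"
  shows "((\<lambda>t::real. \<bar>t\<bar> powr p) has_real_derivative p * (max 0 t) powr (p - 1) - p * (max 0 (- t)) powr (p - 1)) (at t)"
proof -
  have "((\<lambda>t::real. (max 0 (- t)) powr p) has_real_derivative p * (max 0 (- t)) powr (p - 1) * (- 1)) (at t)"
    by (rule DERIV_chain2[OF DERIV_max_0_powr[OF p]]) (auto intro!: derivative_eq_intros)
  from DERIV_add[OF DERIV_max_0_powr[OF p] this]
  have "((\<lambda>t::real. (max 0 t) powr p + (max 0 (- t)) powr p) has_real_derivative p * (max 0 t) powr (p - 1) - p * (max 0 (- t)) powr (p - 1)) (at t)"
    by simp
  also have "(\<lambda>t::real. (max 0 t) powr p + (max 0 (- t)) powr p) = (\<lambda>t. \<bar>t\<bar> powr p)"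
    using p by (auto simp: fun_eq_iff max_def)
  finally show ?thesis .
qed

context riemannian_volume_space
begin

section \<open>Volume of compact sets, cut-off functions, finite energy\<close>

lemma emeasure_compact_chart:
  assumes c: "c \<in> A" and K: "compact K" "K \<subseteq> img c"
  shows "emeasure dv (chart_inv c ` K) < \<infinity>"
proof -
  have T: "compact (chart_inv c ` K)" using K chart_cont(2)[OF c] by (auto intro: compact_continuous_image continuous_on_subset)
  then have Tb: "chart_inv c ` K \<in> sets borel" by (simp add: compact_imp_closed)
  obtain C where C: "C > 0" "\<And>x. x \<in> K \<Longrightarrow> weight c x \<le> C" using chart_bounds[OF c K] by metis
  have "emeasure dv (chart_inv c ` K) = (\<integral>\<^sup>+m\<in>chart_inv c ` K. 1 \<partial>dv)" using Tb by simp
  also have "\<dots> = (\<integral>\<^sup>+x\<in>K. 1 * ennreal (weight c x) \<partial>lborel)"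
    by (rule nn_integral_chart_compact[OF c K]) (use Tb in auto)
  also have "\<dots> \<le> (\<integral>\<^sup>+x. ennreal C * indicator K x \<partial>lborel)"
    using C(2) by (intro nn_integral_mono) (auto simp: indicator_def intro: ennreal_leI)
  also have "\<dots> = ennreal C * emeasure lborel K"
    using K by (subst nn_integral_cmult_indicator) (auto simp: borel_compact)
  also have "\<dots> < \<infinity>" using emeasure_compact_finite[OF K(1)] by (simp add: ennreal_mult_less_top)
  finally show ?thesis .
qed

lemma chart_neighbourhood:
  obtains c r where "c \<in> A" "m \<in> fst c" "r > 0" "cball (snd c m) r \<subseteq> img c"
proof -
  obtain c where c: "c \<in> A" "m \<in> fst c" using charts_cover by blast
  then obtain r where "r > 0" "cball (snd c m) r \<subseteq> img c"
    using chart_open(2)[OF c(1)] open_contains_cball by blast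
  then show ?thesis using c that by blast
qed

lemma emeasure_compact_manifold:
  assumes K: "compact K" shows "emeasure dv K < \<infinity>"
proof -
  have "\<exists>V. open V \<and> m \<in> V \<and> (\<exists>B. V \<subseteq> B \<and> B \<in> sets borel \<and> emeasure dv B < \<infinity>)" for m
  proof -
    obtain c r where c: "c \<in> A" "m \<in> fst c" "r > 0" "cball (snd c m) r \<subseteq> img c" by (rule chart_neighbourhood)
    have "open {m' \<in> fst c. snd c m' \<in> ball (snd c m) r}" by (rule chart_inv_image_open[OF c(1)]) simp
    moreover have "{m' \<in> fst c. snd c m' \<in> ball (snd c m) r} \<subseteq> chart_inv c ` cball (snd c m) r"
    proof
      fix m' assume "m' \<in> {m' \<in> fst c. snd c m' \<in> ball (snd c m) r}"
      then have "m' = chart_inv c (snd c m')" "snd c m' \<in> cball (snd c m) r" using c(1) by auto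
      then show "m' \<in> chart_inv c ` cball (snd c m) r" by blast
    qed
    moreover have "compact (chart_inv c ` cball (snd c m) r)"
      using c chart_cont(2)[OF c(1)] by (auto intro: compact_continuous_image continuous_on_subset)
    moreover have "emeasure dv (chart_inv c ` cball (snd c m) r) < \<infinity>"
      using c by (intro emeasure_compact_chart) auto
    ultimately show ?thesis using c by (intro exI conjI) (auto simp: compact_imp_closed)
  qed
  then obtain V where V: "\<And>m. open (V m)" "\<And>m. m \<in> V m" "\<And>m. \<exists>B. V m \<subseteq> B \<and> B \<in> sets borel \<and> emeasure dv B < \<infinity>"
    by metis
  then obtain B where B: "\<And>m. V m \<subseteq> B m" "\<And>m. B m \<in> sets borel" "\<And>m. emeasure dv (B m) < \<infinity>" by metis
  obtain F where F: "finite F" "F \<subseteq> K" "K \<subseteq> (\<Union>m\<in>F. V m)"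
  proof (rule compactE_image[OF K, of K V])
    show "K \<subseteq> (\<Union>m\<in>K. V m)" using V(2) by blast
  qed (use V(1) that in auto)
  have "(\<Union>m\<in>F. V m) \<subseteq> (\<Union>m\<in>F. B m)" using B(1) by blast
  then have "emeasure dv K \<le> emeasure dv (\<Union>m\<in>F. B m)" using F B(2) by (intro emeasure_mono) auto
  also have "\<dots> \<le> (\<Sum>m\<in>F. emeasure dv (B m))" using F B by (intro emeasure_subadditive_finite) auto
  also have "\<dots> < \<infinity>" using F(1) by induction (use B(3) in auto)
  finally show ?thesis .
qed

lemma compact_borel: "compact K \<Longrightarrow> K \<in> sets (borel :: 'm measure)"
  by (simp add: compact_imp_closed)

text \<open>A C^1 cut-off that equals 1 near \<open>m\<close> and is supported in one chart: a
  radial profile in coordinates, extended by zero. Such functions take the place of a partition of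
  unity.\<close>

lemma plateau_exists:
  obtains \<beta> V c T where "c \<in> A" "C1_manifold \<beta>" "\<And>x. 0 \<le> \<beta> x \<and> \<beta> x \<le> 1" "open V" "m \<in> V" "\<And>x. x \<in> V \<Longrightarrow> \<beta> x = 1"
    "compact T" "T \<subseteq> fst c" "\<And>x. x \<notin> T \<Longrightarrow> \<beta> x = 0"
proof -
  obtain c r where c: "c \<in> A" "m \<in> fst c" "r > 0" "cball (snd c m) r \<subseteq> img c" by (rule chart_neighbourhood)
  define k :: "real \<Rightarrow> real" where "k t = (max 0 t)\<^sup>2" for t
  define k' :: "real \<Rightarrow> real" where "k' t = 2 * max 0 t" for t
  have k: "(k has_real_derivative k' t) (at t)" for t
    unfolding k_def k'_def by (rule DERIV_max_0_square)
  have k'c: "continuous_on UNIV k'" unfolding k'_def by (intro continuous_intros)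
  \<comment> \<open>For \<open>t \<le> 1/2\<close> the value \<open>4 * k (1 - t)\<close> is at
    least 1, so the outer truncation vanishes and \<open>P t = 1\<close>. For
    \<open>t \<ge> 1\<close> the inner one vanishes, and \<open>k 1 = 1\<close> gives
    \<open>P t = 0\<close>.\<close>
  define P where "P t = 1 - k (1 - 4 * k (1 - t))" for t
  define P' where "P' t = - (k' (1 - 4 * k (1 - t)) * (4 * k' (1 - t)))" for t
  have P: "(P has_real_derivative P' t) (at t)" for t
  proof -
    have "((\<lambda>t. k (1 - t)) has_real_derivative k' (1 - t) * (- 1)) (at t)"
      by (rule DERIV_chain2[OF k]) (auto intro!: derivative_eq_intros)
    then have "((\<lambda>t. 1 - 4 * k (1 - t)) has_real_derivative 4 * k' (1 - t)) (at t)"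
      by (auto intro!: derivative_eq_intros)
    from DERIV_chain2[OF k this]
    show ?thesis unfolding P_def P'_def by (auto intro!: derivative_eq_intros)
  qed
  have kc: "continuous_on UNIV k" unfolding k_def by (intro continuous_intros)
  have P'c: "continuous_on UNIV P'"
    unfolding P'_def by (intro continuous_intros continuous_on_compose2[OF k'c] continuous_on_compose2[OF kc]) auto
  have Pb: "0 \<le> P t" "P t \<le> 1" for t
  proof -
    have "1 - 4 * k (1 - t) \<le> 1" by (simp add: k_def)
    then have "max 0 (1 - 4 * k (1 - t)) \<le> 1" by simp
    then have "(max 0 (1 - 4 * k (1 - t)))\<^sup>2 \<le> 1\<^sup>2" by (intro power_mono) auto
    then show "0 \<le> P t" by (simp add: P_def k_def[of "1 - 4 * k (1 - t)"])
    show "P t \<le> 1" by (simp add: P_def k_def[of "1 - 4 * k (1 - t)"])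
  qed
  have P0: "P t = 0" if "1 \<le> t" for t using that by (simp add: P_def k_def)
  have P1: "P t = 1" if "t \<le> 1/2" for t
  proof -
    have "(1/2)\<^sup>2 \<le> (1 - t)\<^sup>2" using that by (intro power_mono) auto
    then have "1 - 4 * k (1 - t) \<le> 0" using that by (simp add: k_def power2_eq_square)
    then show ?thesis by (simp add: P_def k_def[of "1 - 4 * k (1 - t)"])
  qed
  define b where "b x = P ((norm (x - snd c m))\<^sup>2 / r\<^sup>2)" for x
  have bC1: "C1_near b x" for x
  proof -
    have 1: "GDERIV (\<lambda>y. (norm (y - snd c m))\<^sup>2 / r\<^sup>2) y :> (1 / r\<^sup>2) *\<^sub>R (2 *\<^sub>R (y - snd c m))" for y
    proof -
      have "GDERIV (\<lambda>y. (norm (y - snd c m))\<^sup>2) y :> 2 *\<^sub>R (y - snd c m)"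
        by (rule GDERIV_translate[of "\<lambda>z. (norm z)\<^sup>2" "\<lambda>z. 2 *\<^sub>R z"]) (rule GDERIV_norm_square)
      then show ?thesis
        by (rule GDERIV_DERIV_compose[where g="\<lambda>t. t / r\<^sup>2"])
           (use c(3) in \<open>auto intro!: derivative_eq_intros simp: power2_eq_square power4_eq_xxxx\<close>)
    qed
    have "C1_near (\<lambda>y. (norm (y - snd c m))\<^sup>2 / r\<^sup>2) x"
      unfolding C1_near_def using 1
      by (intro exI[of _ UNIV] exI[of _ "\<lambda>y. (1 / r\<^sup>2) *\<^sub>R (2 *\<^sub>R (y - snd c m))"]) (auto intro!: continuous_intros)
    then show ?thesis unfolding b_def by (rule C1_near_compose[OF _ open_UNIV UNIV_I P'c P])
  qed
  have b0: "b x = 0" if "x \<notin> cball (snd c m) r" for x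
  proof -
    have "r \<le> norm (x - snd c m)" using that by (simp add: dist_norm norm_minus_commute)
    then have "r\<^sup>2 \<le> (norm (x - snd c m))\<^sup>2" using c by (intro power_mono) auto
    then show ?thesis unfolding b_def using c by (intro P0) simp
  qed
  note pf = push_forward[OF c(1) bC1 compact_cball c(4) b0]
  define V where "V = {m' \<in> fst c. snd c m' \<in> {x. (norm (x - snd c m))\<^sup>2 / r\<^sup>2 < 1/2}}"
  show ?thesis
  proof (rule that[of c "push_forward c b" V "chart_inv c ` cball (snd c m) r"])
    have "open {x. (norm (x - snd c m))\<^sup>2 / r\<^sup>2 < 1/2}" 
      using c(3) by (intro open_Collect_less continuous_intros) auto
    then show "open V" unfolding V_def by (rule chart_inv_image_open[OF c(1)])
    show "m \<in> V" using c by (simp add: V_def)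
    show "push_forward c b x = 1" if "x \<in> V" for x
      using that P1 by (auto simp: V_def push_forward_def b_def)
    show "0 \<le> push_forward c b x \<and> push_forward c b x \<le> 1" for x
      using Pb by (auto simp: push_forward_def b_def)
    show "push_forward c b x = 0" if "x \<notin> chart_inv c ` cball (snd c m) r" for x
      using pf(2) that by blast
    show "chart_inv c ` cball (snd c m) r \<subseteq> fst c" using c by auto
  qed (use c pf in auto)
qed

lemma grad_measurable:
  assumes u: "C1_manifold u" and c: "c \<in> A"
  shows "grad g u c \<in> borel_measurable (restrict_space borel (fst c \<inter> \<Omega>))"
  by (intro borel_measurable_continuous_on_restrict continuous_on_subset[OF grad_chart_cont[OF u c]]) auto

lemma g_inner_grad_zero_outside:
  assumes X: "vector_field_on A \<Omega> X" and u: "C1_manifold u" and m: "m \<in> \<Omega>" "m \<notin> T" and T: "closed T" "\<And>y. y \<notin> T \<Longrightarrow> u y = 0"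
  shows "g_inner A g X (grad g u) m = 0"
  using g_inner_grad[OF X u chart_at m(1)] cgrad_zero_outside[OF chart_at T m(2)] by simp

text \<open>The norm of the gradient is continuous and vanishes off the support of \<open>u\<close>,
  a compact set of finite volume. Finiteness of the energy is what later permits terms to be
  absorbed and infinite values to be excluded.\<close>

lemma p_energy_finite:
  assumes u: "u \<in> C01 A \<Omega>" and p: "p > 0"
  shows "(\<integral>\<^sup>+m\<in>\<Omega>. ennreal (g_norm A g (grad g u) m powr p) \<partial>dv) < \<infinity>"
proof -
  have u1: "C1_manifold u" and us: "compact_support_in u \<Omega>" using u by (auto simp: C01_iff)
  define K where "K = closure {x. u x \<noteq> 0}"
  have K: "compact K" "K \<subseteq> \<Omega>" using us by (auto simp: compact_support_in_def K_def)
  have u0: "u y = 0" if "y \<notin> K" for y using that closure_subset[of "{x. u x \<noteq> 0}"] by (auto simp: K_def)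
  have c: "continuous_on UNIV (g_norm A g (grad g u))" by (rule g_norm_grad_cont[OF u1])
  have "continuous_on K (\<lambda>m. g_norm A g (grad g u) m)" using c by (rule continuous_on_subset) auto
  then obtain M where M: "M > 0" "\<And>m. m \<in> K \<Longrightarrow> g_norm A g (grad g u) m \<le> M" using compact_upper_bound[OF K(1)] by blast
  have z: "g_norm A g (grad g u) m = 0" if "m \<notin> K" for m
  proof -
    have "g_inner A g (grad g u) (grad g u) m = 0"
    proof (rule g_inner_grad_zero_outside[OF grad_vector_field[OF u1, of UNIV] u1 UNIV_I that])
      show "closed K" by (simp add: K_def)
    qed (rule u0)
    then show ?thesis by (simp add: g_norm_def)
  qed
  have "(\<integral>\<^sup>+m\<in>\<Omega>. ennreal (g_norm A g (grad g u) m powr p) \<partial>dv) \<le> (\<integral>\<^sup>+m. ennreal (M powr p) * indicator K m \<partial>dv)"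
  proof (rule nn_integral_mono)
    fix m
    show "ennreal (g_norm A g (grad g u) m powr p) * indicator \<Omega> m \<le> ennreal (M powr p) * indicator K m"
      using M z[of m] p by (cases "m \<in> K") (auto simp: indicator_def intro!: ennreal_leI powr_mono2)
  qed
  also have "\<dots> = ennreal (M powr p) * emeasure dv K" using compact_borel[OF K(1)] by (subst nn_integral_cmult_indicator) auto
  also have "\<dots> < \<infinity>" using emeasure_compact_manifold[OF K(1)] by (simp add: ennreal_mult_less_top)
  finally show ?thesis .
qed

lemma indicator_measurable_dv:
  fixes f :: "'m \<Rightarrow> real"
  assumes "\<Omega> \<in> sets borel" "f \<in> borel_measurable (restrict_space borel \<Omega>)"
  shows "(\<lambda>m. indicator \<Omega> m * f m) \<in> borel_measurable dv"
  using assms by (subst (asm) borel_measurable_restrict_space_iff) auto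

end

section \<open>The superharmonicity inequality with a Sobolev function in the denominator\<close>

locale p_superharmonic_function = riemannian_volume_space A g dv
  for A :: "('m::{t2_space, second_countable_topology}, 'n::finite) chart set" and g :: "('m, 'n) metric" and dv :: "'m measure" +
  fixes \<Omega> :: "'m set" and \<rho> :: "'m \<Rightarrow> real" and X :: "('m, 'n) vfield" and p :: real
  assumes \<Omega>: "open \<Omega>" and p: "p > 1" and W: "W1p_loc A g dv p \<Omega> \<rho> X"
    and \<rho>_nonneg: "AE x in dv. x \<in> \<Omega> \<longrightarrow> \<rho> x \<ge> 0"
    and super: "p_superharmonic A g dv p \<Omega> X"
begin

abbreviation N :: "'m \<Rightarrow> real" where "N m \<equiv> g_norm A g X m"

text \<open>The weak form of \<open>- \<Delta>\<^sub>p \<rho> \<ge> 0\<close> tested with \<open>w / (\<rho> + \<epsilon>)\<^sup>p\<^sup>-\<^sup>1\<close>.\<close>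

definition tested :: "real \<Rightarrow> ('m \<Rightarrow> real) \<Rightarrow> 'm \<Rightarrow> real" where
  "tested \<epsilon> w m = N m powr (p - 2) * (g_inner A g X (grad g w) m * (\<rho> m + \<epsilon>) powr (1 - p) -
     (p - 1) * w m * (\<rho> m + \<epsilon>) powr (- p) * (N m)\<^sup>2)"

lemma wg: "has_weak_gradient A g dv \<Omega> \<rho> X" and Np: "Lp_loc dv p \<Omega> (g_norm A g X)"
  using W by (auto simp: W1p_loc_def)

lemma X_field: "vector_field_on A \<Omega> X"
  using wg by (simp add: has_weak_gradient_def)

lemma \<Omega>_borel[measurable]: "\<Omega> \<in> sets borel" using \<Omega> by auto

lemma N_measurable: "N \<in> borel_measurable (restrict_space borel \<Omega>)"
  and \<rho>_measurable: "\<rho> \<in> borel_measurable (restrict_space borel \<Omega>)"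
  using W by (auto simp: W1p_loc_def Lp_loc_def)

lemma inner_grad_measurable:
  assumes w: "C1_manifold w"
  shows "g_inner A g X (grad g w) \<in> borel_measurable (restrict_space borel \<Omega>)"
  using wg by (intro g_inner_measurable X_field grad_vector_field w grad_measurable) (auto simp: has_weak_gradient_def)

lemma C1_measurable: "C1_manifold w \<Longrightarrow> w \<in> borel_measurable (restrict_space borel \<Omega>)"
  by (intro borel_measurable_continuous_on_restrict continuous_on_subset[OF C1_manifold_cont]) auto

lemma tested_measurable:
  assumes w: "C1_manifold w" shows "tested \<epsilon> w \<in> borel_measurable (restrict_space borel \<Omega>)"
proof -
  note [measurable] = N_measurable \<rho>_measurable inner_grad_measurable[OF w] C1_measurable[OF w]
  show ?thesis unfolding tested_def by measurable
qed

lemma N_powr_finite: "compact K \<Longrightarrow> K \<subseteq> \<Omega> \<Longrightarrow> (\<integral>\<^sup>+m\<in>K. ennreal (N m powr p) \<partial>dv) < \<infinity>"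
  using Np by (simp add: Lp_loc_def)

text \<open>With the mollified functions \<open>F k\<close> in place of \<rho>, the quotient
  \<open>\<phi> k\<close> is an admissible test function, and its weak inequality says that the
  integral of \<open>S k\<close> is nonnegative. The integrands \<open>S k\<close> converge to
  \<open>tested \<epsilon> w\<close> almost everywhere, under majorants that vary with
  \<open>k\<close>. Integrability of the limit is part of the outcome.\<close>

lemma tested_integral_nonneg_chart:
  assumes w: "C1_manifold w" "\<And>m. 0 \<le> w m" and c: "c \<in> A" and T: "compact T" "T \<subseteq> fst c \<inter> \<Omega>" "\<And>m. m \<notin> T \<Longrightarrow> w m = 0"
    and \<epsilon>: "\<epsilon> > 0"
  shows "set_integrable dv \<Omega> (tested \<epsilon> w)" "0 \<le> (LINT m:\<Omega>|dv. tested \<epsilon> w m)"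
proof -
  let ?U = "snd c ` (fst c \<inter> \<Omega>)"
  define K where "K = snd c ` T"
  define f where "f x = \<rho> (chart_inv c x)" for x
  define G where "G x = g c (chart_inv c x) *v X c (chart_inv c x)" for x
  have U: "open ?U" using \<Omega> c by (intro chart_image_open) (auto simp: chart_open)
  have wgc: "weak_gradient ?U f G" unfolding f_def[abs_def] G_def[abs_def] by (rule weak_gradient_chart(1)[OF \<Omega> wg c])
  have Gp: "locally_integrable_on (\<lambda>x. norm (G x) powr p) ?U"
    unfolding G_def by (rule weak_gradient_chart(2)[OF \<Omega> wg c Np]) (use p in auto)
  have K: "compact K" "K \<subseteq> ?U" "K \<subseteq> img c"
    unfolding K_def using T chart_cont(1)[OF c] by (auto intro!: compact_continuous_image intro: continuous_on_subset)
  have TK: "chart_inv c ` K = T" unfolding K_def using T c by (force simp: image_iff)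
  have Tb[measurable]: "T \<in> sets borel" using compact_borel[OF T(1)] .
  have Tc: "closed T" using T by (simp add: compact_imp_closed)
  obtain F DF H where F: "\<And>k x. GDERIV (F k) x :> DF k x" "\<And>k. continuous_on UNIV (DF k)"
    and H: "\<And>k. integrable lborel (H k)"
    and lim: "AE x in lborel. x \<in> K \<longrightarrow> (\<lambda>k. F k x) \<longlonglongrightarrow> f x"
      "AE x in lborel. x \<in> K \<longrightarrow> (\<lambda>k. DF k x) \<longlonglongrightarrow> G x"
      "AE x in lborel. x \<in> K \<longrightarrow> (\<lambda>k. H k x) \<longlonglongrightarrow> norm (G x) powr p"
    and le: "\<And>k x. x \<in> K \<Longrightarrow> norm (DF k x) powr p \<le> H k x"
    and L1: "(\<lambda>k. \<integral>\<^sup>+x. ennreal \<bar>H k x - norm (G x) powr p\<bar> * indicator K x \<partial>lborel) \<longlonglongrightarrow> 0"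
    and nn: "AE x in lborel. x \<in> ?U \<longrightarrow> 0 \<le> f x \<Longrightarrow> (\<forall>k x. 0 \<le> F k x)"
    by (rule weak_gradient_approx[OF U wgc K(1,2) less_imp_le[OF p] Gp]) (rule that; assumption)
  have "AE x in lborel. x \<in> ?U \<longrightarrow> 0 \<le> \<rho> (chart_inv c x)"
    by (subst AE_chart_iff[OF c, symmetric]) (use \<rho>_nonneg in \<open>auto elim: eventually_mono\<close>)
  \<comment> \<open>Hence \<open>F k x + \<epsilon>\<close> never falls below \<epsilon>, so the
    negative powers in \<open>E\<close> and \<open>E'\<close> are C^1 and bounded, uniformly in
    \<open>k\<close>.\<close>
  then have F0: "0 \<le> F k x" for k x using nn by (auto simp: f_def)
  have Fc: "continuous_on UNIV (F k)" for k using F(1) by (rule continuous_on_GDERIV)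
  have lim_dv: "AE m in dv. m \<in> T \<longrightarrow> (\<lambda>k. F k (snd c m)) \<longlonglongrightarrow> \<rho> m \<and> (\<lambda>k. DF k (snd c m)) \<longlonglongrightarrow> G (snd c m)
      \<and> (\<lambda>k. H k (snd c m)) \<longlonglongrightarrow> norm (G (snd c m)) powr p"
  proof (subst AE_chart_iff[OF c])
    show "T \<subseteq> fst c" using T by auto
    have si: "snd c (chart_inv c x) = x" if "x \<in> K" for x using K(3) that c by auto
    show "AE x in lborel. x \<in> snd c ` T \<longrightarrow> (\<lambda>k. F k (snd c (chart_inv c x))) \<longlonglongrightarrow> \<rho> (chart_inv c x) \<and>
      (\<lambda>k. DF k (snd c (chart_inv c x))) \<longlonglongrightarrow> G (snd c (chart_inv c x)) \<and>
      (\<lambda>k. H k (snd c (chart_inv c x))) \<longlonglongrightarrow> norm (G (snd c (chart_inv c x))) powr p"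
      using lim unfolding K_def[symmetric] by eventually_elim (auto simp: si f_def)
  qed
  define E where "E k x = (F k x + \<epsilon>) powr (1 - p)" for k x
  define E' where "E' k x = (1 - p) * (F k x + \<epsilon>) powr (- p)" for k x
  define b where "b k x = w (chart_inv c x) * E k x" for k x
  have EC1: "GDERIV (E k) x :> E' k x *\<^sub>R DF k x" "C1_near (E k) x" for k x
  proof -
    have D: "((\<lambda>t. (t + \<epsilon>) powr (1 - p)) has_real_derivative (1 - p) * (t + \<epsilon>) powr (- p)) (at t)" if "t \<in> {-\<epsilon><..}" for t
      using that by (auto intro!: derivative_eq_intros)
    show "GDERIV (E k) x :> E' k x *\<^sub>R DF k x"
      unfolding E_def[abs_def] E'_def using F0[of k x] \<epsilon> by (intro GDERIV_DERIV_compose[OF F(1) D]) auto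
    have "C1_near (F k) x" unfolding C1_near_def using F by blast
    then show "C1_near (E k) x" unfolding E_def[abs_def]
    proof (rule C1_near_compose[OF _ _ _ _ D])
      show "F k x \<in> {-\<epsilon><..}" using F0[of k x] \<epsilon> by simp
      show "continuous_on {-\<epsilon><..} (\<lambda>t. (1 - p) * (t + \<epsilon>) powr (- p))" by (intro continuous_intros) auto
    qed auto
  qed
  define \<phi> where "\<phi> k = push_forward c (b k)" for k
  have wC1: "C1_near (\<lambda>x. w (chart_inv c x)) x" if "x \<in> img c" for x
    using w(1) c that unfolding C1_manifold_def by (force simp: o_def)
  have pf: "C1_manifold (\<phi> k)" "{m. \<phi> k m \<noteq> 0} \<subseteq> T" for k
  proof -
    have "C1_near (b k) x" if "x \<in> img c" for x
      unfolding b_def by (rule C1_near_mult[OF wC1[OF that] EC1(2)])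
    moreover have "b k x = 0" if x: "x \<in> img c" "x \<notin> K" for x
    proof -
      have "chart_inv c x \<notin> T" using x c unfolding K_def by (metis chart_inv(2) imageI)
      then show ?thesis using T(3) by (simp add: b_def)
    qed
    ultimately show "C1_manifold (\<phi> k)" "{m. \<phi> k m \<noteq> 0} \<subseteq> T"
      using push_forward(1,2)[OF c _ K(1,3), of "b k"] unfolding \<phi>_def TK by auto
  qed
  have \<phi>nn: "0 \<le> \<phi> k m" for k m using w(2) by (auto simp: \<phi>_def push_forward_def b_def E_def)
  have \<phi>C01: "\<phi> k \<in> C01 A \<Omega>" for k
    unfolding C01_iff using pf T by (auto intro: compact_support_inI)
  define S where "S k m = N m powr (p - 2) * g_inner A g X (grad g (\<phi> k)) m" for k m
  have S_nonneg: "0 \<le> (LINT m:\<Omega>|dv. S k m)" for k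
    using super \<phi>C01[of k] \<phi>nn[of k] unfolding p_superharmonic_def S_def by blast
  have S_out: "S k m = 0" "tested \<epsilon> w m = 0" if m: "m \<in> \<Omega>" "m \<notin> T" for k m
  proof -
    have "g_inner A g X (grad g (\<phi> k)) m = 0"
      by (rule g_inner_grad_zero_outside[OF X_field pf(1) m Tc]) (use pf(2) in blast)
    then show "S k m = 0" by (simp add: S_def)
    have "g_inner A g X (grad g w) m = 0" by (rule g_inner_grad_zero_outside[OF X_field w(1) m Tc T(3)])
    then show "tested \<epsilon> w m = 0" using T(3)[OF m(2)] by (simp add: tested_def)
  qed
  have S_in: "S k m = N m powr (p - 2) * (E k (snd c m) * (X c m \<bullet> cgrad c w m) + w m * E' k (snd c m) * (X c m \<bullet> DF k (snd c m)))"
    if m: "m \<in> T" for k m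
  proof -
    have mc: "m \<in> fst c" "m \<in> \<Omega>" using T m by auto
    have "GDERIV (\<lambda>x. w (chart_inv c x)) (snd c m) :> cgrad c w m"
      using GDERIV_cgrad[OF w(1) c mc(1)] by (simp add: o_def)
    from GDERIV_mult[OF this EC1(1)]
    have "GDERIV (b k) (snd c m) :> w m *\<^sub>R (E' k (snd c m) *\<^sub>R DF k (snd c m)) + E k (snd c m) *\<^sub>R cgrad c w m"
      using mc c by (simp add: b_def[abs_def])
    then have "GDERIV (\<phi> k \<circ> chart_inv c) (snd c m) :> w m *\<^sub>R (E' k (snd c m) *\<^sub>R DF k (snd c m)) + E k (snd c m) *\<^sub>R cgrad c w m"
      unfolding gderiv_def
      by (rule has_derivative_transform_within_open[of _ _ _ _ "img c"]) (use mc c in \<open>auto simp: chart_open \<phi>_def push_forward_def\<close>)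
    then have "cgrad c (\<phi> k) m = w m *\<^sub>R (E' k (snd c m) *\<^sub>R DF k (snd c m)) + E k (snd c m) *\<^sub>R cgrad c w m" by (rule cgrad_eq)
    then show ?thesis unfolding S_def g_inner_grad[OF X_field pf(1) c mc] by (simp add: inner_add_right algebra_simps)
  qed
  obtain C where C: "C > 0" "\<And>x v. x \<in> K \<Longrightarrow> norm v \<le> C * sqrt (v \<bullet> (g c (chart_inv c x) *v v))"
    "\<And>x v. x \<in> K \<Longrightarrow> norm (g c (chart_inv c x) *v v) \<le> C * sqrt (v \<bullet> (g c (chart_inv c x) *v v))"
    "\<And>x. x \<in> K \<Longrightarrow> weight c x \<le> C" using chart_bounds[OF c K(1,3)] by metis
  \<comment> \<open>\<open>G\<close> is the lowered field, so pairing it with \<open>X\<close> in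
    coordinates gives the square of the Riemannian norm. This is how the quadratic term of
    \<open>tested\<close> arises from the limit of \<open>DF k\<close>.\<close>
  have XN: "norm (X c m) \<le> C * N m" "norm (G (snd c m)) \<le> C * N m" "X c m \<bullet> G (snd c m) = (N m)\<^sup>2" if m: "m \<in> T" for m
  proof -
    have mc: "m \<in> fst c" "m \<in> \<Omega>" "snd c m \<in> K" using T m by (auto simp: K_def)
    have Nm: "N m = sqrt (X c m \<bullet> (g c m *v X c m))" by (rule g_norm_chart[OF X_field c mc(1,2)])
    have ci: "chart_inv c (snd c m) = m" using mc c by simp
    show "norm (X c m) \<le> C * N m" "norm (G (snd c m)) \<le> C * N m"
      using C(2,3)[OF mc(3), of "X c m"] Nm by (simp_all add: ci G_def)
    show "X c m \<bullet> G (snd c m) = (N m)\<^sup>2"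
      unfolding g_norm_square g_inner_chart[OF X_field X_field c mc(1,2)] by (simp add: G_def ci)
  qed
  have "continuous_on T (\<lambda>m. norm (cgrad c w m))" using cgrad_cont[OF w(1) c] T by (auto intro!: continuous_intros intro: continuous_on_subset)
  then obtain M1 where M1: "M1 > 0" "\<And>m. m \<in> T \<Longrightarrow> norm (cgrad c w m) \<le> M1" using compact_upper_bound[OF T(1)] by metis
  have "continuous_on T w" using C1_manifold_cont[OF w(1)] by (rule continuous_on_subset) auto
  then obtain M2 where M2: "M2 > 0" "\<And>m. m \<in> T \<Longrightarrow> w m \<le> M2" using compact_upper_bound[OF T(1)] by metis
  \<comment> \<open>\<open>M1\<close> bounds the differential of \<open>w\<close> and
    \<open>M2\<close> bounds \<open>w\<close> on \<open>T\<close>; the powers of \<epsilon> bound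
    \<open>E\<close> and \<open>E'\<close>, and \<open>C\<close> compares norms. None of these
    depends on \<open>k\<close>.\<close>
  define Q where "Q = C * (\<epsilon> powr (1 - p) * M1 + M2 * ((p - 1) * \<epsilon> powr (- p)))"
  have Q: "Q \<ge> 0" using C M1 M2 p by (simp add: Q_def)
  have S_bound: "\<bar>S k m\<bar> \<le> Q * (1 + 2 * N m powr p + H k (snd c m))" if m: "m \<in> T" for k m
  proof -
    let ?x = "snd c m"
    have xK: "?x \<in> K" using m by (auto simp: K_def)
    have Eb: "0 \<le> E k ?x" "E k ?x \<le> \<epsilon> powr (1 - p)"
      using F0[of k ?x] \<epsilon> p by (auto simp: E_def intro!: powr_mono2')
    have E'b: "\<bar>E' k ?x\<bar> \<le> (p - 1) * \<epsilon> powr (- p)"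
    proof -
      have "(F k ?x + \<epsilon>) powr (- p) \<le> \<epsilon> powr (- p)" using F0[of k ?x] \<epsilon> p by (intro powr_mono2') auto
      then show ?thesis using p by (simp add: E'_def abs_mult mult_left_mono)
    qed
    have i1: "\<bar>X c m \<bullet> cgrad c w m\<bar> \<le> (C * N m) * M1"
      using XN(1)[OF m] M1(2)[OF m] C(1) by (intro order_trans[OF Cauchy_Schwarz_ineq2] mult_mono) auto
    have i2: "\<bar>X c m \<bullet> DF k ?x\<bar> \<le> (C * N m) * norm (DF k ?x)"
      using XN(1)[OF m] by (intro order_trans[OF Cauchy_Schwarz_ineq2] mult_right_mono) auto
    \<comment> \<open>This holds at zeros of \<open>N\<close> too, where
      \<open>0 powr (p - 2)\<close> is 0 also for exponents that are not positive.\<close>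
    have NN: "N m powr (p - 2) * N m = N m powr (p - 1)"
      using g_norm_nonneg[of X m] by (cases "N m = 0") (auto simp: powr_mult_base powr_diff power2_eq_square)
    have e1: "\<bar>E k ?x * (X c m \<bullet> cgrad c w m)\<bar> \<le> \<epsilon> powr (1 - p) * ((C * N m) * M1)"
      unfolding abs_mult using Eb i1 by (intro mult_mono) auto
    have e2: "\<bar>w m * E' k ?x * (X c m \<bullet> DF k ?x)\<bar> \<le> (M2 * ((p - 1) * \<epsilon> powr (- p))) * ((C * N m) * norm (DF k ?x))"
      unfolding abs_mult using w(2)[of m] M2 M2(2)[OF m] E'b i2 p by (intro mult_mono) auto
    have "\<bar>S k m\<bar> = N m powr (p - 2) * \<bar>E k ?x * (X c m \<bullet> cgrad c w m) + w m * E' k ?x * (X c m \<bullet> DF k ?x)\<bar>"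
      unfolding S_in[OF m] by (simp add: abs_mult)
    also have "\<dots> \<le> N m powr (p - 2) * (\<epsilon> powr (1 - p) * ((C * N m) * M1) + (M2 * ((p - 1) * \<epsilon> powr (- p))) * ((C * N m) * norm (DF k ?x)))"
      using e1 e2 by (intro mult_left_mono order_trans[OF abs_triangle_ineq] add_mono) auto
    also have "\<dots> = (C * (\<epsilon> powr (1 - p) * M1)) * N m powr (p - 1) + (C * (M2 * ((p - 1) * \<epsilon> powr (- p)))) * (N m powr (p - 1) * norm (DF k ?x))"
      unfolding NN[symmetric] by (simp add: algebra_simps)
    \<comment> \<open>A crude Young inequality without constants: the larger factor dominates. It
      replaces the product of \<open>N m powr (p - 1)\<close> and \<open>norm (DF k ?x)\<close> by a
      sum of p-th powers, the second of which lies below \<open>H k\<close>.\<close>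
    also have "\<dots> \<le> Q * (1 + N m powr p) + Q * (N m powr p + norm (DF k ?x) powr p)"
    proof (intro add_mono mult_mono)
      show "C * (\<epsilon> powr (1 - p) * M1) \<le> Q" "C * (M2 * ((p - 1) * \<epsilon> powr (- p))) \<le> Q"
        unfolding Q_def using C M1 M2 p by (auto intro!: mult_left_mono)
    qed (use Q p powr_minus_1_le powr_mult_le_add in auto)
    also have "\<dots> \<le> Q * (1 + N m powr p) + Q * (N m powr p + H k ?x)"
      using le[OF xK] Q by (intro add_left_mono mult_left_mono) auto
    also have "\<dots> = Q * (1 + 2 * N m powr p + H k ?x)" by (simp add: algebra_simps)
    finally show ?thesis .
  qed
  define Bk where "Bk k m = indicator T m * (Q * (1 + 2 * N m powr p + H k (snd c m)))" for k m
  define bb where "bb m = indicator T m * (Q * (1 + 2 * N m powr p + norm (G (snd c m)) powr p))" for m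
  have intN: "integrable dv (\<lambda>m. indicator T m * N m powr p)"
  proof (rule integrableI_bounded)
    have "(\<lambda>m. indicator \<Omega> m * N m powr p) \<in> borel_measurable dv"
      by (rule indicator_measurable_dv) (use N_measurable in measurable)
    then have "(\<lambda>m. indicator T m * (indicator \<Omega> m * N m powr p)) \<in> borel_measurable dv" by measurable
    also have "(\<lambda>m. indicator T m * (indicator \<Omega> m * N m powr p)) = (\<lambda>m. indicator T m * N m powr p)"
      using T by (auto simp: indicator_def fun_eq_iff)
    finally show "(\<lambda>m. indicator T m * N m powr p) \<in> borel_measurable dv" .
    have "(\<integral>\<^sup>+m. ennreal (norm (indicator T m * N m powr p)) \<partial>dv) = (\<integral>\<^sup>+m\<in>T. ennreal (N m powr p) \<partial>dv)"
      by (intro nn_integral_cong) (auto simp: indicator_def)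
    also have "\<dots> < \<infinity>" using T by (intro N_powr_finite) auto
    finally show "(\<integral>\<^sup>+m. ennreal (norm (indicator T m * N m powr p)) \<partial>dv) < \<infinity>" .
  qed
  have transfer_meas: "(\<lambda>m. indicator T m * h (snd c m)) \<in> borel_measurable dv"
    if h: "(\<lambda>x. indicator K x * h x) \<in> borel_measurable borel" for h :: "real ^ 'n \<Rightarrow> real"
  proof -
    have fb: "fst c \<in> sets borel" using chart_open(1)[OF c] by auto
    have "(\<lambda>m. if m \<in> fst c then snd c m else undefined) \<in> measurable borel borel"
      using fb chart_cont(1)[OF c] by (intro borel_measurable_continuous_on_if) auto
    from measurable_compose[OF this h]
    have "(\<lambda>m. indicator T m * (indicator K (if m \<in> fst c then snd c m else undefined) * h (if m \<in> fst c then snd c m else undefined))) \<in> borel_measurable borel"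
      by measurable
    also have "(\<lambda>m. indicator T m * (indicator K (if m \<in> fst c then snd c m else undefined) * h (if m \<in> fst c then snd c m else undefined))) = (\<lambda>m. indicator T m * h (snd c m))"
      using T by (auto simp: indicator_def fun_eq_iff K_def)
    finally show ?thesis by simp
  qed
  \<comment> \<open>The weight is at most \<open>C\<close> on \<open>K\<close>, so L^1 bounds for
    functions of the coordinates carry over to the manifold. Applied to the difference of the
    majorants, this turns their Lebesgue L^1 convergence into convergence with respect to
    \<open>dv\<close>.\<close>
  have transfer_le: "(\<integral>\<^sup>+m. ennreal \<bar>indicator T m * h (snd c m)\<bar> \<partial>dv) \<le> ennreal C * (\<integral>\<^sup>+x. ennreal \<bar>h x\<bar> * indicator K x \<partial>lborel)"
    if h: "(\<lambda>x. indicator K x * h x) \<in> borel_measurable borel" for h :: "real ^ 'n \<Rightarrow> real"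
  proof -
    have mh: "(\<lambda>m. ennreal \<bar>h (snd c m)\<bar> * indicator (chart_inv c ` K) m) \<in> borel_measurable borel"
    proof -
      have "(\<lambda>m. ennreal \<bar>indicator T m * h (snd c m)\<bar>) \<in> borel_measurable borel" using transfer_meas[OF h] by measurable
      also have "(\<lambda>m. ennreal \<bar>indicator T m * h (snd c m)\<bar>) = (\<lambda>m. ennreal \<bar>h (snd c m)\<bar> * indicator (chart_inv c ` K) m)"
        unfolding TK by (auto simp: indicator_def fun_eq_iff)
      finally show ?thesis .
    qed
    have "(\<integral>\<^sup>+m. ennreal \<bar>indicator T m * h (snd c m)\<bar> \<partial>dv) = (\<integral>\<^sup>+m\<in>chart_inv c ` K. ennreal \<bar>h (snd c m)\<bar> \<partial>dv)"
      unfolding TK by (intro nn_integral_cong) (auto simp: indicator_def)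
    also have "\<dots> = (\<integral>\<^sup>+x\<in>K. ennreal \<bar>h (snd c (chart_inv c x))\<bar> * ennreal (weight c x) \<partial>lborel)"
      by (rule nn_integral_chart_compact[OF c K(1,3) mh])
    also have "\<dots> \<le> (\<integral>\<^sup>+x. ennreal C * (ennreal \<bar>h x\<bar> * indicator K x) \<partial>lborel)"
    proof (rule nn_integral_mono)
      fix x
      show "ennreal \<bar>h (snd c (chart_inv c x))\<bar> * ennreal (weight c x) * indicator K x \<le> ennreal C * (ennreal \<bar>h x\<bar> * indicator K x)"
      proof (cases "x \<in> K")
        case True
        then have "snd c (chart_inv c x) = x" using K(3) c by auto
        then show ?thesis using True mult_left_mono[OF ennreal_leI[OF C(4)[OF True]], of "ennreal \<bar>h x\<bar>"] by (simp add: mult.commute)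
      qed simp
    qed
    also have "\<dots> = ennreal C * (\<integral>\<^sup>+x. ennreal \<bar>h x\<bar> * indicator K x \<partial>lborel)"
    proof (rule nn_integral_cmult)
      have "(\<lambda>x. ennreal \<bar>indicator K x * h x\<bar>) \<in> borel_measurable borel" using h by measurable
      also have "(\<lambda>x. ennreal \<bar>indicator K x * h x\<bar>) = (\<lambda>x. ennreal \<bar>h x\<bar> * indicator K x)" by (auto simp: indicator_def fun_eq_iff)
      finally show "(\<lambda>x. ennreal \<bar>h x\<bar> * indicator K x) \<in> borel_measurable lborel" by simp
    qed
    finally show ?thesis .
  qed
  have Kb[measurable]: "K \<in> sets borel" using K by (simp add: borel_compact)
  have mH: "(\<lambda>x. indicator K x * H k x) \<in> borel_measurable borel" for k using borel_measurable_integrable[OF H[of k]] by measurable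
  have iGK: "integrable lborel (\<lambda>x. indicator K x *\<^sub>R norm (G x) powr p)"
    using Gp K unfolding locally_integrable_on_def set_integrable_def by blast
  have mG: "(\<lambda>x. indicator K x * norm (G x) powr p) \<in> borel_measurable borel"
    using borel_measurable_integrable[OF iGK] by simp
  have fin_abs: "(\<integral>\<^sup>+x. ennreal \<bar>h x\<bar> * indicator K x \<partial>lborel) < \<infinity>" if "integrable lborel (\<lambda>x. indicator K x *\<^sub>R h x)" for h :: "real ^ 'n \<Rightarrow> real"
  proof -
    have "(\<integral>\<^sup>+x. ennreal (norm (indicator K x *\<^sub>R h x)) \<partial>lborel) < \<infinity>" using that by (simp add: integrable_iff_bounded)
    also have "(\<integral>\<^sup>+x. ennreal (norm (indicator K x *\<^sub>R h x)) \<partial>lborel) = (\<integral>\<^sup>+x. ennreal \<bar>h x\<bar> * indicator K x \<partial>lborel)"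
      by (intro nn_integral_cong) (auto simp: indicator_def)
    finally show ?thesis .
  qed
  have transfer_int: "integrable dv (\<lambda>m. indicator T m * h (snd c m))" if h: "integrable lborel (\<lambda>x. indicator K x *\<^sub>R h x)" for h :: "real ^ 'n \<Rightarrow> real"
  proof (rule integrableI_bounded)
    have mh: "(\<lambda>x. indicator K x * h x) \<in> borel_measurable borel" using borel_measurable_integrable[OF h] by simp
    show "(\<lambda>m. indicator T m * h (snd c m)) \<in> borel_measurable dv" by (rule transfer_meas[OF mh])
    have "ennreal C * (\<integral>\<^sup>+x. ennreal \<bar>h x\<bar> * indicator K x \<partial>lborel) < \<infinity>" using fin_abs[OF h] by (simp add: ennreal_mult_less_top)
    then show "(\<integral>\<^sup>+m. ennreal (norm (indicator T m * h (snd c m))) \<partial>dv) < \<infinity>"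
      using transfer_le[OF mh] by simp
  qed
  have iHK: "integrable lborel (\<lambda>x. indicator K x *\<^sub>R H k x)" for k using H by (intro integrable_mult_indicator) auto
  have iT: "integrable dv (indicator T :: 'm \<Rightarrow> real)" using emeasure_compact_manifold[OF T(1)] by (intro integrable_real_indicator) auto
  define a where "a m = indicator \<Omega> m *\<^sub>R tested \<epsilon> w m" for m
  have a: "a m = indicator T m * tested \<epsilon> w m" for m using S_out(2)[of m] T(2) by (auto simp: a_def indicator_def)
  have Sk: "indicator \<Omega> m *\<^sub>R S k m = indicator T m * S k m" for k m using S_out(1)[of m k] T(2) by (auto simp: indicator_def)
  have conc: "integrable dv a" "(\<lambda>k. \<integral>m. indicator \<Omega> m *\<^sub>R S k m \<partial>dv) \<longlonglongrightarrow> (\<integral>m. a m \<partial>dv)"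
  proof -
    have m1: "(\<lambda>m. indicator \<Omega> m *\<^sub>R S k m) \<in> borel_measurable dv" for k
    proof -
      have "S k \<in> borel_measurable (restrict_space borel \<Omega>)"
        unfolding S_def using N_measurable inner_grad_measurable[OF pf(1)[of k]] by measurable
      from indicator_measurable_dv[OF \<Omega>_borel this] show ?thesis by simp
    qed
    have m2: "a \<in> borel_measurable dv"
      using indicator_measurable_dv[OF \<Omega>_borel tested_measurable[OF w(1), of \<epsilon>]] by (simp add: a_def[abs_def])
    have eqB: "Bk k = (\<lambda>m. Q * (indicator T m + 2 * (indicator T m * N m powr p) + indicator T m * H k (snd c m)))" for k
      by (auto simp: Bk_def indicator_def fun_eq_iff)
    have eqb: "bb = (\<lambda>m. Q * (indicator T m + 2 * (indicator T m * N m powr p) + indicator T m * norm (G (snd c m)) powr p))"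
      by (auto simp: bb_def indicator_def fun_eq_iff)
    have i1: "integrable dv (Bk k)" for k
      unfolding eqB using iT intN transfer_int[OF iHK] by (intro integrable_mult_right Bochner_Integration.integrable_add) auto
    have i2: "integrable dv bb"
      unfolding eqb using iT intN transfer_int[OF iGK] by (intro integrable_mult_right Bochner_Integration.integrable_add) auto
    have l1: "AE m in dv. (\<lambda>k. indicator \<Omega> m *\<^sub>R S k m) \<longlonglongrightarrow> a m"
      using lim_dv \<rho>_nonneg
    proof eventually_elim
      case (elim m)
      show ?case
      proof (cases "m \<in> T")
        case True
        have \<rho>m: "0 \<le> \<rho> m" using elim True T by auto
        have lF: "(\<lambda>k. F k (snd c m) + \<epsilon>) \<longlonglongrightarrow> \<rho> m + \<epsilon>" using elim True by (intro tendsto_intros) auto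
        have lE: "(\<lambda>k. E k (snd c m)) \<longlonglongrightarrow> (\<rho> m + \<epsilon>) powr (1 - p)"
          unfolding E_def using \<rho>m \<epsilon> by (intro tendsto_powr lF tendsto_const) auto
        have lE': "(\<lambda>k. E' k (snd c m)) \<longlonglongrightarrow> (1 - p) * (\<rho> m + \<epsilon>) powr (- p)"
          unfolding E'_def using \<rho>m \<epsilon> by (intro tendsto_mult tendsto_powr lF tendsto_const) auto
        have lD: "(\<lambda>k. DF k (snd c m)) \<longlonglongrightarrow> G (snd c m)" using elim True by auto
        have "(\<lambda>k. S k m) \<longlonglongrightarrow> N m powr (p - 2) * ((\<rho> m + \<epsilon>) powr (1 - p) * (X c m \<bullet> cgrad c w m)
            + w m * ((1 - p) * (\<rho> m + \<epsilon>) powr (- p)) * (X c m \<bullet> G (snd c m)))"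
          unfolding S_in[OF True] by (intro tendsto_intros lE lE' lD)
        also have "N m powr (p - 2) * ((\<rho> m + \<epsilon>) powr (1 - p) * (X c m \<bullet> cgrad c w m)
            + w m * ((1 - p) * (\<rho> m + \<epsilon>) powr (- p)) * (X c m \<bullet> G (snd c m))) = tested \<epsilon> w m"
        proof -
          have "m \<in> fst c" "m \<in> \<Omega>" using True T(2) by auto
          then show ?thesis unfolding tested_def XN(3)[OF True] g_inner_grad[OF X_field w(1) c \<open>m \<in> fst c\<close> \<open>m \<in> \<Omega>\<close>]
            by (simp add: algebra_simps)
        qed
        finally show ?thesis using True by (simp only: a Sk) simp
      qed (simp only: a Sk, simp)
    qed
    have l2: "AE m in dv. (\<lambda>k. Bk k m) \<longlonglongrightarrow> bb m"
      using lim_dv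
    proof eventually_elim
      case (elim m)
      show ?case
        unfolding Bk_def bb_def using elim by (cases "m \<in> T") (auto intro!: tendsto_intros)
    qed
    have bd: "AE m in dv. norm (indicator \<Omega> m *\<^sub>R S k m) \<le> Bk k m" for k
      unfolding Sk using S_bound[of _ k] by (intro AE_I2) (auto simp: Bk_def indicator_def)
    have L: "(\<lambda>k. \<integral>\<^sup>+m. \<bar>Bk k m - bb m\<bar> \<partial>dv) \<longlonglongrightarrow> 0"
    proof (rule tendsto_sandwich[OF _ _ tendsto_const]; (intro always_eventually allI)?)
      fix k
      have md: "(\<lambda>x. indicator K x * (Q * (H k x - norm (G x) powr p))) \<in> borel_measurable borel"
      proof -
        have "(\<lambda>x. Q * (indicator K x * H k x - indicator K x * norm (G x) powr p)) \<in> borel_measurable borel"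
          using mH[of k] mG by measurable
        then show ?thesis by (simp add: algebra_simps)
      qed
      have "(\<integral>\<^sup>+m. \<bar>Bk k m - bb m\<bar> \<partial>dv) = (\<integral>\<^sup>+m. ennreal \<bar>indicator T m * (Q * (H k (snd c m) - norm (G (snd c m)) powr p))\<bar> \<partial>dv)"
        by (intro nn_integral_cong) (auto simp: Bk_def bb_def indicator_def algebra_simps)
      also have "\<dots> \<le> ennreal C * (\<integral>\<^sup>+x. ennreal \<bar>Q * (H k x - norm (G x) powr p)\<bar> * indicator K x \<partial>lborel)"
        by (rule transfer_le[OF md])
      also have "(\<integral>\<^sup>+x. ennreal \<bar>Q * (H k x - norm (G x) powr p)\<bar> * indicator K x \<partial>lborel)
         = (\<integral>\<^sup>+x. ennreal Q * (ennreal \<bar>H k x - norm (G x) powr p\<bar> * indicator K x) \<partial>lborel)"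
        using Q by (intro nn_integral_cong) (auto simp: abs_mult ennreal_mult mult.assoc)
      also have "\<dots> = ennreal Q * (\<integral>\<^sup>+x. ennreal \<bar>H k x - norm (G x) powr p\<bar> * indicator K x \<partial>lborel)"
      proof (rule nn_integral_cmult)
        have "(\<lambda>x. ennreal \<bar>indicator K x * H k x - indicator K x * norm (G x) powr p\<bar>) \<in> borel_measurable borel"
          using mH[of k] mG by measurable
        also have "(\<lambda>x. ennreal \<bar>indicator K x * H k x - indicator K x * norm (G x) powr p\<bar>) = (\<lambda>x. ennreal \<bar>H k x - norm (G x) powr p\<bar> * indicator K x)"
          by (auto simp: indicator_def fun_eq_iff)
        finally show "(\<lambda>x. ennreal \<bar>H k x - norm (G x) powr p\<bar> * indicator K x) \<in> borel_measurable lborel" by simp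
      qed
      finally show "(\<integral>\<^sup>+m. \<bar>Bk k m - bb m\<bar> \<partial>dv) \<le> ennreal C * (ennreal Q * (\<integral>\<^sup>+x. ennreal \<bar>H k x - norm (G x) powr p\<bar> * indicator K x \<partial>lborel))" .
    next
      have "(\<lambda>k. ennreal C * (ennreal Q * (\<integral>\<^sup>+x. ennreal \<bar>H k x - norm (G x) powr p\<bar> * indicator K x \<partial>lborel))) \<longlonglongrightarrow> ennreal C * (ennreal Q * 0)"
        using L1 by (intro ennreal_tendsto_cmult) auto
      then show "(\<lambda>k. ennreal C * (ennreal Q * (\<integral>\<^sup>+x. ennreal \<bar>H k x - norm (G x) powr p\<bar> * indicator K x \<partial>lborel))) \<longlonglongrightarrow> 0" by simp
    qed auto
    note gd = tendsto_integral_generalized_dominated[OF m1 m2 i1 i2 l1 l2 bd L]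
    show "integrable dv a" by (rule gd(1))
    show "(\<lambda>k. \<integral>m. indicator \<Omega> m *\<^sub>R S k m \<partial>dv) \<longlonglongrightarrow> (\<integral>m. a m \<partial>dv)" by (rule gd(3))
  qed
  show "set_integrable dv \<Omega> (tested \<epsilon> w)" using conc(1) by (simp add: a_def[abs_def] set_integrable_def)
  have "0 \<le> (\<integral>m. a m \<partial>dv)"
    by (rule LIMSEQ_le_const[OF conc(2)]) (use S_nonneg in \<open>auto simp: set_lebesgue_integral_def\<close>)
  then show "0 \<le> (LINT m:\<Omega>|dv. tested \<epsilon> w m)" by (simp add: a_def[abs_def] set_lebesgue_integral_def)
qed

end

section \<open>Hardy's inequality\<close>

lemma epow_ennreal_pos:
  assumes "0 < x" shows "epow (ennreal x) q = ennreal (x powr q)"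
proof -
  have "ennreal x \<noteq> 0" using assms by (simp add: ennreal_eq_0_iff)
  then show ?thesis using assms unfolding epow_def by simp
qed

lemma epow_ennreal:
  assumes "0 \<le> x" "0 < q" shows "epow (ennreal x) q = ennreal (x powr q)"
proof (cases "x = 0")
  case True then show ?thesis using assms(2) unfolding epow_def by simp
next
  case False then show ?thesis using assms(1) by (intro epow_ennreal_pos) simp
qed

lemma epow_measurable[measurable (raw)]:
  assumes [measurable]: "f \<in> borel_measurable M"
  shows "(\<lambda>x. epow (f x) q) \<in> borel_measurable M"
proof -
  have 1: "{x \<in> space M. f x = 0} \<in> sets M" "{x \<in> space M. f x = \<infinity>} \<in> sets M" by measurable
  show ?thesis unfolding epow_def
    by (intro measurable_If measurable_const 1) measurable
qed

lemma equot_measurable[measurable (raw)]: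
  assumes [measurable]: "f \<in> borel_measurable M" "h \<in> borel_measurable M"
  shows "(\<lambda>x. equot (f x) (h x)) \<in> borel_measurable M"
proof -
  have "{x \<in> space M. h x = 0} = h -` {0} \<inter> space M" by auto
  then have 1: "{x \<in> space M. h x = 0} \<in> sets M" using measurable_sets[OF assms(2), of "{0}"] by simp
  show ?thesis unfolding equot_def
    by (intro measurable_If measurable_const 1) measurable
qed

text \<open>The weighted Young inequality, applied to \<open>f x / F\<close> and
  \<open>h x / H\<close> and integrated, gives the total weight
  \<open>\<alpha> + \<beta> = 1\<close>. If one of the two integrals vanishes, normalising is
  impossible, but then the product is zero almost everywhere.\<close>

lemma Holder_nn_integral:
  assumes [measurable]: "f \<in> borel_measurable M" "h \<in> borel_measurable M"
    and nn: "\<And>x. 0 \<le> f x" "\<And>x. 0 \<le> h x"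
    and F: "(\<integral>\<^sup>+x. ennreal (f x) \<partial>M) = ennreal F" "0 \<le> F" and H: "(\<integral>\<^sup>+x. ennreal (h x) \<partial>M) = ennreal H" "0 \<le> H"
    and \<alpha>: "0 < \<alpha>" "0 < \<beta>" "\<alpha> + \<beta> = (1::real)"
  shows "(\<integral>\<^sup>+x. ennreal (f x powr \<alpha> * h x powr \<beta>) \<partial>M) \<le> ennreal (F powr \<alpha> * H powr \<beta>)"
proof (cases "F = 0 \<or> H = 0")
  case True
  have "AE x in M. f x = 0 \<or> h x = 0"
  proof (cases "F = 0")
    case True
    then have "(\<integral>\<^sup>+x. ennreal (f x) \<partial>M) = 0" using F by simp
    then have "AE x in M. ennreal (f x) = 0" by (subst (asm) nn_integral_0_iff_AE) auto
    then show ?thesis by eventually_elim (use nn in \<open>auto simp: ennreal_eq_0_iff intro: antisym\<close>)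
  next
    case False
    then have "(\<integral>\<^sup>+x. ennreal (h x) \<partial>M) = 0" using H \<open>F = 0 \<or> H = 0\<close> by simp
    then have "AE x in M. ennreal (h x) = 0" by (subst (asm) nn_integral_0_iff_AE) auto
    then show ?thesis by eventually_elim (use nn in \<open>auto simp: ennreal_eq_0_iff intro: antisym\<close>)
  qed
  then have "AE x in M. ennreal (f x powr \<alpha> * h x powr \<beta>) = 0" by eventually_elim auto
  then have "(\<integral>\<^sup>+x. ennreal (f x powr \<alpha> * h x powr \<beta>) \<partial>M) = 0" by (subst nn_integral_0_iff_AE) auto
  then show ?thesis by simp
next
  case False
  then have pos: "F > 0" "H > 0" using F H by auto
  define K where "K = F powr \<alpha> * H powr \<beta>"
  have K: "K \<ge> 0" by (simp add: K_def)
  have "(\<integral>\<^sup>+x. ennreal (f x powr \<alpha> * h x powr \<beta>) \<partial>M) \<le> (\<integral>\<^sup>+x. ennreal (K * \<alpha> / F) * ennreal (f x) + ennreal (K * \<beta> / H) * ennreal (h x) \<partial>M)"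
  proof (rule nn_integral_mono)
    fix x
    have "f x powr \<alpha> * h x powr \<beta> \<le> K * \<alpha> / F * f x + K * \<beta> / H * h x"
    proof (cases "f x = 0 \<or> h x = 0")
      case True then show ?thesis using nn K \<alpha> pos by auto
    next
      case False
      then have fh: "f x > 0" "h x > 0" using nn[of x] by (auto simp: less_le)
      have "f x powr \<alpha> * h x powr \<beta> = K * ((f x / F) powr \<alpha> * (h x / H) powr \<beta>)"
        using fh pos by (simp add: K_def powr_divide)
      also have "\<dots> \<le> K * (\<alpha> * (f x / F) + \<beta> * (h x / H))"
        using K \<alpha> fh pos by (intro mult_left_mono Youngs_inequality_0) auto
      finally show ?thesis by (simp add: algebra_simps)
    qed
    then show "ennreal (f x powr \<alpha> * h x powr \<beta>) \<le> ennreal (K * \<alpha> / F) * ennreal (f x) + ennreal (K * \<beta> / H) * ennreal (h x)"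
      using K \<alpha> pos nn[of x] by (simp add: ennreal_leI flip: ennreal_mult ennreal_plus)
  qed
  also have "\<dots> = ennreal (K * \<alpha> / F) * ennreal F + ennreal (K * \<beta> / H) * ennreal H"
    by (simp add: nn_integral_add nn_integral_cmult F H)
  also have "\<dots> = ennreal (K * \<alpha> + K * \<beta>)" using K \<alpha> pos by (simp flip: ennreal_mult ennreal_plus)
  also have "K * \<alpha> + K * \<beta> = K" using \<alpha> by (simp flip: distrib_left)
  finally show ?thesis by (simp add: K_def)
qed

context riemannian_volume_space
begin

text \<open>In each chart the Euclidean chain rule gives proportional lowered fields. The metric is
  invertible, so the fields themselves are proportional with factor
  \<open>\<alpha> * d m powr (\<alpha> - 1)\<close>, and the norm of \<open>d'\<close> is 1.\<close>

lemma gradient_norm_powr: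
  assumes \<Omega>: "open \<Omega>" and \<rho>: "has_weak_gradient A g dv \<Omega> \<rho> \<rho>'" and d: "has_weak_gradient A g dv \<Omega> d d'"
    and d0: "AE x in dv. x \<in> \<Omega> \<longrightarrow> d x \<ge> 0" and d1: "AE x in dv. x \<in> \<Omega> \<longrightarrow> g_norm A g d' x = 1"
    and \<alpha>: "\<alpha> \<noteq> 0" and eq: "AE x in dv. x \<in> \<Omega> \<longrightarrow> ennreal (\<rho> x) = epow (ennreal (d x)) \<alpha>"
  shows "AE x in dv. x \<in> \<Omega> \<longrightarrow> 0 < d x \<and> \<rho> x = d x powr \<alpha> \<and> g_norm A g \<rho>' x = \<bar>\<alpha>\<bar> * d x powr (\<alpha> - 1)"
proof (rule AE_by_charts)
  fix c assume c: "c \<in> A"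
  let ?U = "snd c ` (fst c \<inter> \<Omega>)"
  have U: "open ?U" using \<Omega> c by (intro chart_image_open) (auto simp: chart_open)
  have Usub: "fst c \<inter> \<Omega> \<subseteq> fst c" by auto
  have Ux: "chart_inv c x \<in> fst c \<and> chart_inv c x \<in> \<Omega>" if "x \<in> ?U" for x
    using that chart_image_eq[OF c Usub] by auto
  have vf: "vector_field_on A \<Omega> \<rho>'" "vector_field_on A \<Omega> d'" using \<rho> d by (auto simp: has_weak_gradient_def)
  note wd = weak_gradient_chart(1)[OF \<Omega> d c] and w\<rho> = weak_gradient_chart(1)[OF \<Omega> \<rho> c]
  have tr: "AE x in lborel. x \<in> ?U \<longrightarrow> P (chart_inv c x)" if "AE m in dv. m \<in> \<Omega> \<longrightarrow> P m" for P
    using that by (subst AE_chart_iff[OF c Usub, symmetric]) (auto elim: eventually_mono)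
  have dpos: "AE x in lborel. x \<in> ?U \<longrightarrow> 0 < d (chart_inv c x)"
    using weak_gradient_eq_0_on_zero_set[OF U wd] tr[OF d0] tr[OF d1]
  proof eventually_elim
    case (elim x)
    show ?case
    proof
      assume x: "x \<in> ?U"
      have m: "chart_inv c x \<in> fst c" "chart_inv c x \<in> \<Omega>" using Ux[OF x] by auto
      have "d (chart_inv c x) \<noteq> 0"
      proof
        assume "d (chart_inv c x) = 0"
        then have "g c (chart_inv c x) *v d' c (chart_inv c x) = 0" using elim(1) x by blast
        then have "g_norm A g d' (chart_inv c x) = 0" using g_norm_chart[OF vf(2) c m] by simp
        then show False using elim(3) x by simp
      qed
      then show "0 < d (chart_inv c x)" using elim(2) x by force
    qed
  qed
  have pw: "AE x in lborel. x \<in> ?U \<longrightarrow> 0 < d (chart_inv c x) \<and> \<rho> (chart_inv c x) = d (chart_inv c x) powr \<alpha>"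
    using dpos tr[OF eq]
  proof eventually_elim
    case (elim x)
    show ?case
    proof
      assume x: "x \<in> ?U"
      then have dx: "0 < d (chart_inv c x)" using elim by blast
      \<comment> \<open>\<open>ennreal\<close> sends all nonpositive reals to 0, but the right side
        is positive here, so the equation holds between the reals themselves.\<close>
      have "ennreal (\<rho> (chart_inv c x)) = ennreal (d (chart_inv c x) powr \<alpha>)"
        using elim(2) x epow_ennreal_pos[OF dx] by simp
      then show "0 < d (chart_inv c x) \<and> \<rho> (chart_inv c x) = d (chart_inv c x) powr \<alpha>"
        using dx by (metis ennreal_eq_0_iff ennreal_inj linorder_not_le nle_le powr_gt_zero less_irrefl)
    qed
  qed
  have "AE x in lborel. x \<in> ?U \<longrightarrow> 0 < d (chart_inv c x) \<and> \<rho> (chart_inv c x) = d (chart_inv c x) powr \<alpha> \<and>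
     g_norm A g \<rho>' (chart_inv c x) = \<bar>\<alpha>\<bar> * d (chart_inv c x) powr (\<alpha> - 1)"
    using weak_gradient_powr[OF U wd w\<rho> \<alpha> pw] pw tr[OF d1]
  proof eventually_elim
    case (elim x)
    show ?case
    proof
      assume x: "x \<in> ?U"
      define m where "m = chart_inv c x"
      have m: "m \<in> fst c" "m \<in> \<Omega>" using Ux[OF x] by (auto simp: m_def)
      define t where "t = \<alpha> * d m powr (\<alpha> - 1)"
      note inv = matrix_inv_mult_vec(2)[OF pos_def_invertible[OF metric_pos_def[OF c m(1)]]]
      have "g c m *v \<rho>' c m = t *\<^sub>R (g c m *v d' c m)" using elim(1) x by (simp add: m_def t_def)
      then have "\<rho>' c m = t *\<^sub>R d' c m"
        using inv[of "\<rho>' c m"] inv[of "d' c m"] by (simp add: matrix_vector_mult_scaleR)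
      then have "\<rho>' c m \<bullet> (g c m *v \<rho>' c m) = t\<^sup>2 * (d' c m \<bullet> (g c m *v d' c m))"
        by (simp add: matrix_vector_mult_scaleR power2_eq_square)
      then have "g_norm A g \<rho>' m = \<bar>t\<bar> * g_norm A g d' m"
        unfolding g_norm_chart[OF vf(1) c m] g_norm_chart[OF vf(2) c m] by (simp add: real_sqrt_mult)
      then show "0 < d (chart_inv c x) \<and> \<rho> (chart_inv c x) = d (chart_inv c x) powr \<alpha> \<and>
         g_norm A g \<rho>' (chart_inv c x) = \<bar>\<alpha>\<bar> * d (chart_inv c x) powr (\<alpha> - 1)"
        using elim(2,3) x by (simp add: m_def t_def abs_mult)
    qed
  qed
  then have "AE m in dv. m \<in> fst c \<inter> \<Omega> \<longrightarrow> 0 < d m \<and> \<rho> m = d m powr \<alpha> \<and> g_norm A g \<rho>' m = \<bar>\<alpha>\<bar> * d m powr (\<alpha> - 1)"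
    by (subst AE_chart_iff[OF c Usub])
  then show "AE m in dv. m \<in> fst c \<longrightarrow> m \<in> \<Omega> \<longrightarrow> 0 < d m \<and> \<rho> m = d m powr \<alpha> \<and> g_norm A g \<rho>' m = \<bar>\<alpha>\<bar> * d m powr (\<alpha> - 1)"
    by eventually_elim auto
qed

end

context p_superharmonic_function
begin

section \<open>Sign of the tested integral and Hardy's inequality\<close>

lemma tested_add:
  assumes "C1_manifold w" "C1_manifold v" "m \<in> \<Omega>"
  shows "tested \<epsilon> (\<lambda>m. w m + v m) m = tested \<epsilon> w m + tested \<epsilon> v m"
proof -
  note c = chart_at[of m]
  have sum: "C1_manifold (\<lambda>m. w m + v m)" by (rule C1_manifold_add[OF assms(1,2)])
  show ?thesis
    unfolding tested_def g_inner_grad[OF X_field sum c assms(3)] g_inner_grad[OF X_field assms(1) c assms(3)]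
      g_inner_grad[OF X_field assms(2) c assms(3)] cgrad_add[OF assms(1,2) c]
    by (simp add: inner_add_right algebra_simps)
qed

text \<open>Finitely many plateau sets cover the support of \<open>w\<close>. Induction on their
  number splits off one of them at a time: \<open>w1\<close> is supported in a single chart, and
  \<open>w2\<close> is left to the remaining sets. Both are nonnegative because the cut-off has
  values between 0 and 1, and no normalisation by a sum of cut-offs is involved.\<close>

lemma tested_integral_nonneg:
  assumes w: "w \<in> C01 A \<Omega>" "\<And>m. 0 \<le> w m" and \<epsilon>: "\<epsilon> > 0"
  shows "set_integrable dv \<Omega> (tested \<epsilon> w) \<and> 0 \<le> (LINT m:\<Omega>|dv. tested \<epsilon> w m)"
proof -
  define good where "good V \<longleftrightarrow> (\<exists>\<beta> c T. c \<in> A \<and> C1_manifold \<beta> \<and> (\<forall>x. 0 \<le> \<beta> x \<and> \<beta> x \<le> 1) \<and> (\<forall>x\<in>V. \<beta> x = 1) \<and>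
    compact T \<and> T \<subseteq> fst c \<and> (\<forall>x. x \<notin> T \<longrightarrow> \<beta> x = 0))" for V
  have main: "set_integrable dv \<Omega> (tested \<epsilon> w) \<and> 0 \<le> (LINT m:\<Omega>|dv. tested \<epsilon> w m)"
    if "finite F" "\<And>V. V \<in> F \<Longrightarrow> good V" "C1_manifold w" "compact_support_in w \<Omega>" "\<And>m. 0 \<le> w m" "\<And>m. w m \<noteq> 0 \<Longrightarrow> m \<in> \<Union>F"
    for F w
    using that
  proof (induction F arbitrary: w rule: finite_induct)
    case empty
    then have w0: "w m = 0" for m by auto
    have "tested \<epsilon> w m = 0" if "m \<in> \<Omega>" for m
    proof -
      have "g_inner A g X (grad g w) m = 0"
        by (rule g_inner_grad_zero_outside[OF X_field empty(2) that, of "{}"]) (use w0 in auto)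
      then show ?thesis by (simp add: tested_def w0)
    qed
    then have "(\<lambda>m. indicator \<Omega> m *\<^sub>R tested \<epsilon> w m) = (\<lambda>m. 0)" by (auto simp: indicator_def fun_eq_iff)
    then show ?case by (simp add: set_integrable_def set_lebesgue_integral_def)
  next
    case (insert V F)
    have "good V" using insert.prems(1) by blast
    then obtain \<beta> c T where \<beta>: "c \<in> A" "C1_manifold \<beta>" "\<And>x. 0 \<le> \<beta> x" "\<And>x. \<beta> x \<le> 1" "\<And>x. x \<in> V \<Longrightarrow> \<beta> x = 1"
      "compact T" "T \<subseteq> fst c" "\<And>x. x \<notin> T \<Longrightarrow> \<beta> x = 0"
      unfolding good_def by blast
    define K where "K = closure {x. w x \<noteq> 0}"
    have K: "compact K" "K \<subseteq> \<Omega>" using insert.prems(3) by (auto simp: compact_support_in_def K_def)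
    have w0: "w y = 0" if "y \<notin> K" for y using that closure_subset[of "{x. w x \<noteq> 0}"] by (auto simp: K_def)
    define w1 where "w1 m = \<beta> m * w m" for m
    \<comment> \<open>The cut-off is exactly 1 on \<open>V\<close>, so \<open>w2\<close> vanishes
      there and its nonzero set is covered by \<open>F\<close> alone.\<close>
    define w2 where "w2 m = (1 - \<beta> m) * w m" for m
    have w1C: "C1_manifold w1" unfolding w1_def by (intro C1_manifold_mult \<beta> insert.prems)
    have "C1_manifold (\<lambda>m. 1 - \<beta> m)"
      by (rule C1_manifold_compose[OF \<beta>(2), of "\<lambda>_. -1"]) (auto intro!: derivative_eq_intros)
    then have w2C: "C1_manifold w2" unfolding w2_def by (intro C1_manifold_mult insert.prems)
    have TK: "compact (T \<inter> K)" using \<beta>(6) K(1) by (intro compact_Int) 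
    have 1: "set_integrable dv \<Omega> (tested \<epsilon> w1)" "0 \<le> (LINT m:\<Omega>|dv. tested \<epsilon> w1 m)"
      by (rule tested_integral_nonneg_chart[OF w1C _ \<beta>(1) TK _ _ \<epsilon>]; use \<beta> insert.prems(4) K w0 in \<open>auto simp: w1_def\<close>)+
    have 2: "set_integrable dv \<Omega> (tested \<epsilon> w2) \<and> 0 \<le> (LINT m:\<Omega>|dv. tested \<epsilon> w2 m)"
    proof (rule insert.IH)
      show "good V'" if "V' \<in> F" for V' using insert.prems(1) that by blast
      show "compact_support_in w2 \<Omega>" by (rule compact_support_inI[OF K]) (use w0 in \<open>auto simp: w2_def\<close>)
      show "0 \<le> w2 m" for m using \<beta>(4)[of m] insert.prems(4)[of m] by (simp add: w2_def)
      show "m \<in> \<Union>F" if "w2 m \<noteq> 0" for m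
        using that insert.prems(5)[of m] \<beta>(5)[of m] by (auto simp: w2_def)
    qed (rule w2C)
    have weq: "(\<lambda>m. w1 m + w2 m) = w" by (auto simp: w1_def w2_def fun_eq_iff algebra_simps)
    have eq: "tested \<epsilon> w m = tested \<epsilon> w1 m + tested \<epsilon> w2 m" if "m \<in> \<Omega>" for m
      using tested_add[OF w1C w2C that, of \<epsilon>] unfolding weq .
    have "set_integrable dv \<Omega> (tested \<epsilon> w) = set_integrable dv \<Omega> (\<lambda>m. tested \<epsilon> w1 m + tested \<epsilon> w2 m)"
      by (rule set_integrable_cong) (auto simp: eq)
    moreover have "(LINT m:\<Omega>|dv. tested \<epsilon> w m) = (LINT m:\<Omega>|dv. tested \<epsilon> w1 m + tested \<epsilon> w2 m)"
      by (rule set_lebesgue_integral_cong) (auto simp: eq)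
    moreover note set_integral_add[OF 1(1) conjunct1[OF 2]]
    ultimately show ?case using 1 2 by simp
  qed
  have wC: "C1_manifold w" "compact_support_in w \<Omega>" using w(1) by (auto simp: C01_iff)
  define K where "K = closure {x. w x \<noteq> 0}"
  have K: "compact K" using wC(2) by (auto simp: compact_support_in_def K_def)
  have w0: "w y = 0" if "y \<notin> K" for y using that closure_subset[of "{x. w x \<noteq> 0}"] by (auto simp: K_def)
  have ex: "\<exists>V. open V \<and> m \<in> V \<and> good V" for m
  proof -
    obtain \<beta> V c T where "c \<in> A" "C1_manifold \<beta>" "\<And>x. 0 \<le> \<beta> x \<and> \<beta> x \<le> 1" "open V" "m \<in> V" "\<And>x. x \<in> V \<Longrightarrow> \<beta> x = 1"
      "compact T" "T \<subseteq> fst c" "\<And>x. x \<notin> T \<Longrightarrow> \<beta> x = 0" by (rule plateau_exists[of m]) (rule that; assumption)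
    then show ?thesis unfolding good_def by blast
  qed
  obtain F where F: "F \<subseteq> {V. open V \<and> good V}" "finite F" "K \<subseteq> \<Union>F"
  proof (rule compactE[OF K, of "{V. open V \<and> good V}"])
    show "K \<subseteq> \<Union>{V. open V \<and> good V}" using ex by blast
  qed (use that in auto)
  show ?thesis
    by (rule main[OF F(2) _ wC w(2)]) (use F w0 in blast)+
qed

lemma C1_manifold_abs_powr:
  assumes u: "C1_manifold u" shows "C1_manifold (\<lambda>m. \<bar>u m\<bar> powr p)"
proof (rule C1_manifold_compose[OF u _ DERIV_abs_powr[OF p]])
  show "continuous_on UNIV (\<lambda>t::real. p * (max 0 t) powr (p - 1) - p * (max 0 (- t)) powr (p - 1))"
    using p by (intro continuous_intros continuous_on_powr') auto
qed

lemma abs_powr_C01: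
  assumes u: "u \<in> C01 A \<Omega>" shows "(\<lambda>m. \<bar>u m\<bar> powr p) \<in> C01 A \<Omega>"
proof -
  have "{x. \<bar>u x\<bar> powr p \<noteq> 0} = {x. u x \<noteq> 0}" by auto
  then show ?thesis using u C1_manifold_abs_powr by (simp add: C01_iff compact_support_in_def)
qed

text \<open>For a weight \<theta> between 0 and 1, Young's inequality leaves the fraction
  \<open>1 - \<theta>\<close> of \<open>(p - 1) * q powr p\<close> for the left side and costs
  \<open>\<theta> powr (1 - p)\<close> on the right. The ratio of cost to remainder is smallest at
  \<open>\<theta> = (p - 1) / p\<close>, where the remainder \<open>(p - 1) * (1 - \<theta>)\<close>
  equals \<theta> and the ratio is \<open>\<theta> powr (- p)\<close>.\<close>

lemma Young_for_Hardy:
  assumes "0 \<le> q" "0 \<le> n"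
  shows "p * q powr (p - 1) * n \<le> ((p - 1) / p) powr (1 - p) * n powr p + (p - 1) * ((p - 1) / p) * q powr p"
proof -
  define \<theta> where "\<theta> = (p - 1) / p"
  have \<theta>: "\<theta> > 0" using p by (simp add: \<theta>_def)
  \<comment> \<open>The powers of \<theta> in \<open>t\<close> and \<open>r\<close> are reciprocal,
    so they cancel in the product but distribute as \<open>\<theta> powr (1 - p)\<close> and
    \<theta> over the two p-th powers.\<close>
  define t where "t = \<theta> powr (- ((p - 1) / p)) * n"
  define r where "r = \<theta> powr ((p - 1) / p) * q powr (p - 1)"
  have "t * r \<le> t powr p / p + r powr (p / (p - 1)) / (p / (p - 1))"
    by (rule Youngs_inequality) (use p assms in \<open>auto simp: t_def r_def field_simps\<close>)
  moreover have "t powr p = \<theta> powr (1 - p) * n powr p"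
    using p assms by (simp add: t_def powr_mult powr_powr)
  moreover have "r powr (p / (p - 1)) = \<theta> * q powr p"
    using p assms \<theta> by (simp add: r_def powr_mult powr_powr)
  moreover have "t * r = q powr (p - 1) * n"
    using \<theta> by (simp add: t_def r_def powr_minus)
  ultimately have "p * (q powr (p - 1) * n) \<le> p * (\<theta> powr (1 - p) * n powr p / p + \<theta> * q powr p / (p / (p - 1)))"
    using p by (intro mult_left_mono) auto
  also have "\<dots> = \<theta> powr (1 - p) * n powr p + (p - 1) * \<theta> * q powr p" using p by (simp add: field_simps)
  finally show ?thesis by (simp add: \<theta>_def mult.assoc)
qed

text \<open>In terms of \<open>q\<close>, the quotient being estimated, and \<open>n\<close>, the
  norm of the gradient of \<open>u\<close>, the Cauchy-Schwarz inequality bounds the tested quantity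
  by \<open>p * q powr (p - 1) * n - (p - 1) * q powr p\<close>. Young's inequality does the rest;
  the estimate is pointwise.\<close>

lemma tested_upper:
  assumes u: "C1_manifold u" and m: "m \<in> \<Omega>" "\<rho> m + \<epsilon> > 0"
  shows "tested \<epsilon> (\<lambda>m. \<bar>u m\<bar> powr p) m + (p - 1) / p * (\<bar>u m\<bar> * N m / (\<rho> m + \<epsilon>)) powr p
     \<le> ((p - 1) / p) powr (1 - p) * g_norm A g (grad g u) m powr p"
proof -
  define n where "n = g_norm A g (grad g u) m"
  define e where "e = \<rho> m + \<epsilon>"
  define q where "q = \<bar>u m\<bar> * N m / e"
  have e: "e > 0" using m by (simp add: e_def)
  have n: "n \<ge> 0" by (simp add: n_def)
  have q: "q \<ge> 0" using e by (simp add: q_def)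
  define \<phi>' where "\<phi>' t = p * (max 0 t) powr (p - 1) - p * (max 0 (- t)) powr (p - 1)" for t :: real
  have \<phi>'b: "\<bar>\<phi>' t\<bar> = p * \<bar>t\<bar> powr (p - 1)" for t using p by (auto simp: \<phi>'_def max_def abs_mult)
  note wC = C1_manifold_abs_powr[OF u]
  note c = chart_at[of m]
  have cg: "cgrad (chart_at A m) (\<lambda>m. \<bar>u m\<bar> powr p) m = \<phi>' (u m) *\<^sub>R cgrad (chart_at A m) u m"
    unfolding \<phi>'_def by (rule cgrad_compose[OF u c DERIV_abs_powr[OF p]])
  have gi: "g_inner A g X (grad g (\<lambda>m. \<bar>u m\<bar> powr p)) m = \<phi>' (u m) * g_inner A g X (grad g u) m"
    unfolding g_inner_grad[OF X_field wC c m(1)] g_inner_grad[OF X_field u c m(1)] cg by simp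
  have "g_inner A g X (grad g (\<lambda>m. \<bar>u m\<bar> powr p)) m \<le> \<bar>\<phi>' (u m)\<bar> * \<bar>g_inner A g X (grad g u) m\<bar>"
    unfolding gi abs_mult[symmetric] by simp
  also have "\<dots> \<le> \<bar>\<phi>' (u m)\<bar> * (N m * n)"
    unfolding n_def by (intro mult_left_mono g_inner_Cauchy_Schwarz) auto
  finally have gle: "g_inner A g X (grad g (\<lambda>m. \<bar>u m\<bar> powr p)) m \<le> p * \<bar>u m\<bar> powr (p - 1) * (N m * n)"
    unfolding \<phi>'b .
  have N1: "N m powr (p - 2) * N m = N m powr (p - 1)"
    using g_norm_nonneg[of X m] by (cases "N m = 0") (auto simp: powr_mult_base powr_diff power2_eq_square)
  have N2: "N m powr (p - 2) * (N m)\<^sup>2 = N m powr p"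
    using g_norm_nonneg[of X m] by (cases "N m = 0") (auto simp: powr_diff power2_eq_square)
  have q1: "q powr (p - 1) = \<bar>u m\<bar> powr (p - 1) * N m powr (p - 1) * e powr (1 - p)"
    using e by (simp add: q_def powr_divide powr_mult powr_diff divide_simps)
  have q2: "q powr p = \<bar>u m\<bar> powr p * N m powr p * e powr (- p)"
    using e by (simp add: q_def powr_divide powr_mult powr_minus divide_simps)
  have "tested \<epsilon> (\<lambda>m. \<bar>u m\<bar> powr p) m \<le> N m powr (p - 2) * ((p * \<bar>u m\<bar> powr (p - 1) * (N m * n)) * e powr (1 - p) - (p - 1) * \<bar>u m\<bar> powr p * e powr (- p) * (N m)\<^sup>2)"
    unfolding tested_def e_def[symmetric] using gle by (intro mult_left_mono diff_right_mono mult_right_mono) auto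
  also have "\<dots> = p * (\<bar>u m\<bar> powr (p - 1) * (N m powr (p - 2) * N m) * e powr (1 - p)) * n - (p - 1) * (\<bar>u m\<bar> powr p * (N m powr (p - 2) * (N m)\<^sup>2) * e powr (- p))"
    by (simp add: algebra_simps)
  also have "\<dots> = p * q powr (p - 1) * n - (p - 1) * q powr p"
    unfolding N1 N2 q1 q2 by simp
  finally have "tested \<epsilon> (\<lambda>m. \<bar>u m\<bar> powr p) m \<le> p * q powr (p - 1) * n - (p - 1) * q powr p" .
  also have "\<dots> \<le> ((p - 1) / p) powr (1 - p) * n powr p + (p - 1) * ((p - 1) / p) * q powr p - (p - 1) * q powr p"
    using Young_for_Hardy[OF q n] by simp
  also have "\<dots> = ((p - 1) / p) powr (1 - p) * n powr p - (p - 1) / p * q powr p"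
    using p by (simp add: field_simps)
  finally show ?thesis by (simp add: n_def q_def e_def)
qed

text \<open>Integrating the pointwise estimate and dropping the nonnegative integral of
  \<open>L\<close> leaves \<open>\<theta>\<close> times the integral of \<open>H\<close> below
  \<open>\<theta> powr (1 - p)\<close> times the energy; division by \<theta> produces the
  constant.\<close>

lemma Hardy_regularized:
  assumes u: "u \<in> C01 A \<Omega>" and \<epsilon>: "\<epsilon> > 0"
  shows "(\<integral>\<^sup>+m\<in>\<Omega>. ennreal ((\<bar>u m\<bar> * N m / (\<rho> m + \<epsilon>)) powr p) \<partial>dv)
    \<le> ennreal ((p / (p - 1)) powr p) * (\<integral>\<^sup>+m\<in>\<Omega>. ennreal (g_norm A g (grad g u) m powr p) \<partial>dv)"
proof -
  have uC: "C1_manifold u" using u by (simp add: C01_iff)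
  define \<theta> where "\<theta> = (p - 1) / p"
  have \<theta>: "\<theta> > 0" using p by (simp add: \<theta>_def)
  define L where "L m = indicator \<Omega> m * tested \<epsilon> (\<lambda>m. \<bar>u m\<bar> powr p) m" for m
  define E where "E m = indicator \<Omega> m * g_norm A g (grad g u) m powr p" for m
  define H where "H m = indicator \<Omega> m * (\<bar>u m\<bar> * N m / (\<rho> m + \<epsilon>)) powr p" for m
  have ti: "set_integrable dv \<Omega> (tested \<epsilon> (\<lambda>m. \<bar>u m\<bar> powr p))" "0 \<le> (LINT m:\<Omega>|dv. tested \<epsilon> (\<lambda>m. \<bar>u m\<bar> powr p) m)"
    using tested_integral_nonneg[OF abs_powr_C01[OF u] _ \<epsilon>] by auto
  have L: "integrable dv L" "0 \<le> (\<integral>m. L m \<partial>dv)"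
    using ti by (simp_all add: L_def[abs_def] set_integrable_def set_lebesgue_integral_def)
  have Em: "E \<in> borel_measurable dv"
    unfolding E_def[abs_def]
    by (intro indicator_measurable_dv borel_measurable_continuous_on_restrict \<Omega>_borel)
       (use p in \<open>auto intro!: continuous_on_powr' continuous_on_subset[OF g_norm_grad_cont[OF uC]] continuous_on_const\<close>)
  have Hm: "H \<in> borel_measurable dv"
  proof -
    note [measurable] = N_measurable \<rho>_measurable C1_measurable[OF uC]
    show ?thesis unfolding H_def[abs_def] by (intro indicator_measurable_dv \<Omega>_borel) measurable
  qed
  have Eeq: "(\<integral>\<^sup>+m. ennreal (E m) \<partial>dv) = (\<integral>\<^sup>+m\<in>\<Omega>. ennreal (g_norm A g (grad g u) m powr p) \<partial>dv)"
    by (intro nn_integral_cong) (auto simp: E_def indicator_def)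
  have Heq: "(\<integral>\<^sup>+m. ennreal (H m) \<partial>dv) = (\<integral>\<^sup>+m\<in>\<Omega>. ennreal ((\<bar>u m\<bar> * N m / (\<rho> m + \<epsilon>)) powr p) \<partial>dv)"
    by (intro nn_integral_cong) (auto simp: H_def indicator_def)
  have Efin: "(\<integral>\<^sup>+m. ennreal (E m) \<partial>dv) < \<infinity>" unfolding Eeq using p by (intro p_energy_finite[OF u]) auto
  have E0: "0 \<le> E m" and H0: "0 \<le> H m" for m by (auto simp: E_def H_def)
  have Ei: "integrable dv E" using Em Efin E0 by (intro integrableI_bounded) auto
  have le: "AE m in dv. L m + \<theta> * H m \<le> \<theta> powr (1 - p) * E m"
    using \<rho>_nonneg
  proof eventually_elim
    case (elim m)
    show ?case using tested_upper[OF uC, of m \<epsilon>] elim \<epsilon> by (auto simp: L_def E_def H_def indicator_def \<theta>_def)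
  qed
  have RHS: "integrable dv (\<lambda>m. (\<theta> powr (1 - p) * E m - L m) / \<theta>)" using Ei L by auto
  \<comment> \<open>Integrability of \<open>H\<close> is not known beforehand and has to precede the
    splitting of the integral. It comes from the same pointwise estimate, because \<open>E\<close>
    and \<open>L\<close> are integrable.\<close>
  have Hi: "integrable dv H"
  proof (rule Bochner_Integration.integrable_bound[OF RHS Hm])
    show "AE m in dv. norm (H m) \<le> norm ((\<theta> powr (1 - p) * E m - L m) / \<theta>)"
      using le
    proof eventually_elim
      case (elim m)
      then have "H m \<le> (\<theta> powr (1 - p) * E m - L m) / \<theta>" using \<theta> by (simp add: pos_le_divide_eq mult.commute)
      then show ?case using H0[of m] by (metis abs_ge_self abs_of_nonneg order_trans real_norm_def)
    qed
  qed
  have "(\<integral>m. L m + \<theta> * H m \<partial>dv) \<le> (\<integral>m. \<theta> powr (1 - p) * E m \<partial>dv)"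
    using L Hi Ei le by (intro integral_mono_AE) auto
  then have "\<theta> * (\<integral>m. H m \<partial>dv) \<le> \<theta> powr (1 - p) * (\<integral>m. E m \<partial>dv)" using L Hi by simp
  then have "(\<integral>m. H m \<partial>dv) \<le> (\<theta> powr (1 - p) * (\<integral>m. E m \<partial>dv)) / \<theta>" using \<theta> by (simp add: pos_le_divide_eq mult.commute)
  also have "\<dots> = \<theta> powr (- p) * (\<integral>m. E m \<partial>dv)"
    using \<theta> by (simp add: powr_diff powr_minus divide_simps)
  also have "\<theta> powr (- p) = (p / (p - 1)) powr p"
    using p by (simp add: \<theta>_def powr_minus powr_divide)
  finally have fin: "(\<integral>m. H m \<partial>dv) \<le> (p / (p - 1)) powr p * (\<integral>m. E m \<partial>dv)" .
  have "(\<integral>\<^sup>+m. ennreal (H m) \<partial>dv) = ennreal (\<integral>m. H m \<partial>dv)" using Hi H0 by (intro nn_integral_eq_integral) auto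
  also have "\<dots> \<le> ennreal ((p / (p - 1)) powr p * (\<integral>m. E m \<partial>dv))" using fin by (rule ennreal_leI)
  also have "\<dots> = ennreal ((p / (p - 1)) powr p) * ennreal (\<integral>m. E m \<partial>dv)"
    using E0 by (intro ennreal_mult) (auto intro: integral_nonneg_AE)
  also have "ennreal (\<integral>m. E m \<partial>dv) = (\<integral>\<^sup>+m. ennreal (E m) \<partial>dv)" using Ei E0 by (intro nn_integral_eq_integral[symmetric]) auto
  finally show ?thesis unfolding Heq Eeq .
qed

text \<open>Fatou's lemma along \<open>\<epsilon> = 1 / Suc k\<close>, with a bound independent of
  \<open>k\<close>. The real quotient in the second claim is 0 where \<open>\<rho> m = 0\<close>; by
  the first claim this conceals nothing, since up to a null set the numerator vanishes there as
  well.\<close>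

lemma Hardy:
  assumes u: "u \<in> C01 A \<Omega>"
  shows "AE m in dv. m \<in> \<Omega> \<longrightarrow> u m \<noteq> 0 \<longrightarrow> N m \<noteq> 0 \<longrightarrow> 0 < \<rho> m"
    and "(\<integral>\<^sup>+m\<in>\<Omega>. ennreal ((\<bar>u m\<bar> * N m / \<rho> m) powr p) \<partial>dv)
    \<le> ennreal ((p / (p - 1)) powr p) * (\<integral>\<^sup>+m\<in>\<Omega>. ennreal (g_norm A g (grad g u) m powr p) \<partial>dv)"
proof -
  have uC: "C1_manifold u" using u by (simp add: C01_iff)
  define R where "R = ennreal ((p / (p - 1)) powr p) * (\<integral>\<^sup>+m\<in>\<Omega>. ennreal (g_norm A g (grad g u) m powr p) \<partial>dv)"
  have R: "R < \<infinity>" unfolding R_def using p_energy_finite[OF u, of p] p by (simp add: ennreal_mult_less_top)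
  define q where "q k m = ennreal (indicator \<Omega> m * (\<bar>u m\<bar> * N m / (\<rho> m + 1 / real (Suc k))) powr p)" for k m
  have qm[measurable]: "q k \<in> borel_measurable dv" for k
  proof -
    note [measurable] = N_measurable \<rho>_measurable C1_measurable[OF uC]
    have "(\<lambda>m. indicator \<Omega> m * (\<bar>u m\<bar> * N m / (\<rho> m + 1 / real (Suc k))) powr p) \<in> borel_measurable dv"
      by (intro indicator_measurable_dv \<Omega>_borel) measurable
    then show ?thesis unfolding q_def[abs_def] by measurable
  qed
  have qle: "(\<integral>\<^sup>+m. q k m \<partial>dv) \<le> R" for k
  proof -
    have "(\<integral>\<^sup>+m. q k m \<partial>dv) = (\<integral>\<^sup>+m\<in>\<Omega>. ennreal ((\<bar>u m\<bar> * N m / (\<rho> m + 1 / real (Suc k))) powr p) \<partial>dv)"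
      by (intro nn_integral_cong) (auto simp: q_def indicator_def)
    also have "\<dots> \<le> R" unfolding R_def by (rule Hardy_regularized[OF u]) simp
    finally show ?thesis .
  qed
  have "(\<integral>\<^sup>+m. liminf (\<lambda>k. q k m) \<partial>dv) \<le> liminf (\<lambda>k. \<integral>\<^sup>+m. q k m \<partial>dv)" by (rule nn_integral_liminf) (rule qm)
  also have "\<dots> \<le> liminf (\<lambda>k. R)" using qle by (intro Liminf_mono) auto
  also have "\<dots> = R" by (simp add: Liminf_const)
  finally have le: "(\<integral>\<^sup>+m. liminf (\<lambda>k. q k m) \<partial>dv) \<le> R" .
  have "AE m in dv. liminf (\<lambda>k. q k m) \<noteq> \<infinity>"
    using le R by (intro nn_integral_noteq_infinite) auto
  then have AE: "AE m in dv. m \<in> \<Omega> \<longrightarrow> (u m \<noteq> 0 \<longrightarrow> N m \<noteq> 0 \<longrightarrow> 0 < \<rho> m) \<and>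
      liminf (\<lambda>k. q k m) = ennreal ((\<bar>u m\<bar> * N m / \<rho> m) powr p)"
    using \<rho>_nonneg
  proof eventually_elim
    case (elim m)
    show ?case
    proof
      assume m: "m \<in> \<Omega>"
      define y where "y = \<bar>u m\<bar> * N m"
      have y0: "y \<ge> 0" by (simp add: y_def)
      have qk: "q k m = ennreal ((y / (\<rho> m + 1 / real (Suc k))) powr p)" for k using m by (simp add: q_def y_def)
      have inv: "(\<lambda>k. \<rho> m + 1 / real (Suc k)) \<longlonglongrightarrow> \<rho> m + 0"
        by (intro tendsto_add tendsto_const LIMSEQ_Suc[OF lim_const_over_n])
      show "(u m \<noteq> 0 \<longrightarrow> N m \<noteq> 0 \<longrightarrow> 0 < \<rho> m) \<and> liminf (\<lambda>k. q k m) = ennreal ((\<bar>u m\<bar> * N m / \<rho> m) powr p)"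
      proof (cases "y = 0")
        case True
        then have "q k m = 0" for k by (simp add: qk)
        then show ?thesis using True by (auto simp: y_def Liminf_const)
      next
        case False
        \<comment> \<open>At a zero of \<rho> the regularised integrands would be
          \<open>(y * real (Suc k)) powr p\<close> with \<open>y > 0\<close>, which is unbounded,
          whereas their lower limit is finite at almost every point.\<close>
        have "\<rho> m \<noteq> 0"
        proof
          assume z: "\<rho> m = 0"
          have y: "y > 0" using False y0 by simp
          have "filterlim (\<lambda>k. y * real (Suc k)) at_top sequentially"
            using y by (intro filterlim_tendsto_pos_mult_at_top[OF tendsto_const] filterlim_compose[OF filterlim_real_sequentially filterlim_Suc]) auto
          then have "filterlim (\<lambda>k. (y * real (Suc k)) powr p) at_top sequentially"
          proof (rule filterlim_at_top_mono)
            have "\<forall>\<^sub>F k in sequentially. 1 \<le> y * real (Suc k)"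
              using \<open>filterlim (\<lambda>k. y * real (Suc k)) at_top sequentially\<close> unfolding filterlim_at_top by blast
            then show "\<forall>\<^sub>F k in sequentially. y * real (Suc k) \<le> (y * real (Suc k)) powr p"
            proof eventually_elim
              case (elim k)
              then have "(y * real (Suc k)) powr 1 \<le> (y * real (Suc k)) powr p" using p by (intro powr_mono) auto
              then show ?case using elim by simp
            qed
          qed
          then have "(\<lambda>k. ennreal ((y * real (Suc k)) powr p)) \<longlonglongrightarrow> \<infinity>"
            unfolding infinity_ennreal_def ennreal_tendsto_top_eq_at_top .
          then have "(\<lambda>k. q k m) \<longlonglongrightarrow> \<infinity>" by (simp add: qk z)
          then have "liminf (\<lambda>k. q k m) = \<infinity>" by (intro lim_imp_Liminf) auto
          then show False using elim by simp
        qed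
        then have \<rho>m: "\<rho> m > 0" using elim(2) m by force
        have "(\<lambda>k. y / (\<rho> m + 1 / real (Suc k))) \<longlonglongrightarrow> y / \<rho> m"
          using inv \<rho>m by (intro tendsto_divide tendsto_const) auto
        then have "(\<lambda>k. (y / (\<rho> m + 1 / real (Suc k))) powr p) \<longlonglongrightarrow> (y / \<rho> m) powr p"
          using False \<rho>m by (intro tendsto_powr tendsto_const) auto
        then have "(\<lambda>k. q k m) \<longlonglongrightarrow> ennreal ((y / \<rho> m) powr p)" unfolding qk by (intro tendsto_ennrealI)
        then have "liminf (\<lambda>k. q k m) = ennreal ((y / \<rho> m) powr p)" by (intro lim_imp_Liminf) auto
        then show ?thesis using \<rho>m by (simp add: y_def)
      qed
    qed
  qed
  then show "AE m in dv. m \<in> \<Omega> \<longrightarrow> u m \<noteq> 0 \<longrightarrow> N m \<noteq> 0 \<longrightarrow> 0 < \<rho> m" by eventually_elim auto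
  have "(\<integral>\<^sup>+m\<in>\<Omega>. ennreal ((\<bar>u m\<bar> * N m / \<rho> m) powr p) \<partial>dv) \<le> (\<integral>\<^sup>+m. liminf (\<lambda>k. q k m) \<partial>dv)"
    by (rule nn_integral_mono_AE) (use AE in eventually_elim, auto simp: indicator_def)
  also have "\<dots> \<le> R" by (rule le)
  finally show "(\<integral>\<^sup>+m\<in>\<Omega>. ennreal ((\<bar>u m\<bar> * N m / \<rho> m) powr p) \<partial>dv)
    \<le> ennreal ((p / (p - 1)) powr p) * (\<integral>\<^sup>+m\<in>\<Omega>. ennreal (g_norm A g (grad g u) m powr p) \<partial>dv)"
    unfolding R_def .
qed

end

section \<open>The interpolation inequality\<close>

context p_superharmonic_function
begin

text \<open>Where everything is positive, \<open>|u|^s\<close> is the product of the power 1/a of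
  the Hardy integrand \<open>h\<close> and the power 1/a' of the integrand of \<open>I\<close>: the
  factors \<open>N / \<rho>\<close> cancel, and the exponents of \<open>|u|\<close> add up to
  \<open>s\<close>. Hoelder's inequality separates the factors and Hardy's inequality bounds the
  first.\<close>

lemma Hoelder_Hardy:
  fixes a a' s :: real
  assumes u: "u \<in> C01 A \<Omega>" and s: "s > 0" and a: "a > 1" and a': "a' = a / (a - 1)"
    and I: "I = (\<integral>\<^sup>+ x\<in>\<Omega>. epow (ennreal \<bar>u x\<bar>) ((a * s - p) / (a - 1)) *
                   epow (equot (\<rho> x) (N x)) (p * (a' - 1)) \<partial>dv)" "I < \<infinity>"
  shows "(\<integral>\<^sup>+ x\<in>\<Omega>. epow (ennreal \<bar>u x\<bar>) s \<partial>dv) \<le>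
             ennreal ((p / (p - 1)) powr (p / a)) *
             epow (\<integral>\<^sup>+ x\<in>\<Omega>. epow (ennreal (g_norm A g (grad g u) x)) p \<partial>dv) (1 / a) *
             epow I (1 / a')"
proof -
  have uC: "C1_manifold u" using u by (simp add: C01_iff)
  have a'1: "a' - 1 = 1 / (a - 1)" and ia': "1 / a' = (a - 1) / a" and a'0: "a' > 0" and ia'0: "1 / a' > 0"
    using a by (auto simp: a' field_simps)
  define k where "k = p * (a' - 1)"
  have k: "k > 0" "k * (1 / a') = p / a" using a p by (auto simp: k_def a'1 ia')
  define e where "e = (a * s - p) / (a - 1)"
  \<comment> \<open>Together with \<open>k * (1 / a') = p / a\<close> this is the exponent count
    behind the factorisation.\<close>
  have e: "e * (1 / a') = s - p / a" using a by (simp add: e_def ia' field_simps)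
  define J where "J x = epow (ennreal \<bar>u x\<bar>) e * epow (equot (\<rho> x) (N x)) k" for x
  define J1 where "J1 x = J x * indicator \<Omega> x" for x
  have I': "I = (\<integral>\<^sup>+x. J1 x \<partial>dv)" unfolding I(1) J1_def J_def e_def k_def ..
  note [measurable] = N_measurable \<rho>_measurable C1_measurable[OF uC]
  have "J \<in> borel_measurable (restrict_space borel \<Omega>)" unfolding J_def by measurable
  then have J1m[measurable]: "J1 \<in> borel_measurable dv"
    unfolding J1_def by (subst (asm) borel_measurable_restrict_space_iff_ennreal) auto
  define h where "h x = indicator \<Omega> x * (\<bar>u x\<bar> * N x / \<rho> x) powr p" for x
  have hm[measurable]: "h \<in> borel_measurable dv"
    unfolding h_def by (intro indicator_measurable_dv \<Omega>_borel) measurable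
  \<comment> \<open>Hoelder's inequality is stated for real functions. The integrand of
    \<open>I\<close> is finite almost everywhere, so passing to reals does not change its
    integral.\<close>
  define j where "j x = enn2real (J1 x)" for x
  have jm[measurable]: "j \<in> borel_measurable dv" unfolding j_def by measurable
  have Jfin: "AE x in dv. J1 x \<noteq> \<infinity>" using I(2) unfolding I' by (intro nn_integral_noteq_infinite) auto
  have jI: "(\<integral>\<^sup>+x. ennreal (j x) \<partial>dv) = I"
    unfolding I' by (intro nn_integral_cong_AE) (use Jfin in \<open>auto simp: j_def less_top elim!: eventually_mono\<close>)
  define E where "E = (\<integral>\<^sup>+ x\<in>\<Omega>. ennreal (g_norm A g (grad g u) x powr p) \<partial>dv)"
  have E: "E < \<infinity>" unfolding E_def using p by (intro p_energy_finite[OF u]) auto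
  have Eeq: "(\<integral>\<^sup>+ x\<in>\<Omega>. epow (ennreal (g_norm A g (grad g u) x)) p \<partial>dv) = E"
    unfolding E_def using p by (simp add: epow_ennreal)
  have hE: "(\<integral>\<^sup>+x. ennreal (h x) \<partial>dv) \<le> ennreal ((p / (p - 1)) powr p) * E"
  proof -
    have "(\<integral>\<^sup>+x. ennreal (h x) \<partial>dv) = (\<integral>\<^sup>+x\<in>\<Omega>. ennreal ((\<bar>u x\<bar> * N x / \<rho> x) powr p) \<partial>dv)"
      by (intro nn_integral_cong) (auto simp: h_def indicator_def)
    then show ?thesis using Hardy(2)[OF u] unfolding E_def by simp
  qed
  obtain E' where E': "E = ennreal E'" "E' \<ge> 0" using E by (cases E) auto
  obtain I1 where I1: "I = ennreal I1" "I1 \<ge> 0" using I(2) by (cases I) auto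
  have hfin: "(\<integral>\<^sup>+x. ennreal (h x) \<partial>dv) < \<infinity>"
    using hE by (rule le_less_trans) (simp add: E' ennreal_mult_less_top)
  then obtain F where F: "(\<integral>\<^sup>+x. ennreal (h x) \<partial>dv) = ennreal F" "F \<ge> 0" by (cases "\<integral>\<^sup>+x. ennreal (h x) \<partial>dv") auto
  have Fle: "F \<le> (p / (p - 1)) powr p * E'"
    using hE unfolding F(1) E'(1) using E'(2) by (simp flip: ennreal_mult)
  have "AE x in dv. epow (ennreal \<bar>u x\<bar>) s * indicator \<Omega> x \<le> ennreal (h x powr (1 / a) * j x powr (1 / a'))"
    using Jfin Hardy(1)[OF u]
  proof eventually_elim
    case (elim x)
    show ?case
    proof (cases "x \<in> \<Omega> \<and> u x \<noteq> 0")
      case False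
      then have "epow (ennreal \<bar>u x\<bar>) s * indicator \<Omega> x = 0" using s by (auto simp: epow_ennreal)
      then show ?thesis by (simp only: zero_le)
    next
      case True
      define y where "y = \<bar>u x\<bar>"
      have y: "y > 0" using True by (simp add: y_def)
      have Jx: "J1 x = ennreal (y powr e) * epow (equot (\<rho> x) (N x)) k"
        using True y by (simp add: J1_def J_def y_def epow_ennreal_pos)
      have ye: "ennreal (y powr e) \<noteq> 0" using y by (simp add: ennreal_eq_0_iff)
      \<comment> \<open>Where \<open>u\<close> is nonzero but \<open>N\<close> vanishes, the
        extended quotient and its positive power are infinite, and the factor
        \<open>y powr e\<close> is positive whatever the sign of \<open>e\<close>. The integrand
        would be infinite, which happens on a null set only.\<close>
      have Nx: "N x \<noteq> 0"
      proof
        assume "N x = 0"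
        then have "epow (equot (\<rho> x) (N x)) k = \<infinity>" using k unfolding equot_def epow_def by simp
        then have "J1 x = \<infinity>" unfolding Jx using ye by (simp add: ennreal_mult_eq_top_iff)
        then show False using elim(1) by simp
      qed
      then have \<rho>x: "\<rho> x > 0" using elim(2) True by blast
      have Np: "N x > 0" using Nx g_norm_nonneg[of X x] by linarith
      have "J1 x = ennreal (y powr e * (\<rho> x / N x) powr k)"
        unfolding Jx equot_def using Nx \<rho>x Np by (simp add: epow_ennreal_pos ennreal_mult)
      then have jx: "j x = y powr e * (\<rho> x / N x) powr k" by (simp add: j_def)
      have hx: "h x = (y * (N x / \<rho> x)) powr p" using True by (simp add: h_def y_def)
      have pa: "p * (1 / a) = p / a" by simp
      have "h x powr (1 / a) * j x powr (1 / a') = y powr (p / a) * (N x / \<rho> x) powr (p / a) * (y powr (e * (1 / a')) * (\<rho> x / N x) powr (k * (1 / a')))"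
        unfolding hx jx using y \<rho>x Np by (simp add: powr_mult powr_powr pa del: times_divide_eq_right)
      also have "\<dots> = (y powr (p / a) * y powr (s - p / a)) * ((N x / \<rho> x) powr (p / a) * (\<rho> x / N x) powr (p / a))"
        unfolding e k(2) by (simp add: mult_ac)
      also have "y powr (p / a) * y powr (s - p / a) = y powr s" by (simp flip: powr_add)
      also have "(N x / \<rho> x) powr (p / a) * (\<rho> x / N x) powr (p / a) = 1"
        using \<rho>x Np by (simp flip: powr_mult)
      finally show ?thesis using True s y by (simp add: epow_ennreal y_def)
    qed
  qed
  then have "(\<integral>\<^sup>+ x\<in>\<Omega>. epow (ennreal \<bar>u x\<bar>) s \<partial>dv) \<le> (\<integral>\<^sup>+x. ennreal (h x powr (1 / a) * j x powr (1 / a')) \<partial>dv)"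
    by (rule nn_integral_mono_AE)
  also have "\<dots> \<le> ennreal (F powr (1 / a) * I1 powr (1 / a'))"
    by (rule Holder_nn_integral[OF hm jm _ _ F _ I1(2)])
       (use jI I1 a in \<open>auto simp: h_def j_def ia' field_simps\<close>)
  also have "\<dots> \<le> ennreal (((p / (p - 1)) powr (p / a) * E' powr (1 / a)) * I1 powr (1 / a'))"
  proof (intro ennreal_leI mult_right_mono)
    have "F powr (1 / a) \<le> ((p / (p - 1)) powr p * E') powr (1 / a)" using Fle F a by (intro powr_mono2) auto
    also have "\<dots> = (p / (p - 1)) powr (p / a) * E' powr (1 / a)" using p E' by (simp add: powr_mult powr_powr)
    finally show "F powr (1 / a) \<le> (p / (p - 1)) powr (p / a) * E' powr (1 / a)" .
  qed simp
  also have "\<dots> = ennreal ((p / (p - 1)) powr (p / a)) * epow E (1 / a) * epow I (1 / a')"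
    unfolding E'(1) I1(1) using a ia'0 E' I1 by (simp add: epow_ennreal ennreal_mult)
  finally show ?thesis unfolding Eeq .
qed

end

theorem theorem3p6:
  fixes A :: "('m::{t2_space, second_countable_topology}, 'n::finite) chart set"
    and g :: "('m, 'n) metric"
    and dv :: "'m measure"
    and \<Omega> :: "'m set"
    and \<rho> :: "'m \<Rightarrow> real"
    and \<rho>' :: "('m, 'n) vfield"
    and p s a a' :: real
  assumes M: "complete_riemannian_manifold A g"
    and vol: "riemannian_volume A g dv"
    and p: "p > 1"
    and \<Omega>: "open \<Omega>"
    and \<rho>_W: "W1p_loc A g dv p \<Omega> \<rho> \<rho>'"
    and \<rho>_nonneg: "AE x in dv. x \<in> \<Omega> \<longrightarrow> \<rho> x \<ge> 0"
    and \<rho>_super: "p_superharmonic A g dv p \<Omega> \<rho>'"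
    and s: "s > 0"
    and a: "a > 1"
    and a': "a' = a / (a - 1)"
  shows
    "(\<forall>u \<in> C01 A \<Omega>.
        let I = (\<integral>\<^sup>+ x\<in>\<Omega>. epow (ennreal \<bar>u x\<bar>) ((a * s - p) / (a - 1)) *
                   epow (equot (\<rho> x) (g_norm A g \<rho>' x)) (p * (a' - 1)) \<partial>dv)
        in I < \<infinity> \<longrightarrow>
           (\<integral>\<^sup>+ x\<in>\<Omega>. epow (ennreal \<bar>u x\<bar>) s \<partial>dv) \<le>
             ennreal ((p / (p - 1)) powr (p / a)) *
             epow (\<integral>\<^sup>+ x\<in>\<Omega>. epow (ennreal (g_norm A g (grad g u) x)) p \<partial>dv) (1 / a) *
             epow I (1 / a')) \<and>
     (\<forall>(d :: 'm \<Rightarrow> real) (d' :: ('m, 'n) vfield) (\<alpha> :: real).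
        \<alpha> \<noteq> 0 \<and>
        has_weak_gradient A g dv \<Omega> d d' \<and>
        (AE x in dv. x \<in> \<Omega> \<longrightarrow> d x \<ge> 0) \<and>
        (AE x in dv. x \<in> \<Omega> \<longrightarrow> g_norm A g d' x = 1) \<and>
        (AE x in dv. x \<in> \<Omega> \<longrightarrow> ennreal (\<rho> x) = epow (ennreal (d x)) \<alpha>) \<longrightarrow>
        (\<forall>u \<in> C01 A \<Omega>.
           let I = (\<integral>\<^sup>+ x\<in>\<Omega>. epow (ennreal \<bar>u x\<bar>) ((a * s - p) / (a - 1)) *
                      epow (ennreal (d x)) (p * (a' - 1)) \<partial>dv)
           in I < \<infinity> \<longrightarrow>
              (\<integral>\<^sup>+ x\<in>\<Omega>. epow (ennreal \<bar>u x\<bar>) s \<partial>dv) \<le>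
                ennreal ((p / (\<bar>\<alpha>\<bar> * (p - 1))) powr (p / a)) *
                epow (\<integral>\<^sup>+ x\<in>\<Omega>. epow (ennreal (g_norm A g (grad g u) x)) p \<partial>dv) (1 / a) *
                epow I (1 / a')))"
proof -
  interpret p_superharmonic_function A g dv \<Omega> \<rho> \<rho>' p
    using M vol \<Omega> p \<rho>_W \<rho>_nonneg \<rho>_super
    by unfold_locales (auto simp: complete_riemannian_manifold_def)
  note main = Hoelder_Hardy[OF _ s a a' refl]
  show ?thesis
  proof (intro conjI allI impI ballI)
    fix u assume u: "u \<in> C01 A \<Omega>"
    show "let I = (\<integral>\<^sup>+ x\<in>\<Omega>. epow (ennreal \<bar>u x\<bar>) ((a * s - p) / (a - 1)) *
                   epow (equot (\<rho> x) (g_norm A g \<rho>' x)) (p * (a' - 1)) \<partial>dv)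
        in I < \<infinity> \<longrightarrow>
           (\<integral>\<^sup>+ x\<in>\<Omega>. epow (ennreal \<bar>u x\<bar>) s \<partial>dv) \<le>
             ennreal ((p / (p - 1)) powr (p / a)) *
             epow (\<integral>\<^sup>+ x\<in>\<Omega>. epow (ennreal (g_norm A g (grad g u) x)) p \<partial>dv) (1 / a) *
             epow I (1 / a')"
      unfolding Let_def using main[OF u] by blast
  next
    fix d :: "'m \<Rightarrow> real" and d' :: "('m, 'n) vfield" and \<alpha> :: real and u
    assume d: "\<alpha> \<noteq> 0 \<and> has_weak_gradient A g dv \<Omega> d d' \<and>
        (AE x in dv. x \<in> \<Omega> \<longrightarrow> d x \<ge> 0) \<and>
        (AE x in dv. x \<in> \<Omega> \<longrightarrow> g_norm A g d' x = 1) \<and>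
        (AE x in dv. x \<in> \<Omega> \<longrightarrow> ennreal (\<rho> x) = epow (ennreal (d x)) \<alpha>)"
      and u: "u \<in> C01 A \<Omega>"
    have \<alpha>: "\<alpha> \<noteq> 0" using d by blast
    have AE: "AE x in dv. x \<in> \<Omega> \<longrightarrow> 0 < d x \<and> \<rho> x = d x powr \<alpha> \<and> N x = \<bar>\<alpha>\<bar> * d x powr (\<alpha> - 1)"
      using gradient_norm_powr[OF \<Omega> wg] d by blast
    define k where "k = p * (a' - 1)"
    have k: "k > 0" "k * (1 / a') = p / a" and ia'0: "1 / a' > 0"
      using a p by (auto simp: k_def a' field_simps)
    define w where "w x = epow (ennreal \<bar>u x\<bar>) ((a * s - p) / (a - 1))" for x
    define I where "I = (\<integral>\<^sup>+ x\<in>\<Omega>. w x * epow (ennreal (d x)) k \<partial>dv)"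
    \<comment> \<open>Almost everywhere \<open>\<rho> x / N x = d x / \<bar>\<alpha>\<bar>\<close>,
      so \<open>I1\<close> is a constant multiple of \<open>I\<close>, and the inequality for
      \<open>d\<close> is the one for \<rho> with a rescaled constant.\<close>
    define I1 where "I1 = (\<integral>\<^sup>+ x\<in>\<Omega>. w x * epow (equot (\<rho> x) (N x)) k \<partial>dv)"
    have "I1 = (\<integral>\<^sup>+ x. ennreal (\<bar>\<alpha>\<bar> powr (- k)) * (w x * epow (ennreal (d x)) k * indicator \<Omega> x) \<partial>dv)"
      unfolding I1_def
    proof (rule nn_integral_cong_AE)
      show "AE x in dv. w x * epow (equot (\<rho> x) (N x)) k * indicator \<Omega> x =
          ennreal (\<bar>\<alpha>\<bar> powr (- k)) * (w x * epow (ennreal (d x)) k * indicator \<Omega> x)"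
        using AE
      proof eventually_elim
        case (elim x)
        show ?case
        proof (cases "x \<in> \<Omega>")
          case True
          then have dx: "0 < d x" "\<rho> x = d x powr \<alpha>" "N x = \<bar>\<alpha>\<bar> * d x powr (\<alpha> - 1)" using elim by auto
          have "\<rho> x / N x = d x / \<bar>\<alpha>\<bar>" using dx \<alpha> by (simp add: powr_diff)
          moreover have "N x \<noteq> 0" using dx \<alpha> by simp
          ultimately have "epow (equot (\<rho> x) (N x)) k = ennreal ((d x / \<bar>\<alpha>\<bar>) powr k)"
            unfolding equot_def using dx(1) \<alpha> by (simp add: epow_ennreal_pos)
          also have "(d x / \<bar>\<alpha>\<bar>) powr k = \<bar>\<alpha>\<bar> powr (- k) * d x powr k"
            using dx(1) \<alpha> by (simp add: powr_divide powr_minus_divide)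
          also have "ennreal \<dots> = ennreal (\<bar>\<alpha>\<bar> powr (- k)) * epow (ennreal (d x)) k"
            using dx(1) by (simp add: epow_ennreal_pos ennreal_mult)
          finally show ?thesis using True by (simp add: mult_ac)
        qed simp
      qed
    qed
    also have "\<dots> = ennreal (\<bar>\<alpha>\<bar> powr (- k)) * I"
      unfolding I_def
    proof (rule nn_integral_cmult)
      have uC: "C1_manifold u" using u by (simp add: C01_iff)
      have [measurable]: "d \<in> borel_measurable (restrict_space borel \<Omega>)"
        using d by (simp add: has_weak_gradient_def Lp_loc_def)
      note [measurable] = C1_measurable[OF uC]
      have "(\<lambda>x. w x * epow (ennreal (d x)) k) \<in> borel_measurable (restrict_space borel \<Omega>)"
        unfolding w_def by measurable
      then show "(\<lambda>x. w x * epow (ennreal (d x)) k * indicator \<Omega> x) \<in> borel_measurable dv"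
        by (subst (asm) borel_measurable_restrict_space_iff_ennreal) auto
    qed
    finally have I1: "I1 = ennreal (\<bar>\<alpha>\<bar> powr (- k)) * I" .
    have "(\<integral>\<^sup>+ x\<in>\<Omega>. epow (ennreal \<bar>u x\<bar>) s \<partial>dv) \<le>
                ennreal ((p / (\<bar>\<alpha>\<bar> * (p - 1))) powr (p / a)) *
                epow (\<integral>\<^sup>+ x\<in>\<Omega>. epow (ennreal (g_norm A g (grad g u) x)) p \<partial>dv) (1 / a) *
                epow I (1 / a')" if I: "I < \<infinity>"
    proof -
      obtain i where i: "I = ennreal i" "i \<ge> 0" using I by (cases I) auto
      have "I1 < \<infinity>" unfolding I1 i(1) by (simp add: ennreal_mult_less_top)
      then have "(\<integral>\<^sup>+ x\<in>\<Omega>. epow (ennreal \<bar>u x\<bar>) s \<partial>dv) \<le> ennreal ((p / (p - 1)) powr (p / a)) *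
             epow (\<integral>\<^sup>+ x\<in>\<Omega>. epow (ennreal (g_norm A g (grad g u) x)) p \<partial>dv) (1 / a) * epow I1 (1 / a')"
        unfolding I1_def w_def k_def by (rule main[OF u])
      \<comment> \<open>By \<open>k * (1 / a') = p / a\<close> the scaling factor
        \<open>\<bar>\<alpha>\<bar> powr (- k)\<close> enters the constant as
        \<open>\<bar>\<alpha>\<bar> powr (- (p / a))\<close>. As \<open>I\<close> is finite, the
        power may be distributed over the product in the reals.\<close>
      also have "epow I1 (1 / a') = ennreal (\<bar>\<alpha>\<bar> powr (- (p / a))) * epow I (1 / a')"
      proof -
        have "epow I1 (1 / a') = epow (ennreal (\<bar>\<alpha>\<bar> powr (- k) * i)) (1 / a')" by (simp add: I1 i ennreal_mult)
        also have "\<dots> = ennreal ((\<bar>\<alpha>\<bar> powr (- k) * i) powr (1 / a'))" using i ia'0 by (intro epow_ennreal) auto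
        also have "(\<bar>\<alpha>\<bar> powr (- k) * i) powr (1 / a') = \<bar>\<alpha>\<bar> powr (- (k * (1 / a'))) * i powr (1 / a')"
          using i by (simp add: powr_mult powr_powr)
        finally show ?thesis unfolding k(2) using i ia'0 by (simp add: epow_ennreal ennreal_mult)
      qed
      also have "ennreal ((p / (p - 1)) powr (p / a)) * epow (\<integral>\<^sup>+ x\<in>\<Omega>. epow (ennreal (g_norm A g (grad g u) x)) p \<partial>dv) (1 / a) *
          (ennreal (\<bar>\<alpha>\<bar> powr (- (p / a))) * epow I (1 / a')) =
          ennreal ((p / (p - 1)) powr (p / a) * \<bar>\<alpha>\<bar> powr (- (p / a))) * epow (\<integral>\<^sup>+ x\<in>\<Omega>. epow (ennreal (g_norm A g (grad g u) x)) p \<partial>dv) (1 / a) * epow I (1 / a')"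
        by (simp add: ennreal_mult mult_ac)
      also have "(p / (p - 1)) powr (p / a) * \<bar>\<alpha>\<bar> powr (- (p / a)) = (p / (\<bar>\<alpha>\<bar> * (p - 1))) powr (p / a)"
        using p \<alpha> by (simp add: powr_divide powr_mult powr_minus divide_simps)
      finally show ?thesis .
    qed
    then show "let I = (\<integral>\<^sup>+ x\<in>\<Omega>. epow (ennreal \<bar>u x\<bar>) ((a * s - p) / (a - 1)) *
                      epow (ennreal (d x)) (p * (a' - 1)) \<partial>dv)
           in I < \<infinity> \<longrightarrow>
              (\<integral>\<^sup>+ x\<in>\<Omega>. epow (ennreal \<bar>u x\<bar>) s \<partial>dv) \<le>
                ennreal ((p / (\<bar>\<alpha>\<bar> * (p - 1))) powr (p / a)) *
                epow (\<integral>\<^sup>+ x\<in>\<Omega>. epow (ennreal (g_norm A g (grad g u) x)) p \<partial>dv) (1 / a) *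
                epow I (1 / a')"
      unfolding Let_def I_def w_def k_def by blast
  qed
qed

end
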